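(* For a parameter $t>0$, let $(X_{j,k})_{j,k\ge1}$ be independent random variables with $\mathbb{P}_t(X_{j,k}=m)=(1-e^{-jk(j+k)t/2})e^{-jk(j+k)mt/2}$ for $m=0,1,2,\ldots$, let $N=\sum_{j,k\ge1}\tfrac12jk(j+k)X_{j,k}$, and let $\phi_t(u)=\mathbb{E}_t(e^{iuN})$ for $u\in\mathbb{R}$. Let $X=\left(\tfrac19\Gamma(\tfrac13)^2\zeta(\tfrac53)\right)^{3/10}$, $Y=-\sqrt\pi\,\zeta(\tfrac12)\zeta(\tfrac32)$, $\tau_1=2X^2$, $\tau_2=\tfrac{3}{10}X^{-1}Y$, $\tau_3=\tfrac{3}{400}X^{-4}Y^2$, $t_n=\tau_1n^{-3/5}-\tau_2n^{-7/10}-\tau_3n^{-4/5}$, and $\sigma_n=\big(\operatorname{Var}_{t_n}(N)\big)^{1/2}$. Then for each $u\in\mathbb{R}$, $$\phi_{t_n}(u/\sigma_n)\,e^{-inu/\sigma_n}\xrightarrow[n\to\infty]{}e^{-u^2/2}.$$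
   Context: $\mathbb{P}_t$, $\mathbb{E}_t$, $\operatorname{Var}_t$ denote probability, expectation and variance in the model with parameter $t$; $i=\sqrt{-1}$. *)

theory Defs
  imports "HOL-Probability.Probability" "HOL-Complex_Analysis.Complex_Analysis"
    "HOL-Real_Asymp.Real_Asymp"
begin

definition zeta_dom :: "complex set" where
  "zeta_dom = {s. Re s > 0} - {1}"

text \<open>The Riemann zeta function as the analytic continuation of its Dirichlet series. Only the
  half-plane of positive real part is covered, so the values outside \<^const>\<open>zeta_dom\<close> are
  unspecified; inside, existence and uniqueness are \<open>zeta_continuation\<close> and \<open>zeta_unique\<close> below.\<close>

definition zeta :: "complex \<Rightarrow> complex" where
  "zeta = (SOME f. f holomorphic_on zeta_dom \<and>
      (\<forall>s. Re s > 1 \<longrightarrow> f s = (\<Sum>n. 1 / of_nat (Suc n) powr s)))"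

definition zeta_real :: "real \<Rightarrow> real" where
  "zeta_real x = Re (zeta (complex_of_real x))"

definition weight :: "nat \<Rightarrow> nat \<Rightarrow> real" where
  "weight j k = real j * real k * (real j + real k) / 2"

text \<open>For the geometric variables of interest the sum is almost surely finite; on the null set
  of divergence
  \<^const>\<open>infsum\<close> yields 0.\<close>

definition weighted_sum :: "(nat \<Rightarrow> nat \<Rightarrow> 'a \<Rightarrow> nat) \<Rightarrow> 'a \<Rightarrow> real" where
  "weighted_sum X \<omega> = (\<Sum>\<^sub>\<infinity>(j, k)\<in>{1..} \<times> {1..}. weight j k * real (X j k \<omega>))"

definition char_fn :: "'a measure \<Rightarrow> ('a \<Rightarrow> real) \<Rightarrow> real \<Rightarrow> complex" where
  "char_fn M N u = prob_space.expectation M (\<lambda>\<omega>. exp (\<i> * complex_of_real (u * N \<omega>)))"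

definition const_X :: real where
  "const_X = (1 / 9 * (Gamma (1 / 3))\<^sup>2 * zeta_real (5 / 3)) powr (3 / 10)"

definition const_Y :: real where
  "const_Y = - sqrt pi * zeta_real (1 / 2) * zeta_real (3 / 2)"

definition tau1 :: real where "tau1 = 2 * const_X\<^sup>2"

definition tau2 :: real where "tau2 = 3 / 10 * const_X powi (-1) * const_Y"

definition tau3 :: real where "tau3 = 3 / 400 * const_X powi (-4) * const_Y\<^sup>2"

definition t_seq :: "nat \<Rightarrow> real" where
  "t_seq n = tau1 * real n powr (-3/5) - tau2 * real n powr (-7/10) - tau3 * real n powr (-4/5)"

lemma open_zeta_dom: "open zeta_dom"
  unfolding zeta_dom_def by (intro open_delete open_halfspace_Re_gt)

lemma connected_zeta_dom: "connected zeta_dom"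
  unfolding zeta_dom_def
  by (intro connected_open_delete open_halfspace_Re_gt convex_connected convex_halfspace_Re_gt) auto

lemma zeta_term_bound:
  fixes s :: complex
  assumes s: "Re s > 0" "s \<noteq> 1"
  shows "norm (1 / of_nat (Suc n) powr s
          - (of_nat (Suc (Suc n)) powr (1 - s) - of_nat (Suc n) powr (1 - s)) / (1 - s))
         \<le> norm s * real (Suc n) powr (- Re s - 1)"
proof -
  define N where "N = complex_of_nat (Suc n)"
  define S where "S = closed_segment N (N + 1)"
  have S_iff: "x \<in> S \<longleftrightarrow> (\<exists>u. 0 \<le> u \<and> u \<le> 1 \<and> x = complex_of_real (real (Suc n) + u))" for x
    unfolding S_def closed_segment_def N_def by (auto simp: algebra_simps scaleR_conv_of_real)
  have S_Re: "Re x \<ge> real (Suc n)" "x \<notin> \<real>\<^sub>\<le>\<^sub>0" "x \<noteq> 0"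
       "norm x \<ge> real (Suc n)" "x = of_real (norm x)" if x: "x \<in> S" for x
  proof -
    from x obtain u where u: "0 \<le> u" "x = complex_of_real (real (Suc n) + u)"
      unfolding S_iff by blast
    have pos: "real (Suc n) + u > 0" using u(1) by linarith
    show "Re x \<ge> real (Suc n)" using u by simp
    show "norm x \<ge> real (Suc n)" "x = of_real (norm x)"
      using u pos by (simp_all only: norm_of_real abs_of_pos)
    have "Re x > 0" using u pos by simp
    thus "x \<notin> \<real>\<^sub>\<le>\<^sub>0" "x \<noteq> 0" by (auto simp: complex_nonpos_Reals_iff)
  qed
  have cS: "convex S" by (simp add: S_def)
  have NS: "N \<in> S" "N + 1 \<in> S" by (auto simp: S_def)
  have norm_N: "norm N = real (Suc n)" unfolding N_def by (simp only: norm_of_nat)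
  have d: "norm (x - N) \<le> 1" if "x \<in> S" for x
    using segment_bound1[of x N "N+1"] that by (simp add: S_def)
  have d1: "norm (x powr (-s) - N powr (-s)) \<le> norm s * real (Suc n) powr (- Re s - 1)"
    if x: "x \<in> S" for x
  proof -
    have "norm (x powr (-s) - N powr (-s)) \<le> (norm s * real (Suc n) powr (- Re s - 1)) * norm (x - N)"
    proof (rule field_differentiable_bound[OF cS _ _ x NS(1)])
      fix z assume z: "z \<in> S"
      show "((\<lambda>z. z powr (-s)) has_field_derivative (-s) * z powr (-s-1)) (at z within S)"
        using S_Re[OF z] by (auto intro!: derivative_eq_intros)
      have "Re z = norm z" using S_Re(5)[OF z] by (metis Re_complex_of_real)
      moreover have "z \<in> \<real>" using S_Re(5)[OF z] Reals_of_real by metis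
      ultimately have "norm (z powr (-s-1)) = norm z powr Re (-s-1)"
        by (simp add: norm_powr_real_powr)
      also have "\<dots> = norm z powr (- Re s - 1)" by simp
      also have "\<dots> \<le> real (Suc n) powr (- Re s - 1)"
        using S_Re(4)[OF z] s by (intro powr_mono2') auto
      finally show "norm (- s * z powr (- s - 1)) \<le> norm s * real (Suc n) powr (- Re s - 1)"
        by (simp add: norm_mult mult_left_mono)
    qed
    also have "\<dots> \<le> (norm s * real (Suc n) powr (- Re s - 1)) * 1"
      by (intro mult_left_mono d x) auto
    finally show ?thesis by simp
  qed
  define G where "G = (\<lambda>x. N powr (-s) * x - x powr (1 - s) / (1 - s))"
  have "norm (G (N + 1) - G N) \<le> (norm s * real (Suc n) powr (- Re s - 1)) * norm (N + 1 - N)"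
  proof (rule field_differentiable_bound[OF cS _ _ NS(2) NS(1)])
    fix z assume z: "z \<in> S"
    show "(G has_field_derivative (N powr (-s) - z powr (-s))) (at z within S)"
      unfolding G_def using S_Re[OF z] s by (auto intro!: derivative_eq_intros)
    show "norm (N powr (-s) - z powr (-s)) \<le> norm s * real (Suc n) powr (- Re s - 1)"
      using d1[OF z] by (simp add: norm_minus_commute)
  qed
  moreover have "G (N + 1) - G N = 1 / N powr s - ((N + 1) powr (1 - s) - N powr (1 - s)) / (1 - s)"
    unfolding G_def by (simp add: powr_minus inverse_eq_divide distrib_left diff_divide_distrib add_divide_distrib)
  ultimately show ?thesis by (simp add: N_def add.commute)
qed

lemma zeta_exists:
  "\<exists>f. f holomorphic_on zeta_dom \<and>
      (\<forall>s. Re s > 1 \<longrightarrow> f s = (\<Sum>n. 1 / of_nat (Suc n) powr s))"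
proof -
  define a where "a = (\<lambda>n (s::complex). 1 / of_nat (Suc n) powr s
          - (of_nat (Suc (Suc n)) powr (1 - s) - of_nat (Suc n) powr (1 - s)) / (1 - s))"
  define f where "f = (\<lambda>s. 1 / (s - 1) + (\<Sum>n. a n s))"
  have "(\<lambda>s. \<Sum>n. a n s) holomorphic_on zeta_dom"
  proof (rule holomorphic_uniform_sequence[OF open_zeta_dom])
    show "(\<lambda>s. \<Sum>i<n. a i s) holomorphic_on zeta_dom" for n
      unfolding a_def zeta_dom_def
      by (intro holomorphic_intros) (auto simp: powr_def simp del: of_nat_Suc)
  next
    fix x assume x: "x \<in> zeta_dom"
    then obtain d where d: "d > 0" "cball x d \<subseteq> zeta_dom"
      using open_zeta_dom open_contains_cball by blast
    define e where "e = min d (Re x / 2)"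
    have Rx: "Re x > 0" using x by (auto simp: zeta_dom_def)
    have e: "e > 0" "e \<le> d" "e \<le> Re x / 2" using d Rx by (auto simp: e_def)
    have sub: "cball x e \<subseteq> zeta_dom" using d e by (meson order_trans subset_cball)
    have "uniform_limit (cball x e) (\<lambda>n s. \<Sum>i<n. a i s) (\<lambda>s. \<Sum>n. a n s) sequentially"
    proof (rule Weierstrass_m_test)
      fix n s assume s: "s \<in> cball x e"
      have "norm (x - s) \<le> e" using s by (simp add: dist_norm)
      hence "Re x - Re s \<le> e" using abs_Re_le_cmod[of "x - s"] by simp
      hence Rs: "Re s \<ge> Re x / 2" using e by linarith
      have ns: "norm s \<le> norm x + e" using \<open>norm (x - s) \<le> e\<close>
        by (metis add_mono_thms_linordered_semiring(2) norm_minus_commute norm_triangle_sub order_trans)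
      have "norm (a n s) \<le> norm s * real (Suc n) powr (- Re s - 1)"
        unfolding a_def using s sub by (intro zeta_term_bound) (auto simp: zeta_dom_def)
      also have "\<dots> \<le> (norm x + e) * real (Suc n) powr (- Re x / 2 - 1)"
        using ns Rs e by (intro mult_mono powr_mono) auto
      finally show "norm (a n s) \<le> (norm x + e) * real (Suc n) powr (- Re x / 2 - 1)" .
    next
      have "summable (\<lambda>n. real n powr (- Re x / 2 - 1))"
        using Rx by (subst summable_real_powr_iff) auto
      hence "summable (\<lambda>n. real (Suc n) powr (- Re x / 2 - 1))" by (subst summable_Suc_iff)
      thus "summable (\<lambda>n. (norm x + e) * real (Suc n) powr (- Re x / 2 - 1))"
        by (rule summable_mult)
    qed
    thus "\<exists>d>0. cball x d \<subseteq> zeta_dom \<and>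
           uniform_limit (cball x d) (\<lambda>n s. \<Sum>i<n. a i s) (\<lambda>s. \<Sum>n. a n s) sequentially"
      using e(1) sub by blast
  qed
  hence "f holomorphic_on zeta_dom"
    unfolding f_def by (intro holomorphic_intros) (auto simp: zeta_dom_def)
  moreover have "f s = (\<Sum>n. 1 / of_nat (Suc n) powr s)" if s: "Re s > 1" for s
  proof -
    have s1: "s \<noteq> 1" using s by auto
    have norm_Suc: "norm (complex_of_nat (Suc n) powr w) = real (Suc n) powr Re w" for n w
      by (subst norm_powr_real_powr) auto
    have "summable (\<lambda>n. real n powr (- Re s))"
      using s by (subst summable_real_powr_iff) auto
    hence "summable (\<lambda>n. real (Suc n) powr (- Re s))" by (subst summable_Suc_iff)
    hence "summable (\<lambda>n. norm (complex_of_nat (Suc n) powr (-s)))"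
      by (simp only: norm_Suc uminus_complex.simps)
    hence "summable (\<lambda>n. complex_of_nat (Suc n) powr (-s))" by (rule summable_norm_cancel)
    hence 1: "(\<lambda>n. 1 / of_nat (Suc n) powr s) sums (\<Sum>n. 1 / of_nat (Suc n) powr s)"
      by (simp add: powr_minus inverse_eq_divide summable_sums)
    have "((\<lambda>n. real (Suc n) powr (1 - Re s)) \<longlongrightarrow> 0) sequentially"
      using s by real_asymp
    moreover have "norm (complex_of_nat (Suc n) powr (1 - s)) = real (Suc n) powr (1 - Re s)" for n
      by (simp only: norm_Suc minus_complex.simps one_complex.simps)
    ultimately have "(\<lambda>n. complex_of_nat (Suc n) powr (1 - s)) \<longlonglongrightarrow> 0"
      by (subst tendsto_norm_zero_iff[symmetric]) (simp only:)
    from telescope_sums[OF this]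
    have "(\<lambda>n. of_nat (Suc (Suc n)) powr (1 - s) - of_nat (Suc n) powr (1 - s))
            sums (0 - complex_of_nat (Suc 0) powr (1 - s))" .
    hence 2: "(\<lambda>n. (of_nat (Suc (Suc n)) powr (1 - s) - of_nat (Suc n) powr (1 - s)) / (1 - s))
            sums (-1 / (1 - s))"
      by (intro sums_divide) simp
    have "(\<lambda>n. a n s) sums ((\<Sum>n. 1 / of_nat (Suc n) powr s) - (-1 / (1 - s)))"
      unfolding a_def by (intro sums_diff 1 2)
    hence "(\<Sum>n. a n s) = (\<Sum>n. 1 / of_nat (Suc n) powr s) - (-1 / (1 - s))"
      by (rule sums_unique[symmetric])
    moreover have "1 / (s - 1) = -1 / (1 - s)" using s1 by (simp add: field_simps)
    ultimately show ?thesis unfolding f_def by simp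
  qed
  ultimately show ?thesis by blast
qed

lemma zeta_continuation:
  shows "zeta holomorphic_on zeta_dom"
    and "Re s > 1 \<Longrightarrow> zeta s = (\<Sum>n. 1 / of_nat (Suc n) powr s)"
  using someI_ex[OF zeta_exists] unfolding zeta_def[symmetric] by blast+

lemma zeta_unique:
  assumes "f holomorphic_on zeta_dom"
    and "\<And>s. Re s > 1 \<Longrightarrow> f s = (\<Sum>n. 1 / of_nat (Suc n) powr s)"
    and "s \<in> zeta_dom"
  shows "zeta s = f s"
proof (rule analytic_continuation_open[of "{s. Re s > 1}" zeta_dom zeta f])
  show "{s::complex. Re s > 1} \<noteq> {}" by (auto intro: exI[of _ 2])
  show "{s. Re s > 1} \<subseteq> zeta_dom" by (auto simp: zeta_dom_def)
qed (use assms zeta_continuation open_zeta_dom connected_zeta_dom open_halfspace_Re_gt in auto)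

end

theory Submission
  imports Defs
begin

text \<open>
  Write \<open>w = j k (j + k) / 2\<close>. The mean of \<open>N\<close> satisfies
  \<open>t \<mu>(t) = \<Sum>\<^sub>w w t / (exp (w t) - 1) = \<Sum>\<^sub>m G (m t) / m\<close> with \<open>G t = \<Sum>\<^sub>w w t exp (- w t)\<close>.
  By symmetry \<open>G\<close> is twice a sum over \<open>k\<close> of trapezoidal sums over \<open>j \<ge> k\<close>. The trapezoidal rule replaces
  each of them by an integral that is explicit in terms of the Gaussian error function, and a second
  application of the trapezoidal rule, to that integral as a function of \<open>k\<close> with its
  singularity \<open>k powr (-1/2)\<close> split off, gives
  \<open>G t = A t powr (-2/3) + B t powr (-1/2) + O (t powr (-1/4))\<close> uniformly in \<open>t > 0\<close>; the singularity accounts for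
  the factor \<open>\<zeta>(1/2)\<close> of \<open>B\<close>. Summing over \<open>m\<close> produces
  \<open>\<mu>(t)\<close> up to \<open>O (t powr (-5/4))\<close>, and at \<open>t = t\<^sub>n\<close> this is \<open>n + o (n powr (4/5))\<close>.
  The variance \<open>V\<close> is at least \<open>\<mu>(t) / t\<close>, hence of order at least \<open>n powr (8/5)\<close>, while the third absolute central
  moments add up to \<open>O (t powr (-2) \<mu>(t/2)) = O (n powr (11/5))\<close>, so that Lyapunov's argument yields the
  normal limit after centring at \<open>\<mu>(t\<^sub>n)\<close>; the error \<open>(\<mu>(t\<^sub>n) - n) / sqrt V\<close> made in centring
  at \<open>n\<close> instead tends to 0.
\<close>

section \<open>The trapezoidal rule\<close>

text \<open>The precision required is set by \<open>n powr (4/5)\<close>, a lower bound for the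
  order of the standard deviation at \<open>t_seq n\<close>: errors of smaller order in the mean
  disappear after normalisation. As \<open>t_seq n\<close> has order \<open>n powr (-3/5)\<close>,
  an error \<open>t powr (-c)\<close> in \<open>G\<close> becomes
  \<open>n powr (3 * (1 + c) / 5)\<close> in the mean, which is small enough exactly for
  \<open>c < 1/3\<close>, while the sum over \<open>m\<close> needs \<open>c > 0\<close>. The
  exponent \<open>1/4\<close> is a convenient choice in between. A term
  \<open>t powr (-1/3)\<close>, the natural contribution of the diagonal, would just fail. The same
  count explains \<open>tau3\<close>: its relative size \<open>n powr (-1/5)\<close> shifts the mean
  by the order \<open>n powr (4/5)\<close>, and a further correction would shift it by less. Since
  \<open>G\<close> is evaluated at all multiples \<open>m t\<close>, small and large, every estimate
  must hold for all \<open>t > 0\<close> with one constant. Exponentials are therefore weakened to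
  powers: the power of \<open>t\<close> is fixed at \<open>-1/4\<close>, and what freedom remains is
  spent on summability over the rows.\<close>

lemma trapezoid_error:
  fixes f f' f'' :: "real \<Rightarrow> real"
  assumes f: "\<And>x. x \<in> {a..a+1} \<Longrightarrow> (f has_real_derivative f' x) (at x)"
    and f': "\<And>x. x \<in> {a..a+1} \<Longrightarrow> (f' has_real_derivative f'' x) (at x)"
    and M: "\<And>x. x \<in> {a..a+1} \<Longrightarrow> \<bar>f'' x\<bar> \<le> M"
  shows "\<bar>(f a + f (a+1)) / 2 - integral {a..a+1} f\<bar> \<le> M"
proof -
  define F where "F = (\<lambda>x. integral {a..x} f)"
  \<comment> \<open>The trapezoidal error on \<open>{a..x}\<close> as a function of
    \<open>x\<close>. It vanishes at \<open>a\<close>, and two uses of the mean value theorem turn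
    its derivative into \<open>f''\<close> times two factors of size at most 1. The constant 1
    instead of the sharp \<open>1/12\<close> is good enough.\<close>
  define E where "E = (\<lambda>x. (x - a) / 2 * (f a + f x) - F x)"
  define E' where "E' = (\<lambda>x. (f a + f x) / 2 + (x - a) / 2 * f' x - f x)"
  have "continuous_on {a..a+1} f"
    using f by (intro continuous_at_imp_continuous_on ballI DERIV_isCont) 
  hence F: "(F has_real_derivative f x) (at x within {a..a+1})" if "x \<in> {a..a+1}" for x
    unfolding F_def using that by (intro integral_has_real_derivative)
  have E: "(E has_real_derivative E' x) (at x within {a..a+1})" if "x \<in> {a..a+1}" for x
    unfolding E_def E'_def
    by (auto intro!: derivative_eq_intros F[OF that] DERIV_subset[OF f[OF that] subset_UNIV])
  have M0: "M \<ge> 0" using M[of a] by force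
  have E'_le: "\<bar>E' x\<bar> \<le> M" if x: "x \<in> {a..a+1}" for x
  proof (cases "x = a")
    case True thus ?thesis using M0 by (simp add: E'_def)
  next
    case False
    hence ax: "a < x" "x \<le> a + 1" using x by auto
    from MVT2[of a x f f'] obtain z where z: "a < z" "z < x" "f x - f a = (x - a) * f' z"
      using ax f by force
    from MVT2[of z x f' f''] obtain w where w: "z < w" "w < x" "f' x - f' z = (x - z) * f'' w"
      using z ax f' by force
    have "E' x = (x - a) / 2 * (f' x - f' z)"
      unfolding E'_def using z(3) by (simp add: field_simps)
    also have "\<dots> = (x - a) / 2 * (x - z) * f'' w" using w by simp
    finally have "\<bar>E' x\<bar> = \<bar>(x - a) / 2 * (x - z) * f'' w\<bar>" by (rule arg_cong)
    also have "\<dots> = (x - a) / 2 * (x - z) * \<bar>f'' w\<bar>"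
      using ax z by (subst abs_mult) simp
    also have "\<dots> \<le> 1 * 1 * M"
      using ax z w by (intro mult_mono M) auto
    finally show ?thesis by simp
  qed
  have "norm (E (a + 1) - E a) \<le> M * norm (a + 1 - a)"
    by (rule field_differentiable_bound[of "{a..a+1}" E E' M]) (use E E'_le in auto)
  thus ?thesis by (simp add: E_def F_def)
qed

text \<open>The interior nodes are counted by two neighbouring intervals and the first node by one,
  hence \<open>f a / 2\<close>. The total error \<open>e\<close> is kept as an exact value rather
  than a bound, because for the integrals over the rows it contains a term of the final
  expansion.\<close>

lemma trapezoid_sums:
  fixes f :: "real \<Rightarrow> real"
  assumes cont: "continuous_on {a..} f"
    and I: "(\<lambda>n. integral {a..a + real n} f) \<longlonglongrightarrow> I"
    and f0: "(\<lambda>n. f (a + real n)) \<longlonglongrightarrow> 0"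
    and e: "(\<lambda>i. (f (a + real i) + f (a + real i + 1)) / 2 
               - integral {a + real i..a + real i + 1} f) sums e"
  shows "(\<lambda>i. f (a + real i)) sums (I + f a / 2 + e)"
proof -
  define d where "d = (\<lambda>i. (f (a + real i) + f (a + real i + 1)) / 2 
               - integral {a + real i..a + real i + 1} f)"
  have part: "(\<Sum>i<n. d i) = (\<Sum>i<n. f (a + real i)) + (f (a + real n) - f a) / 2 
      - integral {a..a + real n} f" for n
  proof (induction n)
    case (Suc n)
    have "integral {a..a + real n} f + integral {a + real n..a + real n + 1} f 
        = integral {a..a + real n + 1} f"
      by (rule Henstock_Kurzweil_Integration.integral_combine) 
         (auto intro!: integrable_continuous_real continuous_on_subset[OF cont])
    thus ?case using Suc by (simp add: d_def field_simps)
  qed simp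
  have "(\<lambda>n. integral {a..a + real n} f - (f (a + real n) - f a) / 2 + (\<Sum>i<n. d i))
          \<longlonglongrightarrow> I - (0 - f a) / 2 + e"
    using e by (intro tendsto_intros I f0) (simp_all add: sums_def d_def)
  thus ?thesis unfolding sums_def by (simp add: part)
qed

lemma trapezoid_sum:
  fixes f f' f'' :: "real \<Rightarrow> real"
  assumes f: "\<And>x. x \<ge> a \<Longrightarrow> (f has_real_derivative f' x) (at x)"
    and f': "\<And>x. x \<ge> a \<Longrightarrow> (f' has_real_derivative f'' x) (at x)"
    and M: "\<And>i x. x \<in> {a+real i..a+real i+1} \<Longrightarrow> \<bar>f'' x\<bar> \<le> M i"
    and sM: "summable M"
    and I: "(\<lambda>n. integral {a..a + real n} f) \<longlonglongrightarrow> I"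
    and f0: "(\<lambda>n. f (a + real n)) \<longlonglongrightarrow> 0"
  shows "summable (\<lambda>i. f (a + real i))"
    and "\<bar>(\<Sum>i. f (a + real i)) - f a / 2 - I\<bar> \<le> suminf M"
proof -
  define e where "e = (\<lambda>i. (f (a + real i) + f (a + real i + 1)) / 2 
      - integral {a + real i..a + real i + 1} f)"
  have e: "\<bar>e i\<bar> \<le> M i" for i
    unfolding e_def by (rule trapezoid_error[of _ _ f' f'']) (use f f' M in auto)
  have cont: "continuous_on {a..} f"
    using f by (intro continuous_at_imp_continuous_on ballI) (auto intro: DERIV_isCont)
  have se: "summable e" using e sM by (intro summable_comparison_test'[of M 0 e]) auto
  have "(\<lambda>i. f (a + real i)) sums (I + f a / 2 + suminf e)"
    by (intro trapezoid_sums cont I f0) (use se in \<open>simp add: e_def summable_sums\<close>)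
  hence *: "summable (\<lambda>i. f (a + real i))" "(\<Sum>i. f (a + real i)) = I + f a / 2 + suminf e"
    by (auto simp: sums_iff)
  show "summable (\<lambda>i. f (a + real i))" by fact
  have "\<bar>suminf e\<bar> \<le> suminf M" 
    using e sM by (intro norm_suminf_le[where f=e, unfolded real_norm_def]) auto
  thus "\<bar>(\<Sum>i. f (a + real i)) - f a / 2 - I\<bar> \<le> suminf M" by (simp add: *)
qed

lemma powr_exp_neg_bounded:
  fixes p a :: real
  assumes "p \<ge> 0" "a > 0"
  obtains C where "C > 0" "\<And>x. x > 0 \<Longrightarrow> exp (- (a * x)) \<le> C * x powr (- p)"
proof -
  have "((\<lambda>x::real. x powr p * exp (- (a * x))) \<longlongrightarrow> 0) at_top"
    using assms by real_asymp
  hence "\<forall>\<^sub>F x in at_top. x powr p * exp (- (a * x)) < 1"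
    by (rule order_tendstoD) simp
  then obtain N where N: "\<And>x. x \<ge> N \<Longrightarrow> x powr p * exp (- (a * x)) < 1"
    by (auto simp: eventually_at_top_linorder)
  define C where "C = max 1 (max N 0 powr p)"
  have "exp (- (a * x)) \<le> C * x powr (- p)" if x: "x > 0" for x
  proof -
    have "x powr p * exp (- (a * x)) \<le> C"
    proof (cases "x \<ge> N")
      case True thus ?thesis using N[OF True] by (simp add: C_def)
    next
      case False
      have "x powr p * exp (- (a * x)) \<le> max N 0 powr p * 1"
        using False x assms by (intro mult_mono powr_mono2) auto
      thus ?thesis by (simp add: C_def)
    qed
    thus ?thesis using x by (simp add: powr_minus field_simps)
  qed
  thus ?thesis using that[of C] by (simp add: C_def)
qed

section \<open>A Gaussian profile function\<close>

text \<open>This is the error function times \<open>sqrt pi / 2\<close>.\<close>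

definition gauss_prim :: "real \<Rightarrow> real" where
  "gauss_prim x = (LBINT r=0..x. exp (- r\<^sup>2))"

lemma gauss_prim_deriv: "(gauss_prim has_real_derivative exp (- x\<^sup>2)) (at x)"
proof -
  \<comment> \<open>The interval contains both 0 and \<open>x\<close> in its interior, so the
    derivative within it is a full derivative whatever the sign of \<open>x\<close>.\<close>
  have "((\<lambda>u. LBINT r=0..u. exp (- r\<^sup>2)) has_vector_derivative exp (- x\<^sup>2)) 
          (at x within {- \<bar>x\<bar> - 1..\<bar>x\<bar> + 1})"
    unfolding zero_ereal_def
    by (rule interval_integral_FTC2) (auto intro!: continuous_intros)
  hence "(gauss_prim has_real_derivative exp (- x\<^sup>2)) (at x within {- \<bar>x\<bar> - 1..\<bar>x\<bar> + 1})"
    by (simp add: gauss_prim_def[abs_def] has_real_derivative_iff_has_vector_derivative zero_ereal_def)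
  moreover have "x \<in> interior {- \<bar>x\<bar> - 1..\<bar>x\<bar> + 1}" by auto
  ultimately show ?thesis by (metis at_within_interior)
qed

lemma gauss_prim_lim: "(gauss_prim \<longlongrightarrow> sqrt pi / 2) at_top"
proof -
  have A: "((\<lambda>b. LBINT x:{..b}. indicator {0..} x *\<^sub>R exp (- x\<^sup>2)) \<longlongrightarrow> 
          (LBINT x. indicator {0..} x *\<^sub>R exp (- x\<^sup>2 :: real))) at_top"
    using gaussian_moment_0 unfolding set_lebesgue_integral_def
    by (intro tendsto_integral_at_top) (auto simp: has_bochner_integral_iff)
  have B: "(LBINT x. indicator {0..} x *\<^sub>R exp (- x\<^sup>2 :: real)) = sqrt pi / 2"
    using gaussian_moment_0 by (simp add: has_bochner_integral_iff)
  have C: "\<forall>\<^sub>F b in at_top. (LBINT x:{..b}. indicator {0..} x *\<^sub>R exp (- x\<^sup>2)) = gauss_prim b"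
    using eventually_ge_at_top[of 0]
  proof eventually_elim
    case (elim b)
    have "gauss_prim b = (LBINT x:{0..b}. exp (- x\<^sup>2))"
      using elim by (simp add: gauss_prim_def zero_ereal_def interval_integral_Icc)
    also have "\<dots> = (LBINT x:{..b}. indicator {0..} x *\<^sub>R exp (- x\<^sup>2))"
      unfolding set_lebesgue_integral_def by (intro Bochner_Integration.integral_cong) (auto simp: indicator_def)
    finally show ?case by simp
  qed
  show ?thesis using A unfolding B tendsto_cong[OF C] .
qed

lemma gauss_prim_bounds:
  assumes "x \<ge> 0"
  shows "gauss_prim x \<le> sqrt pi / 2" and "sqrt pi / 2 - gauss_prim x \<le> 3 * exp (- x\<^sup>2)"
proof -
  have mono: "gauss_prim x \<le> gauss_prim y" if "x \<le> y" for x y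
    using that by (intro DERIV_nonneg_imp_nondecreasing[of x y gauss_prim]) (auto intro!: exI gauss_prim_deriv)
  show "gauss_prim x \<le> sqrt pi / 2"
    by (rule tendsto_lowerbound[OF gauss_prim_lim])
       (auto intro: eventually_mono[OF eventually_ge_at_top[of x]] mono)
  show "sqrt pi / 2 - gauss_prim x \<le> 3 * exp (- x\<^sup>2)"
  proof (cases "x \<le> 1 / 2")
    case True
    have "x * x \<le> (1 / 2) * (1/2)" using True assms by (intro mult_mono) auto
    hence "1 / 2 \<le> exp (- x\<^sup>2)" using exp_ge_add_one_self[of "- x\<^sup>2"] by (simp add: power2_eq_square)
    moreover have "gauss_prim x \<ge> gauss_prim 0" using assms by (intro mono)
    moreover have "gauss_prim 0 = 0" by (simp add: gauss_prim_def zero_ereal_def)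
    moreover have "sqrt pi \<le> 2" using pi_less_4 real_sqrt_le_mono[of pi 4] by simp
    ultimately show ?thesis by linarith
  next
    case False
    \<comment> \<open>The derivative of \<open>D\<close> has the sign of \<open>1 - 6 * y\<close>,
      so \<open>D\<close> decreases beyond \<open>1/2\<close>, and its limit
      \<open>sqrt pi / 2\<close> is a lower bound there. Below \<open>1/2\<close> the claim is
      trivial since \<open>3 * exp (- x\<^sup>2)\<close> exceeds 1.\<close>
    define D where "D = (\<lambda>x. 3 * exp (- x\<^sup>2) + gauss_prim x)"
    have D: "(D has_real_derivative exp (- y\<^sup>2) * (1 - 6 * y)) (at y)" for y
      unfolding D_def by (auto intro!: derivative_eq_intros gauss_prim_deriv simp: algebra_simps)
    have dec: "D y \<le> D x" if "x \<le> y" for y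
      using that False by (intro DERIV_nonpos_imp_nonincreasing[of x y D]) 
        (auto intro!: exI[of _ "exp (- _\<^sup>2) * (1 - 6 * _)"] D mult_nonneg_nonpos)
    have "((\<lambda>x::real. 3 * exp (- x\<^sup>2)) \<longlongrightarrow> 0) at_top" by real_asymp
    hence "(D \<longlongrightarrow> 0 + sqrt pi / 2) at_top"
      unfolding D_def by (intro tendsto_add gauss_prim_lim)
    hence "0 + sqrt pi / 2 \<le> D x"
      by (rule tendsto_upperbound) (auto intro: eventually_mono[OF eventually_ge_at_top[of x]] dec)
    thus ?thesis by (simp add: D_def)
  qed
qed

text \<open>This is \<open>\<integral>\<^sub>0\<^sup>\<infinity> exp (- (u + q) (u + 2 q) / 2) du\<close> in closed form.\<close>

definition gauss_tail :: "real \<Rightarrow> real" where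
  "gauss_tail q = sqrt 2 * exp (q\<^sup>2 / 8) * (sqrt pi / 2 - gauss_prim (3 * q / (2 * sqrt 2)))"

text \<open>The growing factor \<open>exp (q\<^sup>2 / 8)\<close> is absorbed: the argument of
  \<open>gauss_prim\<close> has square \<open>9 * q\<^sup>2 / 8\<close>, and the difference of the
  two exponents is \<open>q\<^sup>2\<close>.\<close>

lemma gauss_tail_bounds:
  assumes "q \<ge> 0"
  shows "0 \<le> gauss_tail q" "gauss_tail q \<le> 6 * exp (- q\<^sup>2)"
proof -
  let ?x = "3 * q / (2 * sqrt 2)"
  have x: "?x \<ge> 0" "?x\<^sup>2 = 9 * q\<^sup>2 / 8" using assms by (auto simp: power2_eq_square)
  show "0 \<le> gauss_tail q"
    unfolding gauss_tail_def using gauss_prim_bounds(1)[OF x(1)] by simp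
  have "gauss_tail q \<le> sqrt 2 * exp (q\<^sup>2 / 8) * (3 * exp (- ?x\<^sup>2))"
    unfolding gauss_tail_def by (intro mult_left_mono gauss_prim_bounds(2) x) auto
  also have "\<dots> = 3 * sqrt 2 * exp (- q\<^sup>2)"
    by (simp add: x(2) exp_add[symmetric] field_simps)
  also have "\<dots> \<le> 6 * exp (- q\<^sup>2)"
    using real_sqrt_le_mono[of 2 4] by simp
  finally show "gauss_tail q \<le> 6 * exp (- q\<^sup>2)" .
qed

text \<open>Because of this linear differential equation, differentiation preserves the span of
  polynomial multiples of \<open>exp (- q\<^sup>2)\<close> and of \<open>gauss_tail q\<close>. The
  formulas for \<open>profile'\<close> and \<open>profile''\<close> arise in this way.\<close>

lemma gauss_tail_deriv:
  "(gauss_tail has_real_derivative q / 4 * gauss_tail q - 3 / 2 * exp (- q\<^sup>2)) (at q)"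
proof -
  define c :: real where "c = 3 / (2 * sqrt 2)"
  have c: "c\<^sup>2 = 9 / 8" "sqrt 2 * c = 3 / 2" by (auto simp: c_def power2_eq_square)
  have tail: "gauss_tail = (\<lambda>q. sqrt 2 * exp (q\<^sup>2 / 8) * (sqrt pi / 2 - gauss_prim (c * q)))"
    by (auto simp: gauss_tail_def c_def)
  have 1: "((\<lambda>q. gauss_prim (c * q)) has_real_derivative exp (- (c * q)\<^sup>2) * c) (at q)"
    by (rule DERIV_chain2[OF gauss_prim_deriv]) (auto intro!: derivative_eq_intros)
  have 2: "((\<lambda>q. exp (q\<^sup>2 / 8)) has_real_derivative exp (q\<^sup>2 / 8) * (q / 4)) (at q)"
    by (auto intro!: derivative_eq_intros)
  have "(gauss_tail has_real_derivative sqrt 2 * (exp (q\<^sup>2 / 8) * (q / 4)) * (sqrt pi / 2 - gauss_prim (c * q))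
      + sqrt 2 * exp (q\<^sup>2 / 8) * (0 - exp (- (c * q)\<^sup>2) * c)) (at q)"
    unfolding tail by (intro DERIV_mult' DERIV_cmult DERIV_diff DERIV_const 1 2 [THEN DERIV_cmult] | 
        (rule DERIV_cong, rule DERIV_mult', rule DERIV_cmult, rule 2, rule DERIV_diff, rule DERIV_const, rule 1, simp))
  also have "sqrt 2 * exp (q\<^sup>2 / 8) * (0 - exp (- (c * q)\<^sup>2) * c) 
      = - ((sqrt 2 * c) * (exp (q\<^sup>2 / 8) * exp (- (c * q)\<^sup>2)))" by simp
  also have "exp (q\<^sup>2 / 8) * exp (- (c * q)\<^sup>2) = exp (- q\<^sup>2)"
    unfolding exp_add[symmetric] power_mult_distrib c by simp
  finally show ?thesis unfolding c(2) by (simp add: tail mult_ac)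
qed

text \<open>The closed form of \<open>\<integral>\<^sub>q\<^sup>\<infinity> f (u (u + q) / 2) du\<close> for \<open>f x = x exp (- x)\<close>, to which the integral over a row of the double
  sum is reduced by the substitution \<open>x = u / sqrt (t y)\<close>.\<close>

definition profile :: "real \<Rightarrow> real" where
  "profile q = 3 * q / 4 * exp (- q\<^sup>2) + (1 / 2 - q\<^sup>2 / 8) * gauss_tail q"

definition profile' :: "real \<Rightarrow> real" where
  "profile' q = - (21 / 16 * q\<^sup>2 * exp (- q\<^sup>2)) - (q / 8 + q ^ 3 / 32) * gauss_tail q"

definition profile'' :: "real \<Rightarrow> real" where
  "profile'' q = (- (21 / 8 * q) + 21 / 8 * q ^ 3) * exp (- q\<^sup>2) - (1 / 8 + 3 * q\<^sup>2 / 32) * gauss_tail q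
     - (q / 8 + q ^ 3 / 32) * (q / 4 * gauss_tail q - 3 / 2 * exp (- q\<^sup>2))"

lemma profile_0: "profile 0 = sqrt (pi / 2) / 2"
  by (simp add: profile_def gauss_tail_def gauss_prim_def zero_ereal_def real_sqrt_divide field_simps)

lemma profile_deriv: "(profile has_real_derivative profile' q) (at q)"
  unfolding profile_def[abs_def] profile'_def
  apply (auto intro!: derivative_eq_intros gauss_tail_deriv)
  apply (simp add: field_simps power2_eq_square power3_eq_cube)
  done

lemma profile'_deriv: "(profile' has_real_derivative profile'' q) (at q)"
  unfolding profile'_def[abs_def] profile''_def
  apply (auto intro!: derivative_eq_intros gauss_tail_deriv)
  apply (simp add: field_simps power2_eq_square power3_eq_cube)
  done

lemma power_exp_neg_square_le:
  fixes p :: real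
  assumes "real n + p \<ge> 0"
  obtains C where "C > 0" "\<And>q. q > 0 \<Longrightarrow> q ^ n * exp (- q\<^sup>2) \<le> C * q powr (- p)"
proof -
  obtain C where C: "C > 0" "\<And>x. x > 0 \<Longrightarrow> exp (- (1 * x)) \<le> C * x powr (- ((real n + p) / 2))"
    using powr_exp_neg_bounded[of "(real n + p) / 2" 1] assms by auto
  have "q ^ n * exp (- q\<^sup>2) \<le> C * q powr (- p)" if q: "q > 0" for q
  proof -
    have "exp (- q\<^sup>2) \<le> C * (q powr 2) powr (- ((real n + p) / 2))"
      using C(2)[of "q\<^sup>2"] q by simp
    also have "\<dots> = C * q powr (2 * - ((real n + p) / 2))" by (simp only: powr_powr)
    also have "2 * - ((real n + p) / 2) = - real n - p" by (simp add: field_simps)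
    finally have "q ^ n * exp (- q\<^sup>2) \<le> q ^ n * (C * q powr (- real n - p))"
      using q by (intro mult_left_mono) auto
    also have "\<dots> = C * (q powr real n * q powr (- real n - p))" using q by (simp add: powr_realpow)
    also have "\<dots> = C * q powr (- p)" by (simp add: powr_add[symmetric])
    finally show ?thesis .
  qed
  thus ?thesis using C that by blast
qed

lemma profile_poly_bounds:
  assumes q: "q > 0"
  shows "\<bar>profile q\<bar> \<le> 30 * (1 + q ^ 4) * exp (- q\<^sup>2)"
    and "\<bar>profile' q\<bar> \<le> 30 * (q + q ^ 4) * exp (- q\<^sup>2)"
    and "\<bar>profile'' q\<bar> \<le> 30 * (1 + q ^ 4) * exp (- q\<^sup>2)"
proof -
  define e where "e = exp (- q\<^sup>2)"
  define T where "T = gauss_tail q"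
  have e: "e > 0" by (simp add: e_def)
  have T: "0 \<le> T" "T \<le> 6 * e" using gauss_tail_bounds[of q] q by (auto simp: T_def e_def)
  have pw: "q \<le> 1 + q^4" "q\<^sup>2 \<le> 1 + q^4" "q^3 \<le> 1 + q^4" "q\<^sup>2 \<le> q + q^4" "q^3 \<le> q + q^4" "q^4 > 0"
  proof -
    show "q^4 > 0" using q by simp
    have "q^n \<le> q^m + q^4" if "m \<le> n" "n \<le> 4" for m n
    proof (cases "q \<le> 1")
      case True
      hence "q^n \<le> q^m" using q that by (intro power_decreasing) auto
      thus ?thesis using q by (simp add: add_increasing2)
    next
      case False
      hence "q^n \<le> q^4" using q that by (intro power_increasing) auto
      thus ?thesis using q by (simp add: add_increasing)
    qed
    from this[of 0 1] this[of 0 2] this[of 0 3] this[of 1 2] this[of 1 3]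
    show "q \<le> 1 + q^4" "q\<^sup>2 \<le> 1 + q^4" "q^3 \<le> 1 + q^4" "q\<^sup>2 \<le> q + q^4" "q^3 \<le> q + q^4" by auto
  qed
  \<comment> \<open>Here \<open>a\<close>, \<open>b\<close>, \<open>c\<close>, \<open>d\<close>
    stand for the first four powers of \<open>q\<close>. Once \<open>gauss_tail q\<close> is
    replaced by \<open>6 * exp (- q\<^sup>2)\<close>, only linear comparisons between these powers
    are left, and 30 is a generous bound for the coefficients.\<close>
  have lin: "3 * a / 4 + 3 + 3 / 4 * b \<le> 30 * (1 + d)" 
    "21 / 16 * b + 6 / 8 * a + 6 / 32 * c \<le> 30 * (a + d)" 
    "21 / 8 * a + 21 / 8 * c + 6 / 8 + 18 / 32 * b + 6 / 32 * b + 6 / 128 * d + 3 / 16 * a + 3 / 64 * c \<le> 30 * (1 + d)"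
    if "a \<le> 1 + d" "b \<le> 1 + d" "c \<le> 1 + d" "b \<le> a + d" "c \<le> a + d" "d > 0" "a > 0" for a b c d :: real
    by (insert that) argo+
  have mT: "a * T \<le> 6 * a * e" if "a \<ge> 0" for a using mult_left_mono[OF T(2) that] by (simp add: algebra_simps)
  have "\<bar>profile q\<bar> \<le> 3 * q / 4 * e + (1 / 2 + q\<^sup>2 / 8) * T"
  proof -
    have "\<bar>profile q\<bar> \<le> \<bar>3 * q / 4 * e\<bar> + \<bar>1 / 2 - q\<^sup>2 / 8\<bar> * \<bar>T\<bar>"
      unfolding profile_def e_def[symmetric] T_def[symmetric] abs_mult[symmetric] by (rule abs_triangle_ineq)
    also have "\<dots> \<le> 3 * q / 4 * e + (1 / 2 + q\<^sup>2 / 8) * T"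
      using q e T by (intro add_mono mult_mono) (auto simp: abs_le_iff)
    finally show ?thesis .
  qed
  also have "\<dots> \<le> 3 * q / 4 * e + 6 * (1 / 2 + q\<^sup>2 / 8) * e"
    by (intro add_left_mono mT) auto
  also have "\<dots> = (3 * q / 4 + 3 + 3 / 4 * q\<^sup>2) * e" by (simp add: algebra_simps)
  also have "\<dots> \<le> (30 * (1 + q^4)) * e"
    by (rule mult_right_mono[OF lin(1)[OF pw q] order_less_imp_le[OF e]])
  finally show "\<bar>profile q\<bar> \<le> 30 * (1 + q ^ 4) * exp (- q\<^sup>2)" by (simp add: e_def)
  have "\<bar>profile' q\<bar> = 21 / 16 * q\<^sup>2 * e + (q / 8 + q ^ 3 / 32) * T"
  proof -
    have "profile' q = - (21 / 16 * q\<^sup>2 * e + (q / 8 + q ^ 3 / 32) * T)"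
      by (simp add: profile'_def e_def T_def)
    moreover have "21 / 16 * q\<^sup>2 * e + (q / 8 + q ^ 3 / 32) * T \<ge> 0"
      using q e T by (intro add_nonneg_nonneg mult_nonneg_nonneg) auto
    ultimately show ?thesis by linarith
  qed
  also have "\<dots> \<le> 21 / 16 * q\<^sup>2 * e + 6 * (q / 8 + q ^ 3 / 32) * e"
    using q by (intro add_left_mono mT) auto
  also have "\<dots> = (21 / 16 * q\<^sup>2 + 6 / 8 * q + 6 / 32 * q ^ 3) * e" by (simp add: algebra_simps)
  also have "\<dots> \<le> (30 * (q + q^4)) * e"
    by (rule mult_right_mono[OF lin(2)[OF pw q] order_less_imp_le[OF e]])
  finally show "\<bar>profile' q\<bar> \<le> 30 * (q + q ^ 4) * exp (- q\<^sup>2)" by (simp add: e_def)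
  have "\<bar>profile'' q\<bar> \<le> 21 / 8 * q * e + 21 / 8 * q^3 * e + (1 / 8 + 3 * q\<^sup>2 / 32) * T
          + (q / 8 + q ^ 3 / 32) * (q / 4) * T + (q / 8 + q ^ 3 / 32) * (3 / 2) * e" (is "_ \<le> ?a + ?b + ?c + ?d + ?f")
  proof -
    have "profile'' q = - ?a + ?b - ?c - ?d + ?f"
      by (simp add: profile''_def e_def T_def algebra_simps)
    moreover have "?a \<ge> 0" "?b \<ge> 0" "?c \<ge> 0" "?d \<ge> 0" "?f \<ge> 0"
      using q e T by (auto intro!: add_nonneg_nonneg mult_nonneg_nonneg)
    moreover have "\<bar>x\<bar> \<le> a + b + c + d + f" 
      if "x = - a + b - c - d + f" "a \<ge> 0" "b \<ge> 0" "c \<ge> 0" "d \<ge> 0" "f \<ge> 0" for x a b c d f :: real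
      using that by linarith
    ultimately show ?thesis by blast
  qed
  also have "\<dots> \<le> ?a + ?b + 6 * (1 / 8 + 3 * q\<^sup>2 / 32) * e + 6 * ((q / 8 + q ^ 3 / 32) * (q / 4)) * e + ?f"
    using q by (intro add_mono mT order_refl) auto
  also have "\<dots> = (21 / 8 * q + 21 / 8 * q^3 + 6 / 8 + 18 / 32 * q\<^sup>2 + 6 / 32 * q\<^sup>2 + 6 / 128 * q^4
      + 3 / 16 * q + 3 / 64 * q^3) * e" by (simp add: algebra_simps power2_eq_square power3_eq_cube power4_eq_xxxx)
  also have "\<dots> \<le> (30 * (1 + q^4)) * e"
    by (rule mult_right_mono[OF lin(3)[OF pw q] order_less_imp_le[OF e]])
  finally show "\<bar>profile'' q\<bar> \<le> 30 * (1 + q ^ 4) * exp (- q\<^sup>2)" by (simp add: e_def)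
qed

text \<open>The exponents \<open>1/2\<close>, \<open>-1/2\<close>, \<open>-3/2\<close> are those of
  a square root and its derivatives, so that after inserting
  \<open>q = sqrt t * y powr (3/2)\<close> all contributions to a second derivative in
  \<open>y\<close> scale alike. The true behaviour is better at both ends; the square root is what
  turns the prefactor \<open>t powr (-1/2)\<close> into \<open>t powr (-1/4)\<close>.\<close>

lemma profile_bounds:
  obtains C where "C > 0" 
    "\<And>q. q > 0 \<Longrightarrow> \<bar>profile q - profile 0\<bar> \<le> C * q powr (1/2)"
    "\<And>q. q > 0 \<Longrightarrow> \<bar>profile' q\<bar> \<le> C * q powr (-1/2)"
    "\<And>q. q > 0 \<Longrightarrow> \<bar>profile'' q\<bar> \<le> C * q powr (-3/2)"
    "\<And>q. q > 0 \<Longrightarrow> \<bar>profile q\<bar> \<le> C"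
proof -
  have ex: "\<exists>C>0. \<forall>q>0. 30 * (q ^ n + q ^ 4) * exp (- q\<^sup>2) \<le> C * q powr (- p)" if np: "p \<ge> 0" for n and p :: real
  proof -
    obtain A where A: "A > 0" "\<And>q. q > 0 \<Longrightarrow> q ^ n * exp (- q\<^sup>2) \<le> A * q powr (- p)"
      using power_exp_neg_square_le[of n p] np by auto
    obtain B where B: "B > 0" "\<And>q. q > 0 \<Longrightarrow> q ^ 4 * exp (- q\<^sup>2) \<le> B * q powr (- p)"
      using power_exp_neg_square_le[of 4 p] np by auto
    have "30 * (q ^ n + q ^ 4) * exp (- q\<^sup>2) \<le> (30 * A + 30 * B) * q powr (- p)" if "q > 0" for q
      using A(2)[OF that] B(2)[OF that] by (simp add: algebra_simps)
    thus ?thesis using A B by (intro exI[of _ "30 * A + 30 * B"]) auto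
  qed
  from ex[of 0 0] obtain A where A: "A > 0" "\<And>q::real. q > 0 \<Longrightarrow> 30 * (1 + q ^ 4) * exp (- q\<^sup>2) \<le> A * q powr (- 0)" by auto
  from ex[of "1/2" 1] obtain B where B: "B > 0" "\<And>q::real. q > 0 \<Longrightarrow> 30 * (q + q ^ 4) * exp (- q\<^sup>2) \<le> B * q powr (- (1/2))" by auto
  from ex[of "3/2" 0] obtain D where D: "D > 0" "\<And>q::real. q > 0 \<Longrightarrow> 30 * (1 + q ^ 4) * exp (- q\<^sup>2) \<le> D * q powr (- (3/2))" by auto
  define C where "C = 60 + A + B + D + \<bar>profile 0\<bar>"
  show ?thesis
  proof (rule that[of C])
    show "C > 0" using A B D by (simp add: C_def)
    fix q :: real assume q: "q > 0"
    have "\<bar>profile' q\<bar> \<le> B * q powr (- (1/2))"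
      using profile_poly_bounds(2)[OF q] B(2)[OF q] by linarith
    also have "\<dots> \<le> C * q powr (- (1/2))" using A B D by (intro mult_right_mono) (auto simp: C_def)
    finally show "\<bar>profile' q\<bar> \<le> C * q powr (-1/2)" by simp
    have "\<bar>profile'' q\<bar> \<le> D * q powr (- (3/2))"
      using profile_poly_bounds(3)[OF q] D(2)[OF q] by linarith
    also have "\<dots> \<le> C * q powr (- (3/2))" using A B D by (intro mult_right_mono) (auto simp: C_def)
    finally show "\<bar>profile'' q\<bar> \<le> C * q powr (-3/2)" by simp
    have "\<bar>profile q\<bar> \<le> A"
      using profile_poly_bounds(1)[OF q] A(2)[OF q] q by simp
    also have "\<dots> \<le> C" using A B D by (simp add: C_def)
    finally show "\<bar>profile q\<bar> \<le> C" .
    show "\<bar>profile q - profile 0\<bar> \<le> C * q powr (1/2)"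
    proof (cases "q \<le> 1")
      case True
      obtain z where z: "0 < z" "z < q" "profile q - profile 0 = (q - 0) * profile' z"
        using MVT2[of 0 q profile profile'] q profile_deriv by auto
      have "\<bar>profile' z\<bar> \<le> 30 * (z + z ^ 4) * exp (- z\<^sup>2)" using z by (intro profile_poly_bounds)
      also have "\<dots> \<le> 30 * (1 + 1) * 1"
        using z True by (intro mult_mono add_mono power_le_one) auto
      finally have "\<bar>profile' z\<bar> \<le> 60" by simp
      hence "\<bar>profile q - profile 0\<bar> \<le> q * 60" using z(3) q by (simp add: abs_mult)
      also have "q powr 1 \<le> q powr (1/2)" using q True by (intro powr_mono') auto
      hence "q * 60 \<le> 60 * q powr (1/2)" using q by simp
      also have "\<dots> \<le> C * q powr (1/2)" using A B D by (intro mult_right_mono) (auto simp: C_def)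
      finally show ?thesis .
    next
      case False
      have "\<bar>profile q - profile 0\<bar> \<le> A + \<bar>profile 0\<bar>"
        using profile_poly_bounds(1)[OF q] A(2)[OF q] q by simp
      also have "\<dots> \<le> C * 1" using A B D by (simp add: C_def)
      also have "\<dots> \<le> C * q powr (1/2)"
        using False A B D by (intro mult_left_mono ge_one_powr_ge_zero) (auto simp: C_def)
      finally show ?thesis .
    qed
  qed
qed

section \<open>Values of the zeta function\<close>

text \<open>As \<open>zeta\<close> is obtained by choice, its values to the left of the line
  \<open>Re s = 1\<close> are reached only through \<open>zeta_unique\<close>. The series compares
  each Dirichlet term with the integral of \<open>x powr (- s)\<close> over the next unit interval;
  the differences are summable on all of \<open>zeta_dom\<close>, and the integrals telescope when
  \<open>Re s > 1\<close>.\<close>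

lemma zeta_series:
  assumes s: "s \<in> zeta_dom"
  shows "zeta s = 1 / (s - 1) + (\<Sum>n. 1 / of_nat (Suc n) powr s
          - (of_nat (Suc (Suc n)) powr (1 - s) - of_nat (Suc n) powr (1 - s)) / (1 - s))"
proof -
  define a where "a = (\<lambda>n (s::complex). 1 / of_nat (Suc n) powr s
          - (of_nat (Suc (Suc n)) powr (1 - s) - of_nat (Suc n) powr (1 - s)) / (1 - s))"
  have "zeta s = 1 / (s - 1) + (\<Sum>n. a n s)"
  proof (rule zeta_unique[OF _ _ s])
    have "(\<lambda>s. \<Sum>n. a n s) holomorphic_on zeta_dom"
    proof (rule holomorphic_uniform_sequence[OF open_zeta_dom])
      show "(\<lambda>s. \<Sum>i<n. a i s) holomorphic_on zeta_dom" for n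
        unfolding a_def zeta_dom_def
        by (intro holomorphic_intros) (auto simp: powr_def simp del: of_nat_Suc)
    next
      fix x assume x: "x \<in> zeta_dom"
      then obtain d where d: "d > 0" "cball x d \<subseteq> zeta_dom"
        using open_zeta_dom open_contains_cball by blast
      define e where "e = min d (Re x / 2)"
      have Rx: "Re x > 0" using x by (auto simp: zeta_dom_def)
      have e: "e > 0" "e \<le> d" "e \<le> Re x / 2" using d Rx by (auto simp: e_def)
      have sub: "cball x e \<subseteq> zeta_dom" using d e by (meson order_trans subset_cball)
      have "uniform_limit (cball x e) (\<lambda>n s. \<Sum>i<n. a i s) (\<lambda>s. \<Sum>n. a n s) sequentially"
      proof (rule Weierstrass_m_test)
        fix n s assume s: "s \<in> cball x e"
        hence xs: "norm (x - s) \<le> e" by (simp add: dist_norm)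
        hence Rs: "Re s \<ge> Re x / 2" using abs_Re_le_cmod[of "x - s"] e by simp
        have "norm (a n s) \<le> norm s * real (Suc n) powr (- Re s - 1)"
          unfolding a_def using s sub by (intro zeta_term_bound) (auto simp: zeta_dom_def)
        also have "\<dots> \<le> (norm x + e) * real (Suc n) powr (- Re x / 2 - 1)"
          using norm_triangle_ineq2[of s x] xs Rs e
          by (intro mult_mono powr_mono) (auto simp: norm_minus_commute)
        finally show "norm (a n s) \<le> (norm x + e) * real (Suc n) powr (- Re x / 2 - 1)" .
      next
        show "summable (\<lambda>n. (norm x + e) * real (Suc n) powr (- Re x / 2 - 1))"
          using Rx by (intro summable_mult) 
            (subst summable_Suc_iff, subst summable_real_powr_iff, auto)
      qed
      thus "\<exists>d>0. cball x d \<subseteq> zeta_dom \<and>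
             uniform_limit (cball x d) (\<lambda>n s. \<Sum>i<n. a i s) (\<lambda>s. \<Sum>n. a n s) sequentially"
        using e(1) sub by blast
    qed
    thus "(\<lambda>s. 1 / (s - 1) + (\<Sum>n. a n s)) holomorphic_on zeta_dom"
      by (intro holomorphic_intros) (auto simp: zeta_dom_def)
  next
    fix s :: complex assume s: "Re s > 1"
    have norm_Suc: "norm (complex_of_nat (Suc n) powr w) = real (Suc n) powr Re w" for n w
      by (subst norm_powr_real_powr) auto
    have "summable (\<lambda>n. real (Suc n) powr (- Re s))" 
      using s by (subst summable_Suc_iff, subst summable_real_powr_iff) auto
    hence "summable (\<lambda>n. norm (complex_of_nat (Suc n) powr (-s)))"
      by (simp only: norm_Suc uminus_complex.simps)
    hence "summable (\<lambda>n. complex_of_nat (Suc n) powr (-s))" by (rule summable_norm_cancel)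
    hence 1: "(\<lambda>n. 1 / of_nat (Suc n) powr s) sums (\<Sum>n. 1 / of_nat (Suc n) powr s)"
      by (simp add: powr_minus inverse_eq_divide summable_sums)
    have "(\<lambda>n. real (Suc n) powr (1 - Re s)) \<longlonglongrightarrow> 0"
      using s by real_asymp
    hence "(\<lambda>n. norm (complex_of_nat (Suc n) powr (1 - s))) \<longlonglongrightarrow> 0"
      by (simp only: norm_Suc minus_complex.simps one_complex.simps)
    hence "(\<lambda>n. complex_of_nat (Suc n) powr (1 - s)) \<longlonglongrightarrow> 0"
      by (rule tendsto_norm_zero_cancel)
    from sums_divide[OF telescope_sums[OF this], of "1 - s"]
    have 2: "(\<lambda>n. (of_nat (Suc (Suc n)) powr (1 - s) - of_nat (Suc n) powr (1 - s)) / (1 - s))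
            sums (-1 / (1 - s))"
      by simp
    have "(\<lambda>n. a n s) sums ((\<Sum>n. 1 / of_nat (Suc n) powr s) - (-1 / (1 - s)))"
      unfolding a_def by (intro sums_diff 1 2)
    moreover have "1 / (s - 1) = -1 / (1 - s)" by (metis minus_diff_eq minus_divide_divide)
    ultimately show "1 / (s - 1) + (\<Sum>n. a n s) = (\<Sum>n. 1 / of_nat (Suc n) powr s)"
      by (simp add: sums_iff)
  qed
  thus ?thesis by (simp add: a_def)
qed

lemma zeta_real_sums:
  assumes "x > 1"
  shows "(\<lambda>n. real (Suc n) powr (- x)) sums zeta_real x"
proof -
  have sm: "summable (\<lambda>n. real (Suc n) powr (- x))" 
    using assms by (subst summable_Suc_iff, subst summable_real_powr_iff) auto
  have "zeta (complex_of_real x) = (\<Sum>n. 1 / of_nat (Suc n) powr complex_of_real x)"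
    using assms by (intro zeta_continuation(2)) simp
  also have "(\<lambda>n. 1 / of_nat (Suc n) powr complex_of_real x) = (\<lambda>n. complex_of_real (real (Suc n) powr (- x)))"
  proof
    fix n
    have "complex_of_real (real (Suc n) powr (- x)) = complex_of_real (real (Suc n)) powr complex_of_real (- x)"
      by (subst powr_of_real) auto
    thus "1 / of_nat (Suc n) powr complex_of_real x = complex_of_real (real (Suc n) powr (- x))"
      by (simp add: powr_minus_divide)
  qed
  also have "(\<Sum>n. complex_of_real (real (Suc n) powr (- x))) = complex_of_real (\<Sum>n. real (Suc n) powr (- x))"
    by (rule suminf_of_real[OF sm, symmetric])
  finally have "zeta_real x = (\<Sum>n. real (Suc n) powr (- x))" by (simp add: zeta_real_def)
  thus ?thesis using sm by (simp add: summable_sums)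
qed

text \<open>The subtracted term is the integral of \<open>x powr (-1/2)\<close> over a unit
  interval, so \<open>zeta_real (1/2) + 2\<close> is the total error of the left-endpoint rule for
  this function on \<open>{1..}\<close>. The 2 is minus the value of \<open>1 / (s - 1)\<close> at
  \<open>s = 1/2\<close>.\<close>

lemma zeta_real_half_sums:
  "(\<lambda>n. real (Suc n) powr (-1/2) - 2 * (sqrt (real (Suc (Suc n))) - sqrt (real (Suc n)))) 
     sums (zeta_real (1/2) + 2)"
proof -
  define b where "b = (\<lambda>n. real (Suc n) powr (-1/2) - 2 * (sqrt (real (Suc (Suc n))) - sqrt (real (Suc n))))"
  define a where "a = (\<lambda>n. 1 / of_nat (Suc n) powr complex_of_real (1/2)
          - (of_nat (Suc (Suc n)) powr (1 - complex_of_real (1/2)) - of_nat (Suc n) powr (1 - complex_of_real (1/2))) / (1 - complex_of_real (1/2)))"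
  have h: "1 - complex_of_real (1/2) = complex_of_real (1/2)" by simp
  have pw: "of_nat (Suc n) powr complex_of_real (1/2) = complex_of_real (sqrt (real (Suc n)))" for n
  proof -
    have "complex_of_real (real (Suc n)) powr complex_of_real (1/2) = complex_of_real (real (Suc n) powr (1/2))"
      by (subst powr_of_real) auto
    thus ?thesis by (simp add: powr_half_sqrt)
  qed
  have ab: "a n = complex_of_real (b n)" for n
    unfolding a_def b_def h pw by (simp add: powr_minus_divide powr_half_sqrt)
  have dom: "complex_of_real (1/2) \<in> zeta_dom" by (auto simp: zeta_dom_def complex_eq_iff)
  have bd: "norm (b n) \<le> 1 / 2 * real (Suc n) powr (-3/2)" for n
    using zeta_term_bound[of "complex_of_real (1/2)" n] dom
    unfolding a_def[symmetric, THEN fun_cong] ab by (simp add: zeta_dom_def)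
  have "summable (\<lambda>n. 1 / 2 * real (Suc n) powr (-3/2))"
    by (intro summable_mult) (subst summable_Suc_iff, subst summable_real_powr_iff, auto)
  hence sb: "summable b" by (rule summable_comparison_test'[where N=0]) (use bd in auto)
  have "zeta (complex_of_real (1/2)) = 1 / (complex_of_real (1/2) - 1) + (\<Sum>n. a n)"
    unfolding a_def by (rule zeta_series[OF dom])
  also have "(\<Sum>n. a n) = complex_of_real (\<Sum>n. b n)"
    unfolding ab by (rule suminf_of_real[OF sb, symmetric])
  finally have "zeta_real (1/2) = -2 + (\<Sum>n. b n)" by (simp add: zeta_real_def)
  thus ?thesis using sb by (simp add: sums_iff b_def)
qed

section \<open>Sums along the rows\<close>

definition xexp :: "real \<Rightarrow> real" where "xexp x = x * exp (- x)"

definition kern :: "real \<Rightarrow> real \<Rightarrow> real \<Rightarrow> real" where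
  "kern t y x = xexp (t * y * x * (x + y) / 2)"

text \<open>This is the integral of \<open>kern t y\<close> over \<open>{y..}\<close>, as
  \<open>row_int_integral\<close> shows; the prefactor comes from the substitution described at
  \<open>profile\<close>.\<close>

definition row_int :: "real \<Rightarrow> real \<Rightarrow> real" where
  "row_int t y = (t * y) powr (-1/2) * profile (sqrt t * y powr (3/2))"

text \<open>An antiderivative of \<open>kern t y\<close> for \<open>A = t * y\<close>. Completing
  the square, \<open>A * x * (x + y) / 2 = A / 2 * (x + y / 2)\<^sup>2 - A * y\<^sup>2 / 8\<close>,
  leaves a Gaussian times a quadratic polynomial in \<open>x + y / 2\<close>, and one integration by
  parts removes the quadratic term.\<close>

definition kern_prim :: "real \<Rightarrow> real \<Rightarrow> real \<Rightarrow> real" where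
  "kern_prim A y x = - ((x + y / 2) / 2 * exp (- (A * x * (x + y) / 2)))
     + (1 / 2 - A * y\<^sup>2 / 8) * (exp (A * y\<^sup>2 / 8) * (1 / sqrt (A / 2)) * gauss_prim (sqrt (A / 2) * (x + y / 2)))"

lemma kern_prim_deriv:
  assumes A: "A > 0"
  shows "(kern_prim A y has_real_derivative xexp (A * x * (x + y) / 2)) (at x)"
proof -
  define c where "c = sqrt (A / 2)"
  have c: "c > 0" "c\<^sup>2 = A / 2" using A by (auto simp: c_def)
  define Z where "Z = A * x * (x + y) / 2"
  have 1: "((\<lambda>x. gauss_prim (c * (x + y / 2))) has_real_derivative exp (- (c * (x + y / 2))\<^sup>2) * c) (at x)"
    by (rule DERIV_chain2[OF gauss_prim_deriv]) (auto intro!: derivative_eq_intros)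
  have 2: "((\<lambda>x. exp (A * y\<^sup>2 / 8) * (1 / c) * gauss_prim (c * (x + y / 2))) has_real_derivative exp (- Z)) (at x)"
  proof (rule DERIV_cong)
    show "((\<lambda>x. exp (A * y\<^sup>2 / 8) * (1 / c) * gauss_prim (c * (x + y / 2))) has_real_derivative 
      exp (A * y\<^sup>2 / 8) * (1 / c) * (exp (- (c * (x + y / 2))\<^sup>2) * c)) (at x)"
      by (rule DERIV_cmult[OF 1])
    have "exp (A * y\<^sup>2 / 8) * (1 / c) * (exp (- (c * (x + y / 2))\<^sup>2) * c) = 
        exp (A * y\<^sup>2 / 8) * exp (- (c * (x + y / 2))\<^sup>2)" using c by simp
    also have "\<dots> = exp (- Z)"
      unfolding exp_add[symmetric] power_mult_distrib c Z_def 
      by (simp add: power2_eq_square field_simps)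
    finally show "exp (A * y\<^sup>2 / 8) * (1 / c) * (exp (- (c * (x + y / 2))\<^sup>2) * c) = exp (- Z)" .
  qed
  have 3: "((\<lambda>x. exp (- (A * x * (x + y) / 2))) has_real_derivative - (A * (x + y / 2)) * exp (- Z)) (at x)"
    unfolding Z_def by (auto intro!: derivative_eq_intros simp: field_simps)
  have "(kern_prim A y has_real_derivative 
      - (1 / 2 * exp (- Z) + - (A * (x + y / 2)) * exp (- Z) * ((x + y / 2) / 2)) + (1 / 2 - A * y\<^sup>2 / 8) * exp (- Z)) (at x)"
    unfolding kern_prim_def[abs_def] c_def[symmetric] Z_def[symmetric]
    by (intro DERIV_add DERIV_minus DERIV_cmult[OF 2] DERIV_mult[OF _ 3[unfolded Z_def], folded Z_def])
       (auto intro!: derivative_eq_intros)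
  moreover have "- (1 / 2 * exp (- Z) + - (A * (x + y / 2)) * exp (- Z) * ((x + y / 2) / 2)) + (1 / 2 - A * y\<^sup>2 / 8) * exp (- Z) 
     = (A * (x + y / 2)\<^sup>2 / 2 - A * y\<^sup>2 / 8) * exp (- Z)"
    by (simp add: field_simps power2_eq_square)
  moreover have "A * (x + y / 2)\<^sup>2 / 2 - A * y\<^sup>2 / 8 = Z"
    unfolding Z_def by (simp add: power2_eq_square field_simps)
  ultimately have "(kern_prim A y has_real_derivative Z * exp (- Z)) (at x)" by (simp only:)
  thus ?thesis by (simp add: xexp_def Z_def)
qed

lemma kern_prim_lim:
  assumes A: "A > 0" and y: "y > 0"
  shows "((\<lambda>x. kern_prim A y x - kern_prim A y y) \<longlongrightarrow> profile (sqrt A * y) / sqrt A) at_top"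
proof -
  define c where "c = sqrt (A / 2)"
  have c: "c > 0" "sqrt A = c * sqrt 2" 
    using A by (auto simp: c_def real_sqrt_divide)
  have "filterlim (\<lambda>x. c * (x + y / 2)) at_top at_top" using c(1) by real_asymp
  hence g: "((\<lambda>x. gauss_prim (c * (x + y / 2))) \<longlongrightarrow> sqrt pi / 2) at_top"
    by (rule filterlim_compose[OF gauss_prim_lim])
  have e: "((\<lambda>x. (x + y / 2) / 2 * exp (- (A * x * (x + y) / 2))) \<longlongrightarrow> 0) at_top"
    using A y by real_asymp
  have "((\<lambda>x. kern_prim A y x - kern_prim A y y) \<longlongrightarrow> 
     - 0 + (1 / 2 - A * y\<^sup>2 / 8) * (exp (A * y\<^sup>2 / 8) * (1 / c) * (sqrt pi / 2)) - kern_prim A y y) at_top"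
    unfolding kern_prim_def[of A y] c_def[symmetric] by (intro tendsto_intros e g)
  also have "- 0 + (1 / 2 - A * y\<^sup>2 / 8) * (exp (A * y\<^sup>2 / 8) * (1 / c) * (sqrt pi / 2)) - kern_prim A y y
     = 3 * y / 4 * exp (- (A * y\<^sup>2)) + (1 / 2 - A * y\<^sup>2 / 8) * 
        (exp (A * y\<^sup>2 / 8) * (1 / c) * (sqrt pi / 2 - gauss_prim (c * (3 * y / 2))))"
    unfolding kern_prim_def c_def[symmetric] by (simp add: algebra_simps power2_eq_square)
  also have "\<dots> = profile (sqrt A * y) / sqrt A"
  proof -
    have "(sqrt A * y)\<^sup>2 = A * y\<^sup>2" using A by (simp add: power_mult_distrib)
    moreover have "3 * (sqrt A * y) / (2 * sqrt 2) = c * (3 * y / 2)" by (simp add: c(2))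
    moreover have "sqrt 2 / sqrt A = 1 / c" using c by simp
    ultimately show ?thesis using A unfolding profile_def gauss_tail_def by (simp add: field_simps)
  qed
  finally show ?thesis .
qed

lemma row_int_eq:
  assumes "t > 0" "y > 0"
  shows "row_int t y = profile (sqrt (t * y) * y) / sqrt (t * y)"
proof -
  have "y powr (3/2) = sqrt y * y"
  proof -
    have "y powr (3/2) = y powr (1/2 + 1)" by simp
    also have "\<dots> = sqrt y * y" using assms by (subst powr_add) (simp add: powr_half_sqrt)
    finally show ?thesis .
  qed
  moreover have "(t * y) powr (-1/2) = 1 / sqrt (t * y)"
    using assms by (simp add: powr_minus_divide powr_half_sqrt)
  ultimately show ?thesis by (simp add: row_int_def real_sqrt_mult mult.assoc)
qed

lemma kern_nonneg: "t \<ge> 0 \<Longrightarrow> y \<ge> 0 \<Longrightarrow> x \<ge> 0 \<Longrightarrow> kern t y x \<ge> 0"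
  by (simp add: kern_def xexp_def)

text \<open>Two readings of the same improper integral: the nonnegative one enters the interchange
  of integrals that yields the leading constant, the limit along \<open>y + real n\<close> enters
  the trapezoidal rule.\<close>

lemma row_int_integral:
  assumes t: "t > 0" and y: "y > 0"
  shows "(\<integral>\<^sup>+x. ennreal (kern t y x) * indicator {y..} x \<partial>lborel) = ennreal (row_int t y)"
    and "(\<lambda>n. integral {y..y + real n} (kern t y)) \<longlonglongrightarrow> row_int t y"
proof -
  have A: "t * y > 0" using t y by simp
  have lim: "((\<lambda>x. kern_prim (t*y) y x - kern_prim (t*y) y y) \<longlongrightarrow> row_int t y) at_top"
    using kern_prim_lim[OF A y] row_int_eq[OF t y] by simp
  have d: "(kern_prim (t*y) y has_real_derivative kern t y x) (at x)" for x
    using kern_prim_deriv[OF A] by (simp add: kern_def)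
  from tendsto_add[OF lim tendsto_const[of "kern_prim (t*y) y y"]]
  have lim': "(kern_prim (t*y) y \<longlongrightarrow> row_int t y + kern_prim (t*y) y y) at_top" by simp
  have "(\<integral>\<^sup>+x. ennreal (kern t y x) * indicator {y..} x \<partial>lborel) 
      = ennreal (row_int t y + kern_prim (t*y) y y - kern_prim (t*y) y y)"
    by (rule nn_integral_FTC_atLeast[OF _ d _ lim']) 
       (use t y in \<open>auto simp: kern_def xexp_def intro!: kern_nonneg\<close>)
  thus "(\<integral>\<^sup>+x. ennreal (kern t y x) * indicator {y..} x \<partial>lborel) = ennreal (row_int t y)" by simp
  have "integral {y..y + real n} (kern t y) = kern_prim (t*y) y (y + real n) - kern_prim (t*y) y y" for n
    by (intro integral_unique fundamental_theorem_of_calculus)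
       (auto intro: DERIV_subset d simp: has_real_derivative_iff_has_vector_derivative[symmetric])
  moreover have "filterlim (\<lambda>n. y + real n) at_top sequentially" by real_asymp
  ultimately show "(\<lambda>n. integral {y..y + real n} (kern t y)) \<longlonglongrightarrow> row_int t y"
    using filterlim_compose[OF lim] by simp
qed

text \<open>For \<open>Z = t * k * x * (x + k) / 2\<close> the second derivative of
  \<open>Z * exp (- Z)\<close> in \<open>x\<close> is at most a constant times
  \<open>t * k * exp (- Z / 2)\<close>. Along a row this exponential splits into a factor
  \<open>exp (- t * k ^ 3 / 4)\<close> and a Gaussian in \<open>i\<close>; the sum of the Gaussians
  and the first factor are then bounded by powers.\<close>

lemma row_int_trapezoid:
  obtains C where "C > 0" 
    "\<And>t k. t > 0 \<Longrightarrow> k > 0 \<Longrightarrow> summable (\<lambda>i. kern t k (k + real i))"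
    "\<And>t k. t > 0 \<Longrightarrow> k > 0 \<Longrightarrow> \<bar>(\<Sum>i. kern t k (k + real i)) - kern t k k / 2 - row_int t k\<bar> 
        \<le> C * t powr (-1/4) * (k powr (-5/4) + k powr (-11/4))"
proof -
  \<comment> \<open>The exponent \<open>3/4\<close> makes the Gaussian terms summable as
    \<open>real i powr (-3/2)\<close>. The exponents \<open>5/4\<close> and \<open>1/2\<close> apply
    to \<open>exp (- (A * k\<^sup>2 / 4))\<close> in the two parts of the bound and are the ones for
    which both parts end with \<open>t powr (-1/4)\<close>.\<close>
  obtain C1 where C1: "C1 > 0" "\<And>x::real. x > 0 \<Longrightarrow> exp (- (1/4 * x)) \<le> C1 * x powr (- (3/4))"
    using powr_exp_neg_bounded[of "3/4" "1/4"] by auto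
  obtain C2 where C2: "C2 > 0" "\<And>x::real. x > 0 \<Longrightarrow> exp (- (1/4 * x)) \<le> C2 * x powr (- (1/2))"
    using powr_exp_neg_bounded[of "1/2" "1/4"] by auto
  obtain C3 where C3: "C3 > 0" "\<And>x::real. x > 0 \<Longrightarrow> exp (- (1/4 * x)) \<le> C3 * x powr (- (5/4))"
    using powr_exp_neg_bounded[of "5/4" "1/4"] by auto
  have sS: "summable (\<lambda>i. real (Suc i) powr (-3/2))"
    by (subst summable_Suc_iff, subst summable_real_powr_iff) auto
  define S where "S = (\<Sum>i. real (Suc i) powr (-3/2))"
  have S0: "S \<ge> 0" unfolding S_def by (intro suminf_nonneg sS) auto
  have gs: "summable (\<lambda>i. exp (- (A * (real i)\<^sup>2 / 4)))" "(\<Sum>i. exp (- (A * (real i)\<^sup>2 / 4))) \<le> 1 + C1 * S * A powr (-3/4)"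
    if A: "A > 0" for A
  proof -
    have le: "exp (- (A * (real (Suc i))\<^sup>2 / 4)) \<le> C1 * A powr (-3/4) * real (Suc i) powr (-3/2)" for i
    proof -
      have "exp (- (1/4 * (A * (real (Suc i))\<^sup>2))) \<le> C1 * (A * (real (Suc i))\<^sup>2) powr (- (3/4))"
        using A by (intro C1) auto
      also have "(A * (real (Suc i))\<^sup>2) powr (- (3/4)) = A powr (-3/4) * (real (Suc i) powr 2) powr (- (3/4))"
        using A by (subst powr_mult) auto
      also have "(real (Suc i) powr 2) powr (- (3/4)) = real (Suc i) powr (-3/2)" by (subst powr_powr) simp
      finally show ?thesis by (simp add: mult_ac)
    qed
    have sm: "summable (\<lambda>i. C1 * A powr (-3/4) * real (Suc i) powr (-3/2))" by (intro summable_mult sS)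
    have sm': "summable (\<lambda>i. exp (- (A * (real (Suc i))\<^sup>2 / 4)))"
      by (rule summable_comparison_test'[OF sm, where N=0]) (use le in auto)
    thus sm'': "summable (\<lambda>i. exp (- (A * (real i)\<^sup>2 / 4)))" by (subst (asm) summable_Suc_iff)
    have "(\<Sum>i. exp (- (A * (real (Suc i))\<^sup>2 / 4))) \<le> (\<Sum>i. C1 * A powr (-3/4) * real (Suc i) powr (-3/2))"
      by (intro suminf_le le sm sm')
    also have "\<dots> = C1 * A powr (-3/4) * S" unfolding S_def by (rule suminf_mult[OF sS])
    finally show "(\<Sum>i. exp (- (A * (real i)\<^sup>2 / 4))) \<le> 1 + C1 * S * A powr (-3/4)"
      using suminf_split_initial_segment[OF sm'', of 1] by (simp add: mult_ac)
  qed
  define C where "C = 24 * (C3 + C1 * S * C2) + 1"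
  have main: "summable (\<lambda>i. kern t k (k + real i)) \<and>
     \<bar>(\<Sum>i. kern t k (k + real i)) - kern t k k / 2 - row_int t k\<bar> 
        \<le> C * t powr (-1/4) * (k powr (-5/4) + k powr (-11/4))" if t: "t > 0" and k: "k > 0" for t k
  proof -
    define A where "A = t * k"
    have A: "A > 0" using t k by (simp add: A_def)
    define Z where "Z = (\<lambda>x. A * x * (x + k) / 2)"
    define Z' where "Z' = (\<lambda>x. A * (x + k / 2))"
    define f' where "f' = (\<lambda>x. (1 - Z x) * exp (- Z x) * Z' x)"
    define f'' where "f'' = (\<lambda>x. (Z x - 2) * exp (- Z x) * (Z' x)\<^sup>2 + (1 - Z x) * exp (- Z x) * A)"
    have dZ: "(Z has_real_derivative Z' x) (at x)" for x
      unfolding Z_def Z'_def by (auto intro!: derivative_eq_intros simp: field_simps)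
    have dZ': "(Z' has_real_derivative A) (at x)" for x
      unfolding Z'_def by (auto intro!: derivative_eq_intros)
    have kZ: "kern t k = (\<lambda>x. Z x * exp (- Z x))"
      by (auto simp: kern_def xexp_def Z_def A_def)
    have d1: "(kern t k has_real_derivative f' x) (at x)" for x
      unfolding kZ f'_def by (auto intro!: derivative_eq_intros dZ simp: algebra_simps)
    have d2: "(f' has_real_derivative f'' x) (at x)" for x
      unfolding f'_def f''_def by (auto intro!: derivative_eq_intros dZ dZ' simp: algebra_simps power2_eq_square)
    define M where "M = (\<lambda>i. 24 * A * exp (- (A * k\<^sup>2 / 4)) * exp (- (A * (real i)\<^sup>2 / 4)))"
    have f''_le: "\<bar>f'' x\<bar> \<le> M i" if "x \<in> {k + real i..k + real i + 1}" for x i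
    proof -
      have x: "x \<ge> k" "x \<ge> k + real i" "x > 0" using that k by auto
      have Z0: "Z x \<ge> 0" using x A k by (simp add: Z_def)
      have "A * k\<^sup>2 \<le> A * (x * (x + k) / 2)"
      proof (rule mult_left_mono)
        have "k * k \<le> x * x" "k * k \<le> x * k" using x k by (auto intro!: mult_mono)
        thus "k\<^sup>2 \<le> x * (x + k) / 2" by (simp add: power2_eq_square algebra_simps)
      qed (use A in auto)
      hence "A * k\<^sup>2 \<le> Z x" by (simp add: Z_def)
      hence "A * (A * k\<^sup>2) \<le> A * Z x" using A by (intro mult_left_mono) auto
      moreover have "(Z' x)\<^sup>2 = 2 * (A * Z x) + A * (A * k\<^sup>2) / 4"
        by (simp add: Z'_def Z_def power2_eq_square field_simps)
      moreover have "A * Z x \<ge> 0" using A Z0 by simp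
      \<comment> \<open>This uses \<open>x >= k\<close>: near \<open>x = 0\<close> the value of
        \<open>Z\<close> is small and its slope is not. It is the reason for summing a row only from
        the diagonal on.\<close>
      ultimately have Z'2: "(Z' x)\<^sup>2 \<le> 3 * (A * Z x)" by linarith
      have "\<bar>f'' x\<bar> \<le> (Z x + 2) * exp (- Z x) * (3 * (A * Z x)) + (1 + Z x) * exp (- Z x) * A"
      proof -
        have "\<bar>f'' x\<bar> \<le> \<bar>Z x - 2\<bar> * exp (- Z x) * (Z' x)\<^sup>2 + \<bar>1 - Z x\<bar> * exp (- Z x) * A"
          unfolding f''_def using A by (intro order_trans[OF abs_triangle_ineq]) (simp add: abs_mult)
        also have "\<dots> \<le> (Z x + 2) * exp (- Z x) * (3 * (A * Z x)) + (1 + Z x) * exp (- Z x) * A"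
          using Z0 Z'2 A by (intro add_mono mult_mono) auto
        finally show ?thesis .
      qed
      also have "\<dots> = A * exp (- Z x) * (3 * (Z x)\<^sup>2 + 7 * Z x + 1)" by (simp add: algebra_simps power2_eq_square)
      \<comment> \<open>The factor 24 is the one with which the quadratic Taylor term
        \<open>(Z x / 2)\<^sup>2 / 2\<close> of \<open>exp (Z x / 2)\<close> becomes
        \<open>3 * (Z x)\<^sup>2\<close>; the lower terms then fit with room to spare.\<close>
      also have "\<dots> \<le> A * exp (- Z x) * (24 * exp (Z x / 2))"
      proof (rule mult_left_mono)
        have "1 + Z x / 2 + (Z x / 2)\<^sup>2 / 2 \<le> exp (Z x / 2)" using Z0 by (intro exp_lower_Taylor_quadratic) auto
        thus "3 * (Z x)\<^sup>2 + 7 * Z x + 1 \<le> 24 * exp (Z x / 2)" using Z0 by (simp add: power_divide)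
      qed (use A in auto)
      also have "\<dots> = 24 * A * exp (- (Z x / 2))"
      proof -
        have "exp (- Z x) * exp (Z x / 2) = exp (- (Z x / 2))" by (simp add: exp_add[symmetric] field_simps)
        thus ?thesis by simp
      qed
      also have "\<dots> \<le> 24 * A * exp (- (A * k\<^sup>2 / 4) + - (A * (real i)\<^sup>2 / 4))"
      proof -
        have "(k + real i)\<^sup>2 \<le> x\<^sup>2" using x k by (intro power_mono) auto
        moreover have "x * k \<ge> 0" "k * real i \<ge> 0" using x k by auto
        ultimately have "k\<^sup>2 + (real i)\<^sup>2 \<le> x * (x + k)" 
          by (simp add: power2_eq_square algebra_simps)
        hence "A * (k\<^sup>2 + (real i)\<^sup>2) \<le> A * (x * (x + k))" using A by (intro mult_left_mono) auto
        hence "- (Z x / 2) \<le> - (A * k\<^sup>2 / 4) + - (A * (real i)\<^sup>2 / 4)"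
          by (simp add: Z_def algebra_simps)
        thus ?thesis using A by simp
      qed
      finally show ?thesis by (simp only: M_def exp_add mult.assoc)
    qed
    have sM: "summable M" unfolding M_def by (intro summable_mult gs A)
    have f0: "(\<lambda>n. kern t k (k + real n)) \<longlonglongrightarrow> 0"
      using t k unfolding kern_def xexp_def by real_asymp
    have "suminf M = 24 * A * exp (- (A * k\<^sup>2 / 4)) * (\<Sum>i. exp (- (A * (real i)\<^sup>2 / 4)))"
      unfolding M_def by (rule suminf_mult[OF gs(1)[OF A]])
    also have "\<dots> \<le> 24 * A * exp (- (A * k\<^sup>2 / 4)) * (1 + C1 * S * A powr (-3/4))"
      using A by (intro mult_left_mono gs) auto
    also have "\<dots> = 24 * (A powr 1 * exp (- (A * k\<^sup>2 / 4)) + C1 * S * (A powr 1 * A powr (-3/4)) * exp (- (A * k\<^sup>2 / 4)))"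
      using A by (simp add: algebra_simps)
    also have "A powr 1 * A powr (-3/4) = A powr (1/4)" by (simp only: powr_add[symmetric]) simp
    also have "24 * (A powr 1 * exp (- (A * k\<^sup>2 / 4)) + C1 * S * A powr (1/4) * exp (- (A * k\<^sup>2 / 4)))
       \<le> 24 * (A powr 1 * (C3 * (A * k\<^sup>2) powr (- (5/4))) + C1 * S * A powr (1/4) * (C2 * (A * k\<^sup>2) powr (- (1/2))))"
      using C3(2)[of "A * k\<^sup>2"] C2(2)[of "A * k\<^sup>2"] A k C1(1) S0
      by (intro mult_left_mono add_mono) (auto intro!: mult_nonneg_nonneg)
    also have "A powr 1 * (C3 * (A * k\<^sup>2) powr (- (5/4))) = C3 * (t powr (-1/4) * k powr (-11/4))"
    proof -
      have "A * k\<^sup>2 = t * k powr 3" using k by (simp add: A_def power2_eq_square power3_eq_cube)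
      hence "(A * k\<^sup>2) powr (- (5/4)) = t powr (- (5/4)) * (k powr 3) powr (- (5/4))"
        using t k by (simp only: powr_mult)
      hence "(A * k\<^sup>2) powr (- (5/4)) = t powr (-5/4) * k powr (-15/4)"
        unfolding powr_powr by simp
      moreover have "A powr 1 = t powr 1 * k powr 1" using t k by (simp add: A_def)
      ultimately have "A powr 1 * (C3 * (A * k\<^sup>2) powr (- (5/4))) = C3 * ((t powr 1 * t powr (-5/4)) * (k powr 1 * k powr (-15/4)))"
        by (simp only: mult_ac)
      thus ?thesis by (simp only: powr_add[symmetric]) simp
    qed
    also have "C1 * S * A powr (1/4) * (C2 * (A * k\<^sup>2) powr (- (1/2))) = C1 * S * C2 * (t powr (-1/4) * k powr (-5/4))"
    proof -
      have "A * k\<^sup>2 = t * k powr 3" using k by (simp add: A_def power2_eq_square power3_eq_cube)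
      hence "(A * k\<^sup>2) powr (- (1/2)) = t powr (- (1/2)) * (k powr 3) powr (- (1/2))"
        using t k by (simp only: powr_mult)
      hence "(A * k\<^sup>2) powr (- (1/2)) = t powr (-1/2) * k powr (-3/2)"
        unfolding powr_powr by simp
      moreover have "A powr (1/4) = t powr (1/4) * k powr (1/4)" using t k by (simp add: A_def powr_mult)
      ultimately have "C1 * S * A powr (1/4) * (C2 * (A * k\<^sup>2) powr (- (1/2))) 
         = C1 * S * C2 * ((t powr (1/4) * t powr (-1/2)) * (k powr (1/4) * k powr (-3/2)))"
        by (simp only: mult_ac)
      thus ?thesis by (simp only: powr_add[symmetric]) simp
    qed
    also have "24 * (C3 * (t powr (-1/4) * k powr (-11/4)) + C1 * S * C2 * (t powr (-1/4) * k powr (-5/4)))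
       \<le> C * t powr (-1/4) * (k powr (-5/4) + k powr (-11/4))"
    proof -
      define T1 where "T1 = t powr (-1/4) * k powr (-11/4)"
      define T2 where "T2 = t powr (-1/4) * k powr (-5/4)"
      have "T1 \<ge> 0" "T2 \<ge> 0" by (auto simp: T1_def T2_def)
      hence "C3 * T2 \<ge> 0" "C1 * S * C2 * T1 \<ge> 0" using C1 C2 C3 S0 by auto
      hence "24 * (C3 * T1 + C1 * S * C2 * T2) \<le> C * (T2 + T1)"
        using \<open>T1 \<ge> 0\<close> \<open>T2 \<ge> 0\<close> by (simp add: C_def algebra_simps)
      thus ?thesis by (simp add: T1_def T2_def algebra_simps)
    qed
    finally have "suminf M \<le> C * t powr (-1/4) * (k powr (-5/4) + k powr (-11/4))" .
    with trapezoid_sum[of k "kern t k" f' f'' M "row_int t k", OF d1 d2 f''_le sM row_int_integral(2)[OF t k] f0]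
    show ?thesis by auto
  qed
  have "C > 0" using C1 C2 C3 S0 by (simp add: C_def add_nonneg_pos)
  with main show ?thesis by (intro that[of C]) blast+
qed

section \<open>Summation over the rows, with the singularity at 0 split off\<close>

definition row_int_rem :: "real \<Rightarrow> real \<Rightarrow> real" where
  "row_int_rem t y = t powr (-1/2) * y powr (-1/2) * (profile (sqrt t * y powr (3/2)) - profile 0)"

text \<open>At \<open>y = 0\<close> every power of \<open>y\<close> is 0 by the convention for
  \<open>powr\<close>, so the identity persists there and may be integrated over the closed interval
  \<open>{0..1}\<close>.\<close>

lemma row_int_decomp:
  assumes "t > 0" "y \<ge> 0"
  shows "row_int t y = profile 0 * t powr (-1/2) * y powr (-1/2) + row_int_rem t y"
  using assms by (simp add: row_int_def row_int_rem_def powr_mult algebra_simps)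

lemma row_int_nonneg:
  assumes "t > 0" "y > 0"
  shows "row_int t y \<ge> 0"
proof (rule LIMSEQ_le_const[OF row_int_integral(2)[OF assms]], intro exI[of _ 0] allI impI)
  fix n
  have "continuous_on {y..y + real n} (kern t y)"
    unfolding kern_def xexp_def by (intro continuous_intros) auto
  thus "0 \<le> integral {y..y + real n} (kern t y)"
    using assms by (intro integral_nonneg integrable_continuous_real kern_nonneg) auto
qed

text \<open>The remainder behaves like \<open>t powr (-1/4) * y powr (1/4)\<close>, and two
  differentiations cost a factor \<open>y powr (-2)\<close> as for a pure power. Hence it is
  harmless at 0, and its trapezoidal errors can be summed over the rows.\<close>

lemma row_int_rem_bounds:
  obtains C where "C > 0" 
    "\<And>t y. t > 0 \<Longrightarrow> y > 0 \<Longrightarrow> \<bar>row_int_rem t y\<bar> \<le> C * t powr (-1/4) * y powr (1/4)"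
    "\<And>t y. t > 0 \<Longrightarrow> y > 0 \<Longrightarrow> \<bar>row_int t y\<bar> \<le> C * (t * y) powr (-1/2)"
    "\<And>t k. t > 0 \<Longrightarrow> k > 0 \<Longrightarrow> \<bar>(row_int_rem t k + row_int_rem t (k + 1)) / 2 - integral {k..k+1} (row_int_rem t)\<bar> 
       \<le> C * t powr (-1/4) * k powr (-7/4)"
proof -
  obtain C where C: "C > 0" 
    "\<And>q. q > 0 \<Longrightarrow> \<bar>profile q - profile 0\<bar> \<le> C * q powr (1/2)"
    "\<And>q. q > 0 \<Longrightarrow> \<bar>profile' q\<bar> \<le> C * q powr (-1/2)"
    "\<And>q. q > 0 \<Longrightarrow> \<bar>profile'' q\<bar> \<le> C * q powr (-3/2)"
    "\<And>q. q > 0 \<Longrightarrow> \<bar>profile q\<bar> \<le> C"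
    using profile_bounds by blast
  show ?thesis
  proof (rule that[of "4 * C"])
    show "4 * C > 0" using C by simp
    fix t y :: real assume t: "t > 0" and y: "y > 0"
    have q0: "sqrt t * y powr (3/2) > 0" using t y by simp
    have qp: "(sqrt t * y powr (3/2)) powr p = t powr (p/2) * y powr (3/2*p)" for p
      using t y by (simp add: powr_mult powr_powr powr_half_sqrt[symmetric])
    have "\<bar>row_int_rem t y\<bar> \<le> t powr (-1/2) * y powr (-1/2) * (C * (t powr (1/2/2) * y powr (3/2*(1/2))))"
      unfolding row_int_rem_def abs_mult using C(2)[OF q0] by (simp add: qp[of "1/2"] mult_left_mono)
    also have "\<dots> = C * ((t powr (-1/2) * t powr (1/2/2)) * (y powr (-1/2) * y powr (3/2*(1/2))))"
      by (simp only: mult_ac)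
    also have "\<dots> = C * t powr (-1/4) * y powr (1/4)"
      by (simp only: powr_add[symmetric]) simp
    also have "\<dots> \<le> 4 * C * t powr (-1/4) * y powr (1/4)" using C by (intro mult_right_mono) auto
    finally show "\<bar>row_int_rem t y\<bar> \<le> 4 * C * t powr (-1/4) * y powr (1/4)" .
    have "\<bar>row_int t y\<bar> \<le> (t * y) powr (-1/2) * C"
      unfolding row_int_def abs_mult using C(5)[OF q0] by (simp add: mult_left_mono)
    also have "\<dots> \<le> (t * y) powr (-1/2) * (4 * C)" using C by (intro mult_left_mono) auto
    finally show "\<bar>row_int t y\<bar> \<le> 4 * C * (t * y) powr (-1/2)" by (simp add: mult_ac)
  next
    fix t k :: real assume t: "t > 0" and k: "k > 0"
    define q where "q = (\<lambda>y. sqrt t * y powr (3/2))"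
    define Q where "Q = (\<lambda>y. profile (q y) - profile 0)"
    define a where "a = t powr (-1/2)"
    define f' where "f' = (\<lambda>y. a * (- (1/2) * y powr (-3/2) * Q y + 3/2 * sqrt t * profile' (q y)))"
    define f'' where "f'' = (\<lambda>y. a * (3/4 * y powr (-5/2) * Q y - 3/4 * sqrt t * y powr (-1) * profile' (q y)
       + 9/4 * t * y powr (1/2) * profile'' (q y)))"
    have dq: "(q has_real_derivative 3/2 * sqrt t * y powr (1/2)) (at y)" if "y > 0" for y
      unfolding q_def using that by (auto intro!: derivative_eq_intros)
    have dp: "((\<lambda>y. y powr r) has_real_derivative r * y powr (r - 1)) (at y)" if "y > 0" for y r :: real
      using that by (auto intro!: derivative_eq_intros)
    have dQ: "(Q has_real_derivative profile' (q y) * (3/2 * sqrt t * y powr (1/2))) (at y)" if "y > 0" for y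
      unfolding Q_def using DERIV_diff[OF DERIV_chain2[OF profile_deriv dq[OF that]] DERIV_const] by simp
    have d1: "(row_int_rem t has_real_derivative f' y) (at y)" if y: "y > 0" for y
    proof -
      have "((\<lambda>y. a * (y powr (-1/2) * Q y)) has_real_derivative 
          a * ((-1/2) * y powr (-1/2 - 1) * Q y + profile' (q y) * (3/2 * sqrt t * y powr (1/2)) * y powr (-1/2))) (at y)"
        by (intro DERIV_cmult DERIV_mult dp dQ y)
      moreover have "y powr (1/2) * y powr (-1/2) = 1" using y by (simp add: powr_add[symmetric])
      hence "profile' (q y) * (3/2 * sqrt t * y powr (1/2)) * y powr (-1/2) = 3/2 * sqrt t * profile' (q y)"
        by (simp only: mult.assoc) simp
      moreover have "row_int_rem t = (\<lambda>y. a * (y powr (-1/2) * Q y))"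
        by (auto simp: row_int_rem_def a_def Q_def q_def)
      moreover have "-1/2 - 1 = (-3/2 :: real)" "-1/2 = - (1/2 :: real)" by simp_all
      ultimately show ?thesis unfolding f'_def by (simp only:)
    qed
    have d2: "(f' has_real_derivative f'' y) (at y)" if y: "y > 0" for y
    proof -
      have "(f' has_real_derivative a * ((- (1/2) * ((-3/2) * y powr (-3/2 - 1))) * Q y + 
          profile' (q y) * (3/2 * sqrt t * y powr (1/2)) * (- (1/2) * y powr (-3/2))
          + 3/2 * sqrt t * (profile'' (q y) * (3/2 * sqrt t * y powr (1/2))))) (at y)"
        unfolding f'_def
        by (intro DERIV_cmult DERIV_add DERIV_mult dp dQ y DERIV_chain2[OF profile'_deriv dq])
      moreover have "y powr (1/2) * y powr (-3/2) = y powr (-1)" by (simp only: powr_add[symmetric]) simp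
      hence "- (3/4 * sqrt t * y powr (-1) * profile' (q y)) = - (3/4 * sqrt t * (y powr (1/2) * y powr (-3/2)) * profile' (q y))"
        by (simp only:)
      hence "profile' (q y) * (3/2 * sqrt t * y powr (1/2)) * (- (1/2) * y powr (-3/2)) 
         = - (3/4 * sqrt t * y powr (-1) * profile' (q y))"
        by (simp only:) simp
      moreover have "3/2 * sqrt t * (profile'' (q y) * (3/2 * sqrt t * y powr (1/2))) 
          = 9/4 * (sqrt t * sqrt t) * y powr (1/2) * profile'' (q y)" by simp
      moreover have "sqrt t * sqrt t = t" using t by simp
      moreover have "- (1/2) * ((-3/2) * y powr (-3/2 - 1)) = 3/4 * y powr (-5/2)" by simp
      ultimately have "(f' has_real_derivative a * (3/4 * y powr (-5/2) * Q y + - (3/4 * sqrt t * y powr (-1) * profile' (q y))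
          + 9/4 * t * y powr (1/2) * profile'' (q y))) (at y)" by (simp only:)
      thus ?thesis unfolding f''_def by (simp only: add_uminus_conv_diff)
    qed
    have bound: "\<bar>f'' y\<bar> \<le> 4 * C * t powr (-1/4) * k powr (-7/4)" if yk: "y \<in> {k..k+1}" for y
    proof -
      have y: "y > 0" using yk k by auto
      have q0: "q y > 0" using t y by (simp add: q_def)
      have qp: "q y powr p = t powr (p/2) * y powr (3/2*p)" for p
        using t y by (simp add: q_def powr_mult powr_powr powr_half_sqrt[symmetric])
      have "\<bar>f'' y\<bar> \<le> a * (3/4 * y powr (-5/2) * \<bar>Q y\<bar> + 3/4 * sqrt t * y powr (-1) * \<bar>profile' (q y)\<bar>
       + 9/4 * t * y powr (1/2) * \<bar>profile'' (q y)\<bar>)"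
      proof -
        have "\<bar>b - c + d\<bar> \<le> \<bar>b\<bar> + \<bar>c\<bar> + \<bar>d\<bar>" for b c d :: real by linarith
        from this[of "3/4 * y powr (-5/2) * Q y" "3/4 * sqrt t * y powr (-1) * profile' (q y)" "9/4 * t * y powr (1/2) * profile'' (q y)"]
        show ?thesis unfolding f''_def abs_mult using t by (simp add: a_def mult_left_mono)
      qed
      also have "\<dots> \<le> a * (3/4 * y powr (-5/2) * (C * q y powr (1/2)) + 3/4 * sqrt t * y powr (-1) * (C * q y powr (-1/2))
       + 9/4 * t * y powr (1/2) * (C * q y powr (-3/2)))"
        using C(2-4)[OF q0] t unfolding Q_def
        by (intro mult_left_mono add_mono) (auto simp: a_def)
      also have "sqrt t = t powr (1/2)" using t by (simp add: powr_half_sqrt)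
      also have "a * (3/4 * y powr (-5/2) * (C * q y powr (1/2)) + 3/4 * t powr (1/2) * y powr (-1) * (C * q y powr (-1/2))
          + 9/4 * t * y powr (1/2) * (C * q y powr (-3/2)))
        = C * (3/4 * ((t powr (-1/2) * t powr (1/2/2)) * (y powr (-5/2) * y powr (3/2*(1/2)))) 
            + 3/4 * ((t powr (-1/2) * t powr (1/2) * t powr ((-1/2)/2)) * (y powr (-1) * y powr (3/2*(-1/2))))
            + 9/4 * ((t powr (-1/2) * t powr 1 * t powr ((-3/2)/2)) * (y powr (1/2) * y powr (3/2*(-3/2)))))"
        using t unfolding qp a_def by (simp add: algebra_simps)
      \<comment> \<open>All three terms have the same exponents in \<open>t\<close> and in
        \<open>y\<close>; their coefficients \<open>3/4\<close>, \<open>3/4\<close> and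
        \<open>9/4\<close> add up to \<open>15/4\<close>, whence the factor 4 in the
        constant.\<close>
      also have "\<dots> = C * (15/4) * t powr (-1/4) * y powr (-7/4)"
        by (simp only: powr_add[symmetric]) simp
      also have "\<dots> \<le> C * 4 * t powr (-1/4) * k powr (-7/4)"
        using C(1) yk k t by (intro mult_mono powr_mono2') auto
      finally show ?thesis by (simp add: mult_ac)
    qed
    show "\<bar>(row_int_rem t k + row_int_rem t (k + 1)) / 2 - integral {k..k+1} (row_int_rem t)\<bar> 
       \<le> 4 * C * t powr (-1/4) * k powr (-7/4)"
      by (rule trapezoid_error[of k _ f' f'']) (use d1 d2 bound k in auto)
  qed
qed

lemma integral_powr_minus_half:
  fixes a b :: real
  assumes "0 < a" "a \<le> b"
  shows "((\<lambda>y. y powr (-1/2)) has_integral 2 * (sqrt b - sqrt a)) {a..b}"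
proof -
  have "((\<lambda>y. y powr (-1/2)) has_integral 2 * sqrt b - 2 * sqrt a) {a..b}"
  proof (rule fundamental_theorem_of_calculus)
    fix y assume y: "y \<in> {a..b}"
    hence "((\<lambda>y. 2 * sqrt y) has_real_derivative y powr (-1/2)) (at y)"
      using assms by (auto intro!: derivative_eq_intros simp: powr_minus_divide powr_half_sqrt field_simps)
    thus "((\<lambda>y. 2 * sqrt y) has_vector_derivative y powr (-1/2)) (at y within {a..b})"
      by (auto simp: has_real_derivative_iff_has_vector_derivative intro: has_vector_derivative_at_within)
  qed fact
  thus ?thesis by simp
qed

text \<open>The trapezoidal error of the singular part \<open>p * y powr (-1/2)\<close> is a fixed
  multiple of \<open>p\<close> and does not become relatively small with \<open>t\<close>, so it is
  evaluated exactly; only the errors of \<open>row_int_rem\<close> are estimated. The nodes start at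
  1, and the integral over \<open>{0..1}\<close> is treated separately because of the singularity.
  The total mass \<open>K\<close> remains a parameter until the next section.\<close>

lemma row_int_sums:
  fixes K :: real
  assumes K: "\<And>t. t > 0 \<Longrightarrow> (\<integral>\<^sup>+y. ennreal (row_int t y) * indicator {0<..} y \<partial>lborel) = ennreal (t powr (-2/3) * K)"
    and K0: "K \<ge> 0"
  obtains C where "C > 0" "\<And>t. t > 0 \<Longrightarrow> summable (\<lambda>i. row_int t (1 + real i))"
    "\<And>t. t > 0 \<Longrightarrow> \<bar>(\<Sum>i. row_int t (1 + real i)) - K * t powr (-2/3) - profile 0 * zeta_real (1/2) * t powr (-1/2)\<bar> 
       \<le> C * t powr (-1/4)"
proof -
  obtain C where C: "C > 0" 
    "\<And>t y. t > 0 \<Longrightarrow> y > 0 \<Longrightarrow> \<bar>row_int_rem t y\<bar> \<le> C * t powr (-1/4) * y powr (1/4)"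
    "\<And>t y. t > 0 \<Longrightarrow> y > 0 \<Longrightarrow> \<bar>row_int t y\<bar> \<le> C * (t * y) powr (-1/2)"
    "\<And>t k. t > 0 \<Longrightarrow> k > 0 \<Longrightarrow> \<bar>(row_int_rem t k + row_int_rem t (k + 1)) / 2 - integral {k..k+1} (row_int_rem t)\<bar> 
       \<le> C * t powr (-1/4) * k powr (-7/4)"
    using row_int_rem_bounds by blast
  define S where "S = (\<Sum>i. real (Suc i) powr (-7/4))"
  have sS: "summable (\<lambda>i. real (Suc i) powr (-7/4))"
    by (subst summable_Suc_iff, subst summable_real_powr_iff) auto
  have S0: "S \<ge> 0" unfolding S_def by (intro suminf_nonneg sS) auto
  define z where "z = zeta_real (1/2)"
  have main: "\<exists>s. (\<lambda>i. row_int t (1 + real i)) sums s \<and> 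
      \<bar>s - K * t powr (-2/3) - profile 0 * z * t powr (-1/2)\<bar> \<le> (2 * C + C * S) * t powr (-1/4)" if t: "t > 0" for t
  proof -
    define p where "p = profile 0 * t powr (-1/2)"
    have profile_cont: "continuous_on A profile" for A
      by (intro continuous_at_imp_continuous_on ballI DERIV_isCont[OF profile_deriv])
    have cont: "continuous_on {0<..} (row_int t)" 
      unfolding row_int_def using t by (intro continuous_intros continuous_on_compose2[OF profile_cont[of UNIV]]) auto
    have cont_rem: "continuous_on {0<..} (row_int_rem t)" 
      unfolding row_int_rem_def using t by (intro continuous_intros continuous_on_compose2[OF profile_cont[of UNIV]]) auto
    have "(\<lambda>y. indicator {0<..} y * row_int t y) \<in> borel_measurable lborel"
      using borel_measurable_continuous_on_indicator[OF _ cont] by (simp add: measurable_lborel1)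
    hence meas: "(\<lambda>y. row_int t y * indicator {0<..} y) \<in> borel_measurable lborel" by (simp add: mult.commute)
    have nn: "(\<integral>\<^sup>+y. ennreal (row_int t y * indicator {0<..} y) \<partial>lborel) = ennreal (t powr (-2/3) * K)"
      unfolding K[OF t, symmetric] by (intro nn_integral_cong) (auto simp: indicator_def)
    have hb: "has_bochner_integral lborel (\<lambda>y. row_int t y * indicator {0<..} y) (t powr (-2/3) * K)"
      using K0 by (intro has_bochner_integral_nn_integral meas nn) 
        (auto simp: indicator_def intro!: row_int_nonneg t)
    \<comment> \<open>The default value of \<open>powr\<close> at 0 allows \<open>{0<..}\<close> and
      \<open>{0..}\<close> to be exchanged without a null set argument.\<close>
    have at0: "row_int t 0 = 0" by (simp add: row_int_def)
    have eq0: "(\<lambda>y. row_int t y * indicator {0<..} y) = (\<lambda>y. indicator {0..} y *\<^sub>R row_int t y)"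
      using at0 by (auto simp: indicator_def fun_eq_iff)
    have si: "set_integrable lborel {0..} (row_int t)" and tot: "(LBINT y:{0..}. row_int t y) = t powr (-2/3) * K"
      using hb unfolding set_integrable_def set_lebesgue_integral_def eq0 by (auto simp: has_bochner_integral_iff)
    have hk: "(row_int t) integrable_on {0..b}" "integral {0..b} (row_int t) = (LBINT y:{0..b}. row_int t y)" for b
    proof -
      have "set_integrable lborel {0..b} (row_int t)" by (rule set_integrable_subset[OF si]) auto
      thus "(row_int t) integrable_on {0..b}" "integral {0..b} (row_int t) = (LBINT y:{0..b}. row_int t y)"
        by (auto simp: set_borel_integral_eq_integral)
    qed
    have "((\<lambda>b. LBINT y:{0..b}. row_int t y) \<longlongrightarrow> t powr (-2/3) * K) at_top"
      using tendsto_set_lebesgue_integral_at_top[OF _ si] tot by simp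
    moreover have "filterlim (\<lambda>n. 1 + real n) at_top sequentially" by real_asymp
    ultimately have "(\<lambda>n. integral {0..1 + real n} (row_int t)) \<longlonglongrightarrow> t powr (-2/3) * K"
      unfolding hk by (rule filterlim_compose)
    hence "(\<lambda>n. integral {0..1 + real n} (row_int t) - integral {0..1} (row_int t)) \<longlonglongrightarrow> t powr (-2/3) * K - integral {0..1} (row_int t)"
      by (intro tendsto_intros)
    also have "(\<lambda>n. integral {0..1 + real n} (row_int t) - integral {0..1} (row_int t)) = (\<lambda>n. integral {1..1 + real n} (row_int t))"
    proof
      fix n
      have "integral {0..1} (row_int t) + integral {1..1 + real n} (row_int t) = integral {0..1 + real n} (row_int t)"
        by (rule Henstock_Kurzweil_Integration.integral_combine) (use hk(1) in auto)
      thus "integral {0..1 + real n} (row_int t) - integral {0..1} (row_int t) = integral {1..1 + real n} (row_int t)" by linarith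
    qed
    finally have I: "(\<lambda>n. integral {1..1 + real n} (row_int t)) \<longlonglongrightarrow> t powr (-2/3) * K - integral {0..1} (row_int t)" .
    have f0: "(\<lambda>n. row_int t (1 + real n)) \<longlonglongrightarrow> 0"
    proof (rule Lim_null_comparison)
      show "\<forall>\<^sub>F n in sequentially. norm (row_int t (1 + real n)) \<le> C * (t * (1 + real n)) powr (-1/2)"
        using C(3)[OF t] by (intro always_eventually) auto
      show "(\<lambda>n. C * (t * (1 + real n)) powr (-1/2)) \<longlonglongrightarrow> 0" using t C(1) by real_asymp
    qed
    define d where "d = (\<lambda>i. (row_int_rem t (1 + real i) + row_int_rem t (1 + real i + 1)) / 2 
        - integral {1 + real i..1 + real i + 1} (row_int_rem t))"
    have d: "\<bar>d i\<bar> \<le> C * t powr (-1/4) * real (Suc i) powr (-7/4)" for i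
      using C(4)[OF t, of "1 + real i"] by (simp add: d_def add_ac)
    have sd: "summable (\<lambda>i. C * t powr (-1/4) * real (Suc i) powr (-7/4))" by (intro summable_mult sS)
    have sumd: "summable d" by (rule summable_comparison_test'[OF sd, where N=0]) (use d in auto)
    have "\<bar>suminf d\<bar> \<le> (\<Sum>i. C * t powr (-1/4) * real (Suc i) powr (-7/4))"
      using norm_suminf_le[of d, OF _ sd] d by simp
    also have "\<dots> = C * t powr (-1/4) * S" unfolding S_def by (rule suminf_mult[OF sS])
    finally have dS: "\<bar>suminf d\<bar> \<le> C * t powr (-1/4) * S" .
    define v where "v = (\<lambda>i. real (Suc i) powr (-1/2))"
    have v0: "v \<longlonglongrightarrow> 0" unfolding v_def by real_asymp
    have tele: "(\<lambda>i. (v i - v (Suc i)) / 2) sums ((v 0 - 0) / 2)"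
      using sums_divide[OF telescope_sums'[OF v0]] by simp
    \<comment> \<open>Passing from the left-endpoint rule, whose errors add up to
      \<open>z + 2\<close>, to the trapezoidal rule subtracts \<open>(v i - v (Suc i)) / 2\<close>
      from each error, altogether \<open>1/2\<close>.\<close>
    have zs: "(\<lambda>i. (v i - 2 * (sqrt (real (Suc (Suc i))) - sqrt (real (Suc i)))) - (v i - v (Suc i)) / 2) sums (z + 2 - (v 0 - 0) / 2)"
      unfolding z_def using zeta_real_half_sums by (intro sums_diff tele) (simp add: v_def)
    have e: "(\<lambda>i. (row_int t (1 + real i) + row_int t (1 + real i + 1)) / 2 - integral {1 + real i..1 + real i + 1} (row_int t)) 
        sums (p * (z + 3/2) + suminf d)"
    proof -
      have "(row_int t (1 + real i) + row_int t (1 + real i + 1)) / 2 - integral {1 + real i..1 + real i + 1} (row_int t)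
        = p * ((v i - 2 * (sqrt (real (Suc (Suc i))) - sqrt (real (Suc i)))) - (v i - v (Suc i)) / 2) + d i" for i
      proof -
        have "integral {1 + real i..1 + real i + 1} (row_int t) = integral {1 + real i..1 + real i + 1} (\<lambda>y. p * y powr (-1/2) + row_int_rem t y)"
          by (intro integral_cong) (auto simp: row_int_decomp t p_def)
        also have "\<dots> = p * (2 * (sqrt (1 + real i + 1) - sqrt (1 + real i))) + integral {1 + real i..1 + real i + 1} (row_int_rem t)"
          by (intro integral_unique has_integral_add has_integral_mult_right integral_powr_minus_half integrable_integral
              integrable_continuous_real continuous_on_subset[OF cont_rem]) auto
        finally show ?thesis
          using row_int_decomp[OF t, of "1 + real i"] row_int_decomp[OF t, of "1 + real i + 1"]
          by (simp add: d_def v_def p_def field_simps add_ac)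
      qed
      moreover have "z + 2 - (v 0 - 0) / 2 = z + 3/2" by (simp add: v_def)
      ultimately show ?thesis using sums_add[OF sums_mult[OF zs, of p] summable_sums[OF sumd]] by (simp only:)
    qed
    have c1: "continuous_on {1..} (row_int t)" by (rule continuous_on_subset[OF cont]) auto
    from trapezoid_sums[OF c1 I f0 e] 
    have sums: "(\<lambda>i. row_int t (1 + real i)) sums 
      (t powr (-2/3) * K - integral {0..1} (row_int t) + row_int t 1 / 2 + (p * (z + 3/2) + suminf d))" .
    define J where "J = integral {0..1} (\<lambda>y. row_int_rem t y)"
    have hi: "((\<lambda>y::real. y powr (-1/2)) has_integral 2) {0..1}"
      using has_integral_powr_from_0[of "-1/2" 1] by simp
    have ir: "row_int_rem t integrable_on {0..1}"
    proof -
      have "(\<lambda>y. row_int t y - p * y powr (-1/2)) integrable_on {0..1}"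
        using hk(1) has_integral_integrable[OF has_integral_mult_right[OF hi]] by (intro integrable_diff)
      thus ?thesis by (rule integrable_eq) (auto simp: row_int_decomp t p_def)
    qed
    have "integral {0..1} (row_int t) = integral {0..1} (\<lambda>y. p * y powr (-1/2) + row_int_rem t y)"
      by (intro integral_cong) (auto simp: row_int_decomp t p_def)
    also have "\<dots> = p * 2 + J"
      unfolding J_def by (intro integral_unique has_integral_add has_integral_mult_right hi integrable_integral ir)
    finally have I01: "integral {0..1} (row_int t) = p * 2 + J" .
    have J: "\<bar>J\<bar> \<le> C * t powr (-1/4)"
    proof -
      have "norm J \<le> integral {0..1::real} (\<lambda>_. C * t powr (-1/4))"
        unfolding J_def
      proof (rule integral_norm_bound_integral[OF ir])
        fix y :: real assume y: "y \<in> {0..1}"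
        show "norm (row_int_rem t y) \<le> C * t powr (-1/4)"
        proof (cases "y = 0")
          case True thus ?thesis using C(1) by (simp add: row_int_rem_def)
        next
          case False
          hence "norm (row_int_rem t y) \<le> C * t powr (-1/4) * y powr (1/4)" using C(2)[OF t, of y] y by simp
          also have "\<dots> \<le> C * t powr (-1/4) * 1" using y C(1) by (intro mult_left_mono powr_le1) auto
          finally show ?thesis by simp
        qed
      qed auto
      thus ?thesis by simp
    qed
    have r1: "\<bar>row_int_rem t 1\<bar> \<le> C * t powr (-1/4)" using C(2)[OF t, of 1] by simp
    have i1: "row_int t 1 = p + row_int_rem t 1" using row_int_decomp[OF t, of 1] by (simp add: p_def)
    \<comment> \<open>The multiples of \<open>p\<close> are \<open>-2\<close> from the integral over
      \<open>{0..1}\<close>, \<open>1/2\<close> from the first node and \<open>z + 3/2\<close> from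
      the trapezoidal errors. The numbers cancel and exactly \<open>p * z\<close> survives.\<close>
    have "t powr (-2/3) * K - integral {0..1} (row_int t) + row_int t 1 / 2 + (p * (z + 3/2) + suminf d) 
         - K * t powr (-2/3) - profile 0 * z * t powr (-1/2) = - J + row_int_rem t 1 / 2 + suminf d"
      unfolding I01 i1 by (simp add: p_def field_simps)
    also have "\<bar>- J + row_int_rem t 1 / 2 + suminf d\<bar> \<le> (2 * C + C * S) * t powr (-1/4)"
    proof -
      have "\<bar>- J + row_int_rem t 1 / 2 + suminf d\<bar> \<le> \<bar>J\<bar> + \<bar>row_int_rem t 1\<bar> + \<bar>suminf d\<bar>" by linarith
      also have "\<dots> \<le> C * t powr (-1/4) + C * t powr (-1/4) + C * t powr (-1/4) * S"
        by (intro add_mono J r1 dS)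
      finally show ?thesis by (simp add: algebra_simps)
    qed
    finally show ?thesis using sums by blast
  qed
  show ?thesis
  proof (rule that[of "2 * C + C * S"])
    show "2 * C + C * S > 0" using C(1) S0 by (simp add: add_pos_nonneg)
    fix t :: real assume "t > 0"
    from main[OF this] show "summable (\<lambda>i. row_int t (1 + real i))"
      "\<bar>(\<Sum>i. row_int t (1 + real i)) - K * t powr (-2/3) - profile 0 * zeta_real (1/2) * t powr (-1/2)\<bar> 
         \<le> (2 * C + C * S) * t powr (-1/4)"
      by (auto simp: sums_iff z_def)
  qed
qed

section \<open>The leading constant\<close>

text \<open>The substitution \<open>r = \<kappa> * y ^ 3\<close> turns the integrand into that of
  \<open>Gamma (5/3)\<close>, up to the factor \<open>\<kappa> powr (-2/3) / 3\<close>.\<close>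

lemma Gamma_cubic_integral:
  fixes \<kappa> :: real
  assumes "\<kappa> > 0"
  shows "(\<integral>\<^sup>+y. ennreal (indicator {0<..} y * (y * xexp (\<kappa> * y ^ 3))) \<partial>lborel) 
     = ennreal (\<kappa> powr (-2/3) * Gamma (5/3) / 3)"
proof -
  define g where "g = (\<lambda>y::real. \<kappa> * y ^ 3)"
  define f where "f = (\<lambda>r::real. r powr (5/3 - 1) / exp r)"
  have "(f has_integral Gamma (5/3)) {0..}" unfolding f_def by (rule Gamma_integral_real) simp
  hence fi: "(f has_integral Gamma (5/3)) {0<..}"
    by (subst has_integral_spike_set_eq[where T="{0..}"]) (auto intro: negligible_subset[of "{0}"])
  have img: "g ` {0<..} = {0<..}"
  proof
    show "g ` {0<..} \<subseteq> {0<..}" using assms by (auto simp: g_def)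
    show "{0<..} \<subseteq> g ` {0<..}"
    proof
      fix r :: real assume r: "r \<in> {0<..}"
      hence "r = g (root 3 (r / \<kappa>))" "root 3 (r / \<kappa>) \<in> {0<..}" using assms by (auto simp: g_def)
      thus "r \<in> g ` {0<..}" by (rule image_eqI)
    qed
  qed
  have fa: "f absolutely_integrable_on (g ` {0<..}) \<and> integral (g ` {0<..}) f = Gamma (5/3)"
    unfolding img using fi by (intro conjI nonnegative_absolutely_integrable_1) (auto simp: f_def has_integral_iff)
  have inj: "inj_on g {0<..}"
  proof (rule inj_onI)
    fix x y assume xy: "x \<in> {0<..}" "y \<in> {0<..}" "g x = g y"
    hence "x ^ 3 = y ^ 3" using assms by (simp add: g_def)
    thus "x = y" by (rule power_eq_imp_eq_base) (use xy in auto)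
  qed
  have "(\<lambda>y. \<bar>3 * \<kappa> * y\<^sup>2\<bar> * f (g y)) absolutely_integrable_on {0<..} \<and>
           integral {0<..} (\<lambda>y. \<bar>3 * \<kappa> * y\<^sup>2\<bar> * f (g y)) = Gamma (5/3)"
  proof (subst has_absolute_integral_change_of_variables_1'[where g=g])
    show "(g has_real_derivative 3 * \<kappa> * y\<^sup>2) (at y within {0<..})" for y
      unfolding g_def by (auto intro!: derivative_eq_intros)
  qed (use fa inj in auto)
  hence "((\<lambda>y. \<bar>3 * \<kappa> * y\<^sup>2\<bar> * f (g y)) has_integral Gamma (5/3)) {0<..}"
    by (auto simp: has_integral_iff absolutely_integrable_on_def)
  hence "((\<lambda>y. \<kappa> powr (-2/3) / 3 * (\<bar>3 * \<kappa> * y\<^sup>2\<bar> * f (g y))) has_integral \<kappa> powr (-2/3) / 3 * Gamma (5/3)) {0<..}"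
    by (rule has_integral_mult_right)
  hence "((\<lambda>y. y * xexp (\<kappa> * y ^ 3)) has_integral \<kappa> powr (-2/3) / 3 * Gamma (5/3)) {0<..}"
  proof (rule has_integral_eq[rotated])
    fix y :: real assume y: "y \<in> {0<..}"
    have "f (g y) = \<kappa> powr (2/3) * y powr 2 * exp (- (\<kappa> * y ^ 3))"
    proof -
      have "g y = \<kappa> * y powr 3" using y by (simp add: g_def)
      hence "g y powr (2/3) = \<kappa> powr (2/3) * (y powr 3) powr (2/3)" using assms by (simp only: powr_mult)
      also have "(y powr 3) powr (2/3) = y powr 2" by (simp only: powr_powr) simp
      finally have "g y powr (2/3) = \<kappa> powr (2/3) * y powr 2" .
      moreover have "f (g y) = g y powr (2/3) * exp (- g y)" by (simp add: f_def exp_minus inverse_eq_divide)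
      moreover have "g y = \<kappa> * y ^ 3" by (simp add: g_def)
      ultimately show ?thesis by (simp only:)
    qed
    moreover have "\<kappa> powr (-2/3) * \<kappa> powr (2/3) = 1" using assms by (simp add: powr_add[symmetric])
    moreover have "\<bar>3 * \<kappa> * y\<^sup>2\<bar> = 3 * \<kappa> * y\<^sup>2" using assms by simp
    moreover have "y powr 2 = y\<^sup>2" using y by simp
    moreover have "a / 3 * (3 * \<kappa> * y\<^sup>2 * (b * y\<^sup>2 * e)) = y * (\<kappa> * y ^ 3 * e)" if "a * b = 1" for a b e :: real
    proof -
      have "a / 3 * (3 * \<kappa> * y\<^sup>2 * (b * y\<^sup>2 * e)) = (a * b) * (y * (\<kappa> * y ^ 3 * e))"
        by (simp add: power2_eq_square power3_eq_cube)
      thus ?thesis using that by simp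
    qed
    ultimately show "\<kappa> powr (-2/3) / 3 * (\<bar>3 * \<kappa> * y\<^sup>2\<bar> * f (g y)) = y * xexp (\<kappa> * y ^ 3)"
      unfolding xexp_def by (simp only:)
  qed
  hence "(\<integral>\<^sup>+y. ennreal (indicator {0<..} y * (y * xexp (\<kappa> * y ^ 3))) \<partial>lborel) = ennreal (\<kappa> powr (-2/3) / 3 * Gamma (5/3))"
    using assms by (intro nn_integral_has_integral_lebesgue) (auto simp: xexp_def)
  thus ?thesis by simp
qed

text \<open>With \<open>p = v / (v + 1)\<close> the half-line \<open>{1..}\<close> becomes
  \<open>{1/2..<1}\<close>, and the integrand becomes that of \<open>Beta (1/3) (1/3)\<close>. The
  latter is symmetric under \<open>p\<close> to \<open>1 - p\<close>, so this half of the unit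
  interval carries half of the value.\<close>

lemma half_Beta_integral:
  "((\<lambda>v::real. (v * (v + 1)) powr (-2/3)) has_integral Beta (1/3) (1/3) / 2) {1..}"
proof -
  define f where "f = (\<lambda>p::real. p powr (1/3 - 1) * (1 - p) powr (1/3 - 1))"
  define B :: real where "B = Beta (1/3) (1/3)"
  have F: "(f has_integral B) {0..1}"
    unfolding f_def B_def by (rule has_integral_Beta_real) auto
  have fi: "f integrable_on {0..1}" using F by blast
  have f0: "f p \<ge> 0" for p by (simp add: f_def)
  have sub: "f absolutely_integrable_on {a..b}" if "0 \<le> a" "b \<le> 1" for a b
    using that fi f0 by (intro nonnegative_absolutely_integrable_1 integrable_on_subinterval[OF fi]) auto
  have comb: "integral {0..1/2} f + integral {1/2..1} f = B"
    using Henstock_Kurzweil_Integration.integral_combine[of 0 "1/2" 1 f] fi F by (auto simp: has_integral_iff)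
  have img: "(\<lambda>p. 1 - p) ` {1/2..1} = {0..1/2::real}"
    by (auto simp: image_iff intro!: bexI[of _ "1 - _"])
  have "(\<lambda>p. \<bar>-1\<bar> * f (1 - p)) absolutely_integrable_on {1/2..1} \<and>
           integral {1/2..1} (\<lambda>p. \<bar>-1\<bar> * f (1 - p)) = integral {0..1/2} f"
    by (subst has_absolute_integral_change_of_variables_1'[where g="\<lambda>p. 1 - p"])
       (use sub[of 0 "1/2"] img in \<open>auto intro!: derivative_eq_intros inj_onI\<close>)
  moreover have "f (1 - p) = f p" for p by (simp add: f_def)
  ultimately have half: "integral {1/2..1} f = B / 2" using comb by simp
  define g where "g = (\<lambda>v::real. v / (v + 1))"
  have img2: "g ` {1..} = {1/2..<1}"
  proof
    show "g ` {1..} \<subseteq> {1/2..<1}" by (auto simp: g_def field_simps)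
    show "{1/2..<1} \<subseteq> g ` {1..}"
    proof
      fix p :: real assume p: "p \<in> {1/2..<1}"
      hence "g (p / (1 - p)) = p" "p / (1 - p) \<ge> 1" by (auto simp: g_def field_simps)
      thus "p \<in> g ` {1..}" by (intro image_eqI[of _ _ "p / (1 - p)"]) auto
    qed
  qed
  have "(f has_integral B / 2) {1/2..1}" using half sub[of "1/2" 1] 
    by (auto simp: has_integral_iff absolutely_integrable_on_def)
  hence "(f has_integral B / 2) {1/2..<1}"
    by (subst has_integral_spike_set_eq[where T="{1/2..1}"]) (auto intro: negligible_subset[of "{1}"])
  hence fa: "f absolutely_integrable_on (g ` {1..}) \<and> integral (g ` {1..}) f = B / 2"
    unfolding img2 using f0 by (intro conjI nonnegative_absolutely_integrable_1) (auto simp: has_integral_iff)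
  have "(\<lambda>v. \<bar>1 / (v + 1)\<^sup>2\<bar> * f (g v)) absolutely_integrable_on {1..} \<and>
           integral {1..} (\<lambda>v. \<bar>1 / (v + 1)\<^sup>2\<bar> * f (g v)) = B / 2"
  proof (subst has_absolute_integral_change_of_variables_1'[where g=g])
    show "inj_on g {1..}" by (auto intro!: inj_onI simp: g_def field_simps)
    show "(g has_real_derivative 1 / (x + 1)\<^sup>2) (at x within {1..})" if "x \<in> {1..}" for x
      unfolding g_def using that by (auto intro!: derivative_eq_intros simp: power2_eq_square field_simps)
  qed (use fa in auto)
  hence "((\<lambda>v. \<bar>1 / (v + 1)\<^sup>2\<bar> * f (g v)) has_integral B / 2) {1..}"
    by (auto simp: has_integral_iff absolutely_integrable_on_def)
  thus ?thesis unfolding B_def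
  proof (rule has_integral_eq[rotated])
    fix v :: real assume v: "v \<in> {1..}"
    have "f (g v) = (v / (v + 1) * (1 / (v + 1))) powr (-2/3)"
    proof -
      have "1 - g v = 1 / (v + 1)" using v by (simp add: g_def field_simps)
      hence "f (g v) = (v / (v + 1)) powr (1/3 - 1) * (1 / (v + 1)) powr (1/3 - 1)"
        unfolding f_def by (simp only: g_def)
      also have "\<dots> = (v / (v + 1) * (1 / (v + 1))) powr (1/3 - 1)" using v by (intro powr_mult[symmetric])
      finally show ?thesis by simp
    qed
    also have "v / (v + 1) * (1 / (v + 1)) = v * (v + 1) * (v + 1) powr (-3)"
    proof -
      have "w / x * (1 / x) = w * x * (1 / x ^ 3)" if "x \<noteq> 0" for w x :: real
        using that by (simp add: power3_eq_cube)
      moreover have "(v + 1) powr (-3) = 1 / (v + 1) ^ 3" using v by (simp add: powr_minus_divide)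
      ultimately show ?thesis using v by simp
    qed
    also have "(v * (v + 1) * (v + 1) powr (-3)) powr (-2/3) = (v * (v + 1)) powr (-2/3) * ((v + 1) powr (-3)) powr (-2/3)"
      using v by (intro powr_mult)
    also have "((v + 1) powr (-3)) powr (-2/3) = (v + 1) powr 2" by (simp only: powr_powr) simp
    finally show "\<bar>1 / (v + 1)\<^sup>2\<bar> * f (g v) = (v * (v + 1)) powr (-2/3)" using v by simp
  qed
qed

text \<open>The left side is a double integral over the sector \<open>x >= y > 0\<close>. In the
  coordinates \<open>y\<close> and \<open>v = x / y\<close> the exponent becomes
  \<open>t * v * (v + 1) / 2 * y ^ 3\<close>, so the \<open>y\<close>-integral is a Gamma integral
  and the remaining \<open>v\<close>-integral is half a Beta integral. The values at
  \<open>2/3\<close> cancel between \<open>Gamma (5/3) = 2/3 * Gamma (2/3)\<close> and the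
  denominator of the Beta function.\<close>

lemma row_int_total:
  assumes t: "t > 0"
  shows "(\<integral>\<^sup>+y. ennreal (row_int t y) * indicator {0<..} y \<partial>lborel) 
    = ennreal (t powr (-2/3) * (2 powr (2/3) * (Gamma (1/3))\<^sup>2 / 9))"
proof -
  define h where "h = (\<lambda>(y::real) v::real. ennreal (indicator {1..} v * (indicator {0<..} y * (y * xexp (t * v * (v + 1) / 2 * y ^ 3)))))"
  have meas[measurable]: "case_prod h \<in> borel_measurable (lborel \<Otimes>\<^sub>M lborel)"
    unfolding h_def xexp_def by measurable
  have "(\<integral>\<^sup>+y. ennreal (row_int t y) * indicator {0<..} y \<partial>lborel) = (\<integral>\<^sup>+y. \<integral>\<^sup>+v. h y v \<partial>lborel \<partial>lborel)"
  proof (rule nn_integral_cong)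
    fix y :: real
    show "ennreal (row_int t y) * indicator {0<..} y = (\<integral>\<^sup>+v. h y v \<partial>lborel)"
    proof (cases "y > 0")
      case True
      have [measurable]: "kern t y \<in> borel_measurable borel" unfolding kern_def xexp_def by measurable
      have "ennreal (row_int t y) = (\<integral>\<^sup>+x. ennreal (kern t y x) * indicator {y..} x \<partial>lborel)"
        using row_int_integral(1)[OF t True] by simp
      also have "\<dots> = ennreal \<bar>y\<bar> * (\<integral>\<^sup>+v. ennreal (kern t y (0 + y * v)) * indicator {y..} (0 + y * v) \<partial>lborel)"
        using True by (intro nn_integral_real_affine) auto
      also have "\<dots> = (\<integral>\<^sup>+v. ennreal \<bar>y\<bar> * (ennreal (kern t y (0 + y * v)) * indicator {y..} (0 + y * v)) \<partial>lborel)"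
        by (rule nn_integral_cmult[symmetric]) measurable
      also have "\<dots> = (\<integral>\<^sup>+v. h y v \<partial>lborel)"
      proof (rule nn_integral_cong)
        fix v :: real
        have "kern t y (y * v) = xexp (t * v * (v + 1) / 2 * y ^ 3)"
          unfolding kern_def by (simp add: power3_eq_cube algebra_simps)
        moreover have "y \<le> y * v \<longleftrightarrow> 1 \<le> v" using True by (simp add: mult_le_cancel_left1)
        ultimately show "ennreal \<bar>y\<bar> * (ennreal (kern t y (0 + y * v)) * indicator {y..} (0 + y * v)) = h y v"
          using True by (simp add: h_def indicator_def ennreal_mult'[symmetric])
      qed
      finally show ?thesis using True by simp
    qed (simp add: h_def)
  qed
  also have "\<dots> = (\<integral>\<^sup>+v. \<integral>\<^sup>+y. h y v \<partial>lborel \<partial>lborel)"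
    by (rule lborel_pair.Fubini'[OF meas, symmetric])
  also have "\<dots> = (\<integral>\<^sup>+v. ennreal (indicator {1..} v * ((t powr (-2/3) * 2 powr (2/3) * Gamma (5/3) / 3) * (v * (v + 1)) powr (-2/3))) \<partial>lborel)"
  proof (rule nn_integral_cong)
    fix v :: real
    show "(\<integral>\<^sup>+y. h y v \<partial>lborel) = ennreal (indicator {1..} v * ((t powr (-2/3) * 2 powr (2/3) * Gamma (5/3) / 3) * (v * (v + 1)) powr (-2/3)))"
    proof (cases "v \<ge> 1")
      case True
      have "(\<integral>\<^sup>+y. h y v \<partial>lborel) = (\<integral>\<^sup>+y. ennreal (indicator {0<..} y * (y * xexp (t * v * (v + 1) / 2 * y ^ 3))) \<partial>lborel)"
        unfolding h_def using True by simp
      also have "\<dots> = ennreal ((t * v * (v + 1) / 2) powr (-2/3) * Gamma (5/3) / 3)"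
        using True t by (intro Gamma_cubic_integral) auto
      also have "t * v * (v + 1) / 2 = t * 2 powr (-1) * (v * (v + 1))" by (simp add: powr_minus)
      also have "(t * 2 powr (-1) * (v * (v + 1))) powr (-2/3) = t powr (-2/3) * (2 powr (-1)) powr (-2/3) * (v * (v + 1)) powr (-2/3)"
        using True t by (simp only: powr_mult)
      also have "(2 powr (-1)) powr (-2/3) = (2::real) powr (2/3)" by (simp only: powr_powr) simp
      finally show ?thesis using True by (simp add: mult_ac)
    qed (simp add: h_def)
  qed
  also have "\<dots> = ennreal ((t powr (-2/3) * 2 powr (2/3) * Gamma (5/3) / 3) * (Beta (1/3) (1/3) / 2))"
    by (intro nn_integral_has_integral_lebesgue has_integral_mult_right half_Beta_integral)
       (auto intro!: Gamma_real_pos less_imp_le)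
  also have "(t powr (-2/3) * 2 powr (2/3) * Gamma (5/3) / 3) * (Beta (1/3) (1/3) / 2) 
     = t powr (-2/3) * (2 powr (2/3) * (Gamma (1/3))\<^sup>2 / 9)"
  proof -
    have "Gamma (2/3 + 1 :: real) = 2/3 * Gamma (2/3)" by (rule Gamma_plus1) auto
    moreover have "2/3 + 1 = (5/3 :: real)" by simp
    ultimately have G: "Gamma (5/3 :: real) = 2/3 * Gamma (2/3)" by (simp only:)
    have "(0::real) < 2/3" by simp
    hence "Gamma (2/3 :: real) \<noteq> 0" using Gamma_real_pos less_irrefl by metis
    moreover have "a * b * (2/3 * g) / 3 * (h * h / g / 2) = a * (b * h\<^sup>2 / 9)" if "g \<noteq> 0" for a b g h :: real
      using that by (simp add: power2_eq_square)
    moreover have "1/3 + 1/3 = (2/3 :: real)" by simp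
    ultimately show ?thesis unfolding G Beta_def by (simp only:)
  qed
  finally show ?thesis .
qed

section \<open>The double sum and the mean\<close>

lemma has_sum_Sigma_nonneg:
  fixes f :: "'a \<times> 'b \<Rightarrow> real"
  assumes "\<And>x. x \<in> A \<Longrightarrow> ((\<lambda>y. f (x, y)) has_sum g x) (B x)"
    and "(g has_sum S) A"
    and "\<And>x y. x \<in> A \<Longrightarrow> y \<in> B x \<Longrightarrow> f (x, y) \<ge> 0"
  shows "(f has_sum S) (Sigma A B)"
  by (rule has_sum_SigmaI[OF assms(1,2) summable_on_SigmaI[OF assms(1) has_sum_imp_summable[OF assms(2)] assms(3)]])

definition pairs :: "(nat \<times> nat) set" where "pairs = {1..} \<times> {1..}"

definition pair_weight :: "nat \<times> nat \<Rightarrow> real" where "pair_weight p = weight (fst p) (snd p)"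

lemma pair_weight_ge_1: "p \<in> pairs \<Longrightarrow> pair_weight p \<ge> 1"
proof -
  assume "p \<in> pairs"
  then obtain j k where p: "p = (j, k)" "j \<ge> 1" "k \<ge> 1" by (auto simp: pairs_def)
  hence "1 * 1 * (1 + 1) \<le> real j * real k * (real j + real k)" by (intro mult_mono add_mono) auto
  thus ?thesis by (simp add: pair_weight_def weight_def p)
qed

lemma weight_commute: "weight j k = weight k j" by (simp add: weight_def algebra_simps)

text \<open>The part on and below the diagonal and the part above it give the same rows, except that the diagonal
  is counted once: this is the endpoint term of the trapezoidal rule, which is why no term of order
  \<open>t powr (-1/3)\<close> appears.\<close>

lemma symmetric_has_sum:
  fixes a :: "nat \<Rightarrow> nat \<Rightarrow> real"
  assumes sym: "\<And>j k. a j k = a k j" and nonneg: "\<And>j k. a j k \<ge> 0"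
    and rows: "\<And>k. summable (\<lambda>i. a (Suc k + i) (Suc k))"
    and total: "(\<lambda>k. 2 * ((\<Sum>i. a (Suc k + i) (Suc k)) - a (Suc k) (Suc k) / 2)) sums S"
  shows "((\<lambda>(j, k). a j k) has_sum S) pairs"
proof -
  define R where "R = (\<lambda>k. \<Sum>i. a (Suc k + i) (Suc k))"
  define D where "D = (\<lambda>k. a (Suc k) (Suc k))"
  have R: "((\<lambda>i. a (Suc k + i) (Suc k)) has_sum R k) UNIV" for k
    unfolding R_def by (intro sums_nonneg_imp_has_sum summable_sums rows nonneg)
  have R': "((\<lambda>i. a (Suc k + Suc i) (Suc k)) has_sum (R k - D k)) UNIV" for k
  proof (intro sums_nonneg_imp_has_sum nonneg)
    have "(\<lambda>i. a (Suc k + Suc i) (Suc k)) sums (R k - a (Suc k + 0) (Suc k))"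
      by (rule sums_Suc_iff[THEN iffD2]) (use rows[of k] in \<open>simp add: R_def summable_sums\<close>)
    thus "(\<lambda>i. a (Suc k + Suc i) (Suc k)) sums (R k - D k)" by (simp add: D_def)
  qed
  have D0: "D k \<ge> 0" "D k \<le> R k" "R k - D k \<ge> 0" for k
  proof -
    show "D k \<ge> 0" by (simp add: D_def nonneg)
    show "R k - D k \<ge> 0" by (rule has_sum_nonneg[OF R']) (simp add: nonneg)
    thus "D k \<le> R k" by simp
  qed
  have t: "(\<lambda>k. 2 * R k - D k) sums S" using total by (simp add: R_def D_def algebra_simps)
  have sR: "summable R"
    by (rule summable_comparison_test'[OF sums_summable[OF t], where N=0]) (use D0 in \<open>auto simp: algebra_simps\<close>, smt (verit) D0)
  have sRD: "summable (\<lambda>k. R k - D k)"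
    by (rule summable_comparison_test'[OF sums_summable[OF t], where N=0]) (use D0 in \<open>auto simp: algebra_simps\<close>, smt (verit) D0)
  define S1 where "S1 = suminf R"
  define S2 where "S2 = (\<Sum>k. R k - D k)"
  have "(\<lambda>k. R k + (R k - D k)) sums (S1 + S2)"
    unfolding S1_def S2_def by (intro sums_add summable_sums sR sRD)
  hence S: "S = S1 + S2" using t by (simp add: sums_iff)
  have h1: "((\<lambda>(k, i). a (Suc k + i) (Suc k)) has_sum S1) (UNIV \<times> UNIV)"
  proof (rule has_sum_Sigma_nonneg[where g=R])
    show "(R has_sum S1) UNIV"
      unfolding S1_def using D0 by (intro sums_nonneg_imp_has_sum summable_sums sR) (blast intro: order_trans)
  qed (use R nonneg in auto)
  have h2: "((\<lambda>(k, i). a (Suc k + Suc i) (Suc k)) has_sum S2) (UNIV \<times> UNIV)"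
  proof (rule has_sum_Sigma_nonneg[where g="\<lambda>k. R k - D k"])
    show "((\<lambda>k. R k - D k) has_sum S2) UNIV"
      unfolding S2_def using D0 by (intro sums_nonneg_imp_has_sum summable_sums sRD)
  qed (use R' nonneg in auto)
  have u1: "((\<lambda>(j, k). a j k) has_sum S1) {(j, k). 1 \<le> k \<and> k \<le> j}"
  proof (rule iffD1[OF _ h1])
    show "((\<lambda>(k, i). a (Suc k + i) (Suc k)) has_sum S1) (UNIV \<times> UNIV) 
        = ((\<lambda>(j, k). a j k) has_sum S1) {(j, k). 1 \<le> k \<and> k \<le> j}"
      by (rule has_sum_reindex_bij_witness[where i="\<lambda>(j, k). (k - 1, j - k)" and j="\<lambda>(k, i). (Suc k + i, Suc k)"]) auto
  qed
  have u2: "((\<lambda>(j, k). a j k) has_sum S2) {(j, k). 1 \<le> j \<and> j < k}"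
  proof (rule iffD1[OF _ h2])
    show "((\<lambda>(k, i). a (Suc k + Suc i) (Suc k)) has_sum S2) (UNIV \<times> UNIV) 
        = ((\<lambda>(j, k). a j k) has_sum S2) {(j, k). 1 \<le> j \<and> j < k}"
      by (rule has_sum_reindex_bij_witness[where i="\<lambda>(j, k). (j - 1, k - j - 1)" and j="\<lambda>(k, i). (Suc k, Suc k + Suc i)"])
         (auto simp: sym)
  qed
  have "((\<lambda>(j, k). a j k) has_sum (S1 + S2)) ({(j, k). 1 \<le> k \<and> k \<le> j} \<union> {(j, k). 1 \<le> j \<and> j < k})"
    by (rule has_sum_Un_disjoint[OF u1 u2]) auto
  also have "{(j, k). 1 \<le> k \<and> k \<le> j} \<union> {(j, k). 1 \<le> j \<and> j < k} = pairs"
    by (auto simp: pairs_def)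
  finally show ?thesis by (simp add: S)
qed

text \<open>Both uses of the trapezoidal rule contribute errors of order
  \<open>t powr (-1/4)\<close>, the one inside the rows after summation of
  \<open>k powr (-5/4)\<close> and \<open>k powr (-11/4)\<close>. Symmetry doubles both constants:
  \<open>2 powr (2/3)\<close> becomes \<open>2 powr (5/3)\<close>, and \<open>profile 0\<close>
  becomes \<open>sqrt (pi / 2)\<close>.\<close>

lemma xexp_weight_sum:
  obtains C G where "C > 0" 
    "\<And>t. t > 0 \<Longrightarrow> ((\<lambda>p. xexp (pair_weight p * t)) has_sum G t) pairs"
    "\<And>t. t > 0 \<Longrightarrow> \<bar>G t - 2 powr (5/3) * (Gamma (1/3))\<^sup>2 / 9 * t powr (-2/3)
        - sqrt (pi / 2) * zeta_real (1/2) * t powr (-1/2)\<bar> \<le> C * t powr (-1/4)"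
proof -
  define K :: real where "K = 2 powr (2/3) * (Gamma (1/3))\<^sup>2 / 9"
  have K0: "K \<ge> 0" by (simp add: K_def)
  obtain C1 where C1: "C1 > 0" "\<And>t. t > 0 \<Longrightarrow> summable (\<lambda>i. row_int t (1 + real i))"
    "\<And>t. t > 0 \<Longrightarrow> \<bar>(\<Sum>i. row_int t (1 + real i)) - K * t powr (-2/3) - profile 0 * zeta_real (1/2) * t powr (-1/2)\<bar> 
       \<le> C1 * t powr (-1/4)"
    using row_int_sums[OF row_int_total[folded K_def] K0] by blast
  obtain C2 where C2: "C2 > 0" 
    "\<And>t k. t > 0 \<Longrightarrow> k > 0 \<Longrightarrow> summable (\<lambda>i. kern t k (k + real i))"
    "\<And>t k. t > 0 \<Longrightarrow> k > 0 \<Longrightarrow> \<bar>(\<Sum>i. kern t k (k + real i)) - kern t k k / 2 - row_int t k\<bar> 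
        \<le> C2 * t powr (-1/4) * (k powr (-5/4) + k powr (-11/4))"
    using row_int_trapezoid by blast
  define s where "s = (\<lambda>i. real (Suc i) powr (-5/4) + real (Suc i) powr (-11/4))"
  have ss: "summable s" unfolding s_def
    by (intro summable_add) (subst summable_Suc_iff, subst summable_real_powr_iff, simp)+
  have s0: "suminf s \<ge> 0" by (intro suminf_nonneg ss) (auto simp: s_def)
  define a where "a = (\<lambda>t j k. xexp (weight j k * t))"
  define Tr where "Tr = (\<lambda>t k. (\<Sum>i. a t (Suc k + i) (Suc k)) - a t (Suc k) (Suc k) / 2)"
  define d where "d = (\<lambda>t k. Tr t k - row_int t (1 + real k))"
  define G where "G = (\<lambda>t. 2 * (\<Sum>k. Tr t k))"
  have ak: "a t j k = kern t (real k) (real j)" for t j k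
    by (simp add: a_def kern_def weight_def mult_ac)
  have main: "((\<lambda>p. xexp (pair_weight p * t)) has_sum G t) pairs \<and> 
     \<bar>G t - 2 * K * t powr (-2/3) - 2 * profile 0 * zeta_real (1/2) * t powr (-1/2)\<bar> \<le> (2 * C1 + 2 * C2 * suminf s) * t powr (-1/4)"
    if t: "t > 0" for t
  proof -
    have d: "\<bar>d t k\<bar> \<le> C2 * t powr (-1/4) * s k" for k
      using C2(3)[OF t, of "1 + real k"] by (simp add: d_def Tr_def ak s_def add_ac)
    have sm: "summable (\<lambda>k. C2 * t powr (-1/4) * s k)" by (intro summable_mult ss)
    have sd: "summable (d t)" by (rule summable_comparison_test'[OF sm, where N=0]) (use d in auto)
    have ds: "\<bar>suminf (d t)\<bar> \<le> C2 * t powr (-1/4) * suminf s"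
      using norm_suminf_le[of "d t", OF _ sm] d suminf_mult[OF ss] by simp
    have Tr: "Tr t = (\<lambda>k. d t k + row_int t (1 + real k))" by (simp add: d_def)
    have sTr: "summable (Tr t)" unfolding Tr by (intro summable_add sd C1 t)
    have eq: "suminf (Tr t) = suminf (d t) + (\<Sum>i. row_int t (1 + real i))"
      unfolding Tr by (rule suminf_add[symmetric, OF sd C1(2)[OF t]])
    have "((\<lambda>(j, k). a t j k) has_sum G t) pairs"
    proof (rule symmetric_has_sum)
      show "a t j k = a t k j" for j k by (simp add: a_def weight_commute)
      show "a t j k \<ge> 0" for j k using t by (simp add: a_def xexp_def weight_def)
      show "summable (\<lambda>i. a t (Suc k + i) (Suc k))" for k
        using C2(2)[OF t, of "1 + real k"] by (simp add: ak add_ac)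
      show "(\<lambda>k. 2 * ((\<Sum>i. a t (Suc k + i) (Suc k)) - a t (Suc k) (Suc k) / 2)) sums G t"
        using sums_mult[OF summable_sums[OF sTr], of 2] by (simp only: Tr_def G_def)
    qed
    moreover have "(\<lambda>(j, k). a t j k) = (\<lambda>p. xexp (pair_weight p * t))"
      by (auto simp: a_def pair_weight_def)
    ultimately have 1: "((\<lambda>p. xexp (pair_weight p * t)) has_sum G t) pairs" by simp
    have "G t - 2 * K * t powr (-2/3) - 2 * profile 0 * zeta_real (1/2) * t powr (-1/2)
       = 2 * suminf (d t) + 2 * ((\<Sum>i. row_int t (1 + real i)) - K * t powr (-2/3) - profile 0 * zeta_real (1/2) * t powr (-1/2))"
      unfolding G_def eq by (simp add: algebra_simps)
    also have "\<bar>\<dots>\<bar> \<le> 2 * \<bar>suminf (d t)\<bar> + 2 * \<bar>(\<Sum>i. row_int t (1 + real i)) - K * t powr (-2/3) - profile 0 * zeta_real (1/2) * t powr (-1/2)\<bar>"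
      (is "\<bar>2 * ?x + 2 * ?y\<bar> \<le> _")
      using abs_triangle_ineq[of "2 * ?x" "2 * ?y"] by (simp only: abs_mult abs_numeral)
    also have "\<dots> \<le> 2 * (C2 * t powr (-1/4) * suminf s) + 2 * (C1 * t powr (-1/4))"
      by (intro add_mono mult_left_mono ds C1 t) auto
    finally show ?thesis using 1 by (simp add: algebra_simps)
  qed
  show ?thesis
  proof (rule that[of "2 * C1 + 2 * C2 * suminf s" G])
    show "2 * C1 + 2 * C2 * suminf s > 0" using C1(1) C2(1) s0 by (simp add: add_pos_nonneg)
    fix t :: real assume t: "t > 0"
    show "((\<lambda>p. xexp (pair_weight p * t)) has_sum G t) pairs" using main[OF t] by blast
    have "(2::real) powr (5/3) = 2 powr (1 + 2/3)" by simp
    hence "(2::real) powr (5/3) = 2 * 2 powr (2/3)" by (simp only: powr_add) simp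
    thus "\<bar>G t - 2 powr (5/3) * (Gamma (1/3))\<^sup>2 / 9 * t powr (-2/3)
        - sqrt (pi / 2) * zeta_real (1/2) * t powr (-1/2)\<bar> \<le> (2 * C1 + 2 * C2 * suminf s) * t powr (-1/4)"
      using main[OF t] by (simp add: K_def profile_0 mult.assoc)
  qed
qed

section \<open>From exponential weights to the mean\<close>

lemma bose_sums:
  fixes x :: real
  assumes "x > 0"
  shows "(\<lambda>m. exp (- (real (Suc m) * x))) sums (1 / (exp x - 1))"
proof -
  have q: "norm (exp (- x)) < 1" using assms by simp
  have "(\<lambda>m. exp (- x) * exp (- x) ^ m) sums (exp (- x) * (1 / (1 - exp (- x))))"
    by (intro sums_mult geometric_sums q)
  moreover have "exp (- x) * exp (- x) ^ m = exp (- (real (Suc m) * x))" for m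
    by (simp add: exp_of_nat_mult[symmetric] exp_add[symmetric] algebra_simps)
  moreover have "exp (- x) * (1 / (1 - exp (- x))) = 1 / (exp x - 1)"
    using assms by (simp add: exp_minus field_simps)
  ultimately show ?thesis by simp
qed

text \<open>All terms of the double series over \<open>m\<close> and \<open>p\<close> are
  nonnegative, so it may be summed in either order. Summing over \<open>p\<close> first gives the
  expansion; summing over \<open>m\<close> first gives the terms of the mean, whose summability is
  thus obtained together with the value. The division by \<open>m\<close> lowers the exponents by
  one, which explains the zeta arguments \<open>5/3\<close> and \<open>3/2\<close>, and
  \<open>5/4\<close> in the error.\<close>

lemma bose_weight_sum:
  obtains C \<mu> where "C > 0" 
    "\<And>t. t > 0 \<Longrightarrow> ((\<lambda>p. pair_weight p / (exp (pair_weight p * t) - 1)) has_sum \<mu> t) pairs"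
    "\<And>t. t > 0 \<Longrightarrow> \<bar>\<mu> t - 2 powr (5/3) * (Gamma (1/3))\<^sup>2 / 9 * zeta_real (5/3) * t powr (-5/3)
        - sqrt (pi / 2) * zeta_real (1/2) * zeta_real (3/2) * t powr (-3/2)\<bar> \<le> C * t powr (-5/4)"
proof -
  define a :: real where "a = 2 powr (5/3) * (Gamma (1/3))\<^sup>2 / 9"
  define b :: real where "b = sqrt (pi / 2) * zeta_real (1/2)"
  obtain C G where C: "C > 0" 
    "\<And>t. t > 0 \<Longrightarrow> ((\<lambda>p. xexp (pair_weight p * t)) has_sum G t) pairs"
    "\<And>t. t > 0 \<Longrightarrow> \<bar>G t - a * t powr (-2/3) - b * t powr (-1/2)\<bar> \<le> C * t powr (-1/4)"
    unfolding a_def b_def using xexp_weight_sum by blast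
  define z where "z = zeta_real (5/4)"
  have z: "(\<lambda>m. real (Suc m) powr (-5/4)) sums z" using zeta_real_sums[of "5/4"] by (simp add: z_def)
  have z0: "z \<ge> 0" using z by (intro sums_le[OF _ sums_zero z]) auto
  have z1: "(\<lambda>m. real (Suc m) powr (-5/3)) sums zeta_real (5/3)" using zeta_real_sums[of "5/3"] by simp
  have z2: "(\<lambda>m. real (Suc m) powr (-3/2)) sums zeta_real (3/2)" using zeta_real_sums[of "3/2"] by simp
  have main: "\<exists>S. ((\<lambda>p. pair_weight p / (exp (pair_weight p * t) - 1)) has_sum S) pairs \<and> 
     \<bar>S - a * zeta_real (5/3) * t powr (-5/3) - b * zeta_real (3/2) * t powr (-3/2)\<bar> \<le> (C * z + 1) * t powr (-5/4)"
    if t: "t > 0" for t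
  proof -
    define g where "g = (\<lambda>m. G (real (Suc m) * t) / real (Suc m))"
    define e where "e = (\<lambda>m. g m - a * t powr (-2/3) * real (Suc m) powr (-5/3) - b * t powr (-1/2) * real (Suc m) powr (-3/2))"
    have e: "\<bar>e m\<bar> \<le> C * t powr (-1/4) * real (Suc m) powr (-5/4)" for m
    proof -
      define n where "n = real (Suc m)"
      have n: "n > 0" by (simp add: n_def)
      have pw: "(n * t) powr r / n = t powr r * n powr (r - 1)" for r
        using n t by (simp add: powr_mult powr_diff)
      have "e m = (G (n * t) - a * (n * t) powr (-2/3) - b * (n * t) powr (-1/2)) / n"
        unfolding e_def g_def n_def[symmetric] diff_divide_distrib times_divide_eq_right[symmetric] pw by simp
      hence "\<bar>e m\<bar> = \<bar>G (n * t) - a * (n * t) powr (-2/3) - b * (n * t) powr (-1/2)\<bar> / n" using n by simp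
      also have "\<dots> \<le> (C * (n * t) powr (-1/4)) / n"
        using n t by (intro divide_right_mono C) auto
      also have "\<dots> = C * t powr (-1/4) * n powr (-5/4)"
        unfolding times_divide_eq_right[symmetric] pw by simp
      finally show ?thesis by (simp add: n_def)
    qed
    have sm: "(\<lambda>m. C * t powr (-1/4) * real (Suc m) powr (-5/4)) sums (C * t powr (-1/4) * z)"
      by (intro sums_mult z)
    have se: "summable e" by (rule summable_comparison_test'[OF sums_summable[OF sm], where N=0]) (use e in auto)
    have es: "\<bar>suminf e\<bar> \<le> C * t powr (-1/4) * z"
      using norm_sums_le[OF summable_sums[OF se] sm] e by simp
    define T where "T = a * t powr (-2/3) * zeta_real (5/3) + b * t powr (-1/2) * zeta_real (3/2) + suminf e"
    have "(\<lambda>m. a * t powr (-2/3) * real (Suc m) powr (-5/3) + b * t powr (-1/2) * real (Suc m) powr (-3/2) + e m) sums T"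
      unfolding T_def by (intro sums_add sums_mult z1 z2 summable_sums se)
    hence gT: "g sums T" by (simp add: e_def)
    have w0: "pair_weight p > 0" if "p \<in> pairs" for p using pair_weight_ge_1[OF that] by linarith
    \<comment> \<open>The factor \<open>real (Suc m)\<close> inside \<open>xexp\<close> cancels
      against the denominator, so that for fixed \<open>p\<close> a geometric series in
      \<open>m\<close> remains.\<close>
    define f where "f = (\<lambda>(m::nat, p). xexp (pair_weight p * (real (Suc m) * t)) / real (Suc m))"
    have rows: "((\<lambda>p. f (m, p)) has_sum g m) pairs" for m
      unfolding f_def g_def prod.case using t by (intro has_sum_divide_const C) auto
    have f0: "f (m, p) \<ge> 0" if "p \<in> pairs" for m p
      using w0[OF that] t by (auto simp: f_def xexp_def)
    have "(f has_sum T) (Sigma UNIV (\<lambda>_. pairs))"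
    proof (rule has_sum_Sigma_nonneg[where g=g])
      have "g m \<ge> 0" for m by (rule has_sum_nonneg[OF rows]) (rule f0)
      thus "(g has_sum T) UNIV" by (intro sums_nonneg_imp_has_sum gT)
    qed (use rows f0 in auto)
    moreover have "(f has_sum T) (UNIV \<times> pairs) = ((\<lambda>(p, m). f (m, p)) has_sum T) (pairs \<times> UNIV)"
      by (rule has_sum_reindex_bij_witness[where i=prod.swap and j=prod.swap]) auto
    ultimately have "((\<lambda>(p, m). f (m, p)) has_sum T) (pairs \<times> UNIV)" by simp
    hence "((\<lambda>p. pair_weight p * t / (exp (pair_weight p * t) - 1)) has_sum T) pairs"
    proof (rule has_sum_SigmaD)
      fix p assume p: "p \<in> pairs"
      define x where "x = pair_weight p * t"
      have x: "x > 0" using w0[OF p] t by (simp add: x_def)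
      have "(\<lambda>m. x * exp (- (real (Suc m) * x))) sums (x * (1 / (exp x - 1)))"
        by (intro sums_mult bose_sums x)
      moreover have "(case (p, m) of (p, m) \<Rightarrow> f (m, p)) = x * exp (- (real (Suc m) * x))" for m
        by (simp add: f_def xexp_def x_def field_simps del: of_nat_Suc)
      ultimately show "((\<lambda>m. case (p, m) of (p, m) \<Rightarrow> f (m, p)) has_sum pair_weight p * t / (exp (pair_weight p * t) - 1)) UNIV"
        using x by (intro sums_nonneg_imp_has_sum) (simp_all add: x_def)
    qed
    hence "((\<lambda>p. pair_weight p * t / (exp (pair_weight p * t) - 1) / t) has_sum T / t) pairs"
      by (rule has_sum_divide_const)
    hence 1: "((\<lambda>p. pair_weight p / (exp (pair_weight p * t) - 1)) has_sum T / t) pairs"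
      using t by simp
    have pw: "t powr (-2/3) / t = t powr (-5/3)" "t powr (-1/2) / t = t powr (-3/2)" "t powr (-1/4) / t = t powr (-5/4)"
      using t powr_diff[of t "-2/3" 1] powr_diff[of t "-1/2" 1] powr_diff[of t "-1/4" 1] by simp_all
    have "(a * A * z1 + b * B * z2 + e) / t = a * z1 * (A / t) + b * z2 * (B / t) + e / t" for A B z1 z2 e
      using t by (simp add: field_simps)
    hence "T / t = a * zeta_real (5/3) * (t powr (-2/3) / t) + b * zeta_real (3/2) * (t powr (-1/2) / t) + suminf e / t"
      unfolding T_def by blast
    hence "T / t - a * zeta_real (5/3) * t powr (-5/3) - b * zeta_real (3/2) * t powr (-3/2) = suminf e / t"
      unfolding pw by linarith
    also have "\<bar>\<dots>\<bar> = \<bar>suminf e\<bar> / t" using t by simp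
    also have "\<dots> \<le> (C * t powr (-1/4) * z) / t" using t es by (intro divide_right_mono) auto
    also have "\<dots> = C * z * t powr (-5/4)" unfolding pw(3)[symmetric] by simp
    also have "\<dots> \<le> (C * z + 1) * t powr (-5/4)" by (intro mult_right_mono) auto
    finally show ?thesis using 1 by blast
  qed
  define \<mu> where "\<mu> = (\<lambda>t. \<Sum>\<^sub>\<infinity>p\<in>pairs. pair_weight p / (exp (pair_weight p * t) - 1))"
  have "((\<lambda>p. pair_weight p / (exp (pair_weight p * t) - 1)) has_sum \<mu> t) pairs \<and>
     \<bar>\<mu> t - a * zeta_real (5/3) * t powr (-5/3) - b * zeta_real (3/2) * t powr (-3/2)\<bar> \<le> (C * z + 1) * t powr (-5/4)" 
     if "t > 0" for t
    using main[OF that] by (auto simp: \<mu>_def dest: infsumI)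
  moreover have "C * z + 1 > 0" using C(1) z0 by (simp add: add_nonneg_pos)
  ultimately show ?thesis unfolding a_def b_def by (intro that[of "C * z + 1" \<mu>]) blast+
qed

section \<open>Normal approximation of infinite sums of independent variables\<close>

text \<open>The factors are exchanged one at a time. Each exchange costs one difference, as all
  other factors have norm at most 1.\<close>

lemma norm_prod_diff_le:
  fixes a b :: "nat \<Rightarrow> 'a::{real_normed_algebra_1,comm_ring_1}"
  assumes "\<And>i. i < n \<Longrightarrow> norm (a i) \<le> 1" "\<And>i. i < n \<Longrightarrow> norm (b i) \<le> 1"
  shows "norm ((\<Prod>i<n. a i) - (\<Prod>i<n. b i)) \<le> (\<Sum>i<n. norm (a i - b i))"
  using assms
proof (induction n)
  case (Suc n)
  have b: "norm (\<Prod>i<n. b i) \<le> 1"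
  proof -
    have "norm (\<Prod>i<n. b i) \<le> (\<Prod>i<n. norm (b i))" by (rule norm_prod_le)
    also have "\<dots> \<le> 1" using Suc.prems(2) by (intro prod_le_1) auto
    finally show ?thesis .
  qed
  have "(\<Prod>i<Suc n. a i) - (\<Prod>i<Suc n. b i) = ((\<Prod>i<n. a i) - (\<Prod>i<n. b i)) * a n + (\<Prod>i<n. b i) * (a n - b n)"
    by (simp add: algebra_simps)
  also have "norm \<dots> \<le> norm ((\<Prod>i<n. a i) - (\<Prod>i<n. b i)) * norm (a n) + norm (\<Prod>i<n. b i) * norm (a n - b n)"
    by (intro order_trans[OF norm_triangle_ineq] add_mono norm_mult_ineq)
  also have "\<dots> \<le> (\<Sum>i<n. norm (a i - b i)) * 1 + 1 * norm (a n - b n)"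
    using Suc b by (intro add_mono mult_mono) (auto intro!: sum_nonneg)
  finally show ?case by simp
qed simp

lemma exp_neg_approx:
  fixes y :: real
  assumes "y \<ge> 0"
  shows "\<bar>(1 - y) - exp (- y)\<bar> \<le> y\<^sup>2 / 2"
proof -
  have "1 - y \<le> exp (- y)" using exp_ge_add_one_self[of "- y"] by simp
  moreover have "exp (- y) \<le> 1 - y + y\<^sup>2 / 2"
  proof -
    define D where "D = (\<lambda>y::real. 1 - y + y\<^sup>2 / 2 - exp (- y))"
    have "D 0 \<le> D y"
    proof (rule DERIV_nonneg_imp_nondecreasing[OF assms])
      fix x :: real
      have "(D has_real_derivative (- 1 + x + exp (- x))) (at x)"
        unfolding D_def by (auto intro!: derivative_eq_intros)
      moreover have "- 1 + x + exp (- x) \<ge> 0" using exp_ge_add_one_self[of "- x"] by simp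
      ultimately show "\<exists>d. (D has_real_derivative d) (at x) \<and> 0 \<le> d" by blast
    qed
    thus ?thesis by (simp add: D_def)
  qed
  ultimately show ?thesis by (simp add: abs_le_iff)
qed

text \<open>Stated for the second moment about 0: when the summands are nonnegative the squares of
  the partial sums increase, so this form passes to the infinite sum by monotone convergence, which
  the centred squares would not allow.\<close>

lemma (in prob_space) variance_indep_sum:
  fixes Y :: "nat \<Rightarrow> 'a \<Rightarrow> real"
  assumes indep: "indep_vars (\<lambda>_. borel) Y UNIV"
    and i1: "\<And>i. integrable M (Y i)" and i2: "\<And>i. integrable M (\<lambda>\<omega>. (Y i \<omega>)\<^sup>2)"
  shows "integrable M (\<lambda>\<omega>. (\<Sum>i<n. Y i \<omega>)\<^sup>2)"
    and "expectation (\<lambda>\<omega>. (\<Sum>i<n. Y i \<omega>)\<^sup>2) = (\<Sum>i<n. variance (Y i)) + (\<Sum>i<n. expectation (Y i))\<^sup>2"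
proof (induction n)
  case (Suc n)
  let ?S = "\<lambda>\<omega>. \<Sum>i<n. Y i \<omega>"
  have iv: "indep_var borel (Y n) borel ?S"
    by (rule indep_vars_sum) (auto intro: indep_vars_subset[OF indep])
  have iS: "integrable M ?S" by (intro Bochner_Integration.integrable_sum i1)
  have prod: "integrable M (\<lambda>\<omega>. Y n \<omega> * ?S \<omega>)" "expectation (\<lambda>\<omega>. Y n \<omega> * ?S \<omega>) = expectation (Y n) * expectation ?S"
    using indep_var_integrable[OF iv i1 iS] indep_var_lebesgue_integral[OF iv i1 iS] by auto
  have eq: "(\<lambda>\<omega>. (\<Sum>i<Suc n. Y i \<omega>)\<^sup>2) = (\<lambda>\<omega>. (?S \<omega>)\<^sup>2 + (Y n \<omega>)\<^sup>2 + 2 * (Y n \<omega> * ?S \<omega>))"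
    by (auto simp: power2_eq_square algebra_simps)
  {
    case 1
    show ?case unfolding eq by (intro Bochner_Integration.integrable_add integrable_mult_right Suc i2 prod)
  next
    case 2
    have "expectation (\<lambda>\<omega>. (\<Sum>i<Suc n. Y i \<omega>)\<^sup>2) = expectation (\<lambda>\<omega>. (?S \<omega>)\<^sup>2) + expectation (\<lambda>\<omega>. (Y n \<omega>)\<^sup>2) + 2 * (expectation (Y n) * expectation ?S)"
      unfolding eq by (simp add: Suc i2 prod)
    also have "expectation (\<lambda>\<omega>. (Y n \<omega>)\<^sup>2) = variance (Y n) + (expectation (Y n))\<^sup>2"
      using variance_eq[OF i1 i2] by simp
    also have "expectation ?S = (\<Sum>i<n. expectation (Y i))"
      by (intro Bochner_Integration.integral_sum i1)
    finally show ?case using Suc(2) by (simp add: power2_eq_square algebra_simps)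
  }
qed simp_all

text \<open>A Berry--Esseen type estimate: the characteristic functions of the centred summands are compared
  factor by factor with those of Gaussian variables of the same variance.\<close>

lemma (in prob_space) char_indep_sum_approx:
  fixes Y :: "nat \<Rightarrow> 'a \<Rightarrow> real"
  assumes indep: "indep_vars (\<lambda>_. borel) Y UNIV"
    and i1: "\<And>i. integrable M (Y i)" and i2: "\<And>i. integrable M (\<lambda>\<omega>. (Y i \<omega>)\<^sup>2)"
    and i3: "\<And>i. integrable M (\<lambda>\<omega>. \<bar>Y i \<omega> - expectation (Y i)\<bar> ^ 3)"
    and r: "\<And>i. expectation (\<lambda>\<omega>. \<bar>Y i \<omega> - expectation (Y i)\<bar> ^ 3) \<le> r i"
    and b: "\<And>i. variance (Y i) \<le> b"
  shows "cmod (expectation (\<lambda>\<omega>. exp (\<i> * complex_of_real (v * ((\<Sum>i<n. Y i \<omega>) - (\<Sum>i<n. expectation (Y i)))))) 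
           - complex_of_real (exp (- (v\<^sup>2 * (\<Sum>i<n. variance (Y i)) / 2))))
       \<le> \<bar>v\<bar> ^ 3 / 6 * (\<Sum>i<n. r i) + v ^ 4 / 8 * b * (\<Sum>i<n. variance (Y i))"
proof -
  define Z where "Z = (\<lambda>i \<omega>. Y i \<omega> - expectation (Y i))"
  have rvY[measurable]: "Y i \<in> borel_measurable M" for i using i1 by auto
  have indepZ: "indep_vars (\<lambda>_. borel) Z UNIV"
    unfolding Z_def by (rule indep_vars_compose2[OF indep, where Y="\<lambda>i y. y - expectation (Y i)"]) auto
  have rv[measurable]: "Z i \<in> borel_measurable M" for i by (simp add: Z_def)
  have iZ: "integrable M (Z i)" "expectation (Z i) = 0" for i
    using i1 by (auto simp: Z_def prob_space)
  have iZ2: "integrable M (\<lambda>\<omega>. (Z i \<omega>)\<^sup>2)" for i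
  proof -
    have "(\<lambda>\<omega>. (Z i \<omega>)\<^sup>2) = (\<lambda>\<omega>. (Y i \<omega>)\<^sup>2 + (expectation (Y i))\<^sup>2 - 2 * expectation (Y i) * Y i \<omega>)"
      by (auto simp: Z_def power2_eq_square algebra_simps)
    thus ?thesis using i1 i2 by auto
  qed
  have varZ: "variance (Z i) = variance (Y i)" for i
    unfolding iZ(2) by (simp add: Z_def)
  have var0: "variance (Y i) \<ge> 0" for i by (intro Bochner_Integration.integral_nonneg) auto
  define y where "y = (\<lambda>i. v\<^sup>2 * variance (Y i) / 2)"
  have y0: "y i \<ge> 0" for i using var0[of i] by (simp add: y_def)
  define A where "A = (\<lambda>i. char (distr M borel (Z i)) v)"
  define B where "B = (\<lambda>i. complex_of_real (exp (- y i)))"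
  have "expectation (\<lambda>\<omega>. exp (\<i> * complex_of_real (v * ((\<Sum>i<n. Y i \<omega>) - (\<Sum>i<n. expectation (Y i))))))
      = expectation (\<lambda>\<omega>. iexp (v * (\<Sum>i<n. Z i \<omega>)))"
    by (simp add: Z_def sum_subtractf)
  also have "\<dots> = char (distr M borel (\<lambda>\<omega>. \<Sum>i<n. Z i \<omega>)) v"
    unfolding char_def by (subst integral_distr) auto
  also have "\<dots> = (\<Prod>i<n. A i)"
    unfolding A_def by (intro char_distr_sum indep_vars_subset[OF indepZ]) auto
  finally have eq1: "expectation (\<lambda>\<omega>. exp (\<i> * complex_of_real (v * ((\<Sum>i<n. Y i \<omega>) - (\<Sum>i<n. expectation (Y i))))))
      = (\<Prod>i<n. A i)" .
  have eq2: "complex_of_real (exp (- (v\<^sup>2 * (\<Sum>i<n. variance (Y i)) / 2))) = (\<Prod>i<n. B i)"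
    unfolding B_def of_real_prod[symmetric] 
    by (simp add: exp_sum[symmetric] y_def sum_negf sum_distrib_left sum_divide_distrib)
  have "norm (A i) \<le> 1" for i
  proof -
    interpret D: real_distribution "distr M borel (Z i)" by (rule real_distribution_distr) simp
    show ?thesis unfolding A_def by (rule D.cmod_char_le_1)
  qed
  moreover have "norm (B i) \<le> 1" for i using y0 by (simp add: B_def)
  ultimately have "norm ((\<Prod>i<n. A i) - (\<Prod>i<n. B i)) \<le> (\<Sum>i<n. norm (A i - B i))"
    by (intro norm_prod_diff_le)
  also have "\<dots> \<le> (\<Sum>i<n. \<bar>v\<bar> ^ 3 / 6 * r i + v ^ 4 / 8 * b * variance (Y i))"
  proof (rule sum_mono)
    fix i
    have "cmod (A i - (1 - v\<^sup>2 * variance (Y i) / 2)) 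
       \<le> v\<^sup>2 / 6 * expectation (\<lambda>\<omega>. min (6 * (Z i \<omega>)\<^sup>2) (\<bar>v\<bar> * \<bar>Z i \<omega>\<bar> ^ 3))"
      unfolding A_def by (rule char_approx3'[OF rv iZ(1) iZ2 iZ(2) varZ refl])
    also have "\<dots> \<le> v\<^sup>2 / 6 * expectation (\<lambda>\<omega>. \<bar>v\<bar> * \<bar>Z i \<omega>\<bar> ^ 3)"
    proof (intro mult_left_mono integral_mono)
      show i3': "integrable M (\<lambda>\<omega>. \<bar>v\<bar> * \<bar>Z i \<omega>\<bar> ^ 3)" using i3[of i] by (simp add: Z_def)
      show "integrable M (\<lambda>\<omega>. min (6 * (Z i \<omega>)\<^sup>2) (\<bar>v\<bar> * \<bar>Z i \<omega>\<bar> ^ 3))"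
        by (rule Bochner_Integration.integrable_bound[OF i3']) auto
    qed auto
    also have "\<dots> = \<bar>v\<bar> ^ 3 / 6 * expectation (\<lambda>\<omega>. \<bar>Y i \<omega> - expectation (Y i)\<bar> ^ 3)"
    proof -
      have "v\<^sup>2 * \<bar>v\<bar> = \<bar>v\<bar> ^ 3" by (simp add: power2_eq_square power3_eq_cube)
      thus ?thesis by (simp add: Z_def)
    qed
    also have "\<dots> \<le> \<bar>v\<bar> ^ 3 / 6 * r i" by (intro mult_left_mono r) auto
    finally have 1: "cmod (A i - complex_of_real (1 - y i)) \<le> \<bar>v\<bar> ^ 3 / 6 * r i" by (simp add: y_def)
    have "cmod (complex_of_real (1 - y i) - B i) = \<bar>(1 - y i) - exp (- y i)\<bar>"
      unfolding B_def of_real_diff[symmetric] norm_of_real ..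
    also have "\<dots> \<le> (y i)\<^sup>2 / 2" by (rule exp_neg_approx[OF y0])
    also have "\<dots> = v ^ 4 / 8 * variance (Y i) * variance (Y i)"
      by (simp add: y_def power2_eq_square power4_eq_xxxx)
    also have "\<dots> \<le> v ^ 4 / 8 * b * variance (Y i)"
      using var0 b by (intro mult_right_mono mult_left_mono) auto
    finally have 2: "cmod (complex_of_real (1 - y i) - B i) \<le> v ^ 4 / 8 * b * variance (Y i)" .
    show "cmod (A i - B i) \<le> \<bar>v\<bar> ^ 3 / 6 * r i + v ^ 4 / 8 * b * variance (Y i)"
      using norm_triangle_le[of "A i - complex_of_real (1 - y i)" "complex_of_real (1 - y i) - B i"] 1 2 by simp
  qed
  also have "\<dots> = \<bar>v\<bar> ^ 3 / 6 * (\<Sum>i<n. r i) + v ^ 4 / 8 * b * (\<Sum>i<n. variance (Y i))"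
    by (simp add: sum.distrib sum_distrib_left)
  finally show ?thesis unfolding eq1 eq2 .
qed

text \<open>The extended sum has finite expectation \<open>m\<close>, so the series converges almost
  surely. Monotone convergence then gives the first two moments, and dominated convergence of the
  bounded exponentials carries the estimate for finite sums to the limit.\<close>

lemma (in prob_space) infinite_indep_sum:
  fixes Y :: "nat \<Rightarrow> 'a \<Rightarrow> real"
  assumes indep: "indep_vars (\<lambda>_. borel) Y UNIV"
    and nonneg: "\<And>i \<omega>. Y i \<omega> \<ge> 0"
    and i1: "\<And>i. integrable M (Y i)" and i2: "\<And>i. integrable M (\<lambda>\<omega>. (Y i \<omega>)\<^sup>2)"
    and i3: "\<And>i. integrable M (\<lambda>\<omega>. \<bar>Y i \<omega> - expectation (Y i)\<bar> ^ 3)"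
    and m: "(\<lambda>i. expectation (Y i)) sums m" and V: "(\<lambda>i. variance (Y i)) sums V"
    and r: "\<And>i. expectation (\<lambda>\<omega>. \<bar>Y i \<omega> - expectation (Y i)\<bar> ^ 3) \<le> r i" and sr: "summable r"
    and b: "\<And>i. variance (Y i) \<le> b"
    and S: "\<And>\<omega>. S \<omega> = (if summable (\<lambda>i. Y i \<omega>) then \<Sum>i. Y i \<omega> else 0)"
  shows "expectation S = m" "variance S = V"
    and "cmod (expectation (\<lambda>\<omega>. exp (\<i> * complex_of_real (v * (S \<omega> - m)))) - complex_of_real (exp (- (v\<^sup>2 * V / 2))))
       \<le> \<bar>v\<bar> ^ 3 / 6 * suminf r + v ^ 4 / 8 * b * V"
proof -
  have rv[measurable]: "Y i \<in> borel_measurable M" for i using i1 by auto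
  \<comment> \<open>The value 0 on the divergence set agrees with \<open>enn2real top = 0\<close>;
    written in this way, \<open>S\<close> is visibly measurable.\<close>
  have S_eq: "S = (\<lambda>\<omega>. enn2real (\<Sum>i. ennreal (Y i \<omega>)))"
  proof
    fix \<omega>
    show "S \<omega> = enn2real (\<Sum>i. ennreal (Y i \<omega>))"
    proof (cases "summable (\<lambda>i. Y i \<omega>)")
      case True
      hence "(\<Sum>i. ennreal (Y i \<omega>)) = ennreal (\<Sum>i. Y i \<omega>)"
        by (intro suminf_ennreal2) (use nonneg in auto)
      thus ?thesis using True nonneg by (simp add: S suminf_nonneg)
    next
      case False
      hence "(\<Sum>i. ennreal (Y i \<omega>)) = top"
        using summable_suminf_not_top[of "\<lambda>i. Y i \<omega>"] nonneg by blast
      thus ?thesis using False by (simp add: S)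
    qed
  qed
  have [measurable]: "S \<in> borel_measurable M" unfolding S_eq by measurable
  have m0: "m \<ge> 0" by (rule sums_le[OF _ sums_zero m]) (auto intro!: Bochner_Integration.integral_nonneg nonneg)
  have "(\<integral>\<^sup>+\<omega>. (\<Sum>i. ennreal (Y i \<omega>)) \<partial>M) = (\<Sum>i. \<integral>\<^sup>+\<omega>. ennreal (Y i \<omega>) \<partial>M)"
    by (rule nn_integral_suminf) measurable
  also have "\<dots> = (\<Sum>i. ennreal (expectation (Y i)))"
    by (intro suminf_cong nn_integral_eq_integral i1) (auto simp: nonneg)
  also have "\<dots> = ennreal m"
    using m by (intro sums_unique[symmetric]) (auto intro!: sums_ennreal[THEN iffD2] Bochner_Integration.integral_nonneg nonneg m0)
  finally have "(\<integral>\<^sup>+\<omega>. (\<Sum>i. ennreal (Y i \<omega>)) \<partial>M) = ennreal m" .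
  hence "AE \<omega> in M. (\<Sum>i. ennreal (Y i \<omega>)) \<noteq> \<infinity>"
    by (intro nn_integral_noteq_infinite) auto
  hence AEs: "AE \<omega> in M. summable (\<lambda>i. Y i \<omega>)"
    by eventually_elim (auto intro: summable_suminf_not_top nonneg)
  hence AEl: "AE \<omega> in M. (\<lambda>n. \<Sum>i<n. Y i \<omega>) \<longlonglongrightarrow> S \<omega>"
    by eventually_elim (auto simp: S intro: summable_LIMSEQ)
  define P where "P = (\<lambda>n \<omega>. \<Sum>i<n. Y i \<omega>)"
  have P0: "P n \<omega> \<ge> 0" for n \<omega> by (simp add: P_def nonneg sum_nonneg)
  have mono: "incseq (\<lambda>n. P n \<omega>)" for \<omega>
    by (intro incseq_SucI) (simp add: P_def nonneg)
  have iP: "integrable M (P n)" for n unfolding P_def by (intro Bochner_Integration.integrable_sum i1)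
  have EP: "expectation (P n) = (\<Sum>i<n. expectation (Y i))" for n
    unfolding P_def by (intro Bochner_Integration.integral_sum i1)
  have hb1: "has_bochner_integral M S m"
    by (rule has_bochner_integral_monotone_convergence[OF iP])
       (use AEl mono m in \<open>auto simp: P_def EP[unfolded P_def] sums_def\<close>)
  have iP2: "integrable M (\<lambda>\<omega>. (P n \<omega>)\<^sup>2)" for n
    unfolding P_def by (rule variance_indep_sum[OF indep i1 i2])
  have hb2: "has_bochner_integral M (\<lambda>\<omega>. (S \<omega>)\<^sup>2) (V + m\<^sup>2)"
  proof (rule has_bochner_integral_monotone_convergence[OF iP2])
    show "AE \<omega> in M. incseq (\<lambda>n. (P n \<omega>)\<^sup>2)"
      using mono P0 by (auto simp: incseq_def intro!: power_mono)
    show "AE \<omega> in M. (\<lambda>n. (P n \<omega>)\<^sup>2) \<longlonglongrightarrow> (S \<omega>)\<^sup>2"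
      using AEl by eventually_elim (auto simp: P_def intro!: tendsto_power)
    have "(\<lambda>n. (\<Sum>i<n. variance (Y i)) + (\<Sum>i<n. expectation (Y i))\<^sup>2) \<longlonglongrightarrow> V + m\<^sup>2"
      using V m unfolding sums_def by (intro tendsto_intros)
    thus "(\<lambda>n. expectation (\<lambda>\<omega>. (P n \<omega>)\<^sup>2)) \<longlonglongrightarrow> V + m\<^sup>2"
      unfolding P_def variance_indep_sum(2)[OF indep i1 i2] .
  qed simp
  show ES: "expectation S = m" using hb1 by (simp add: has_bochner_integral_iff)
  have "variance S = expectation (\<lambda>\<omega>. (S \<omega>)\<^sup>2) - (expectation S)\<^sup>2"
    using hb1 hb2 by (intro variance_eq) (auto simp: has_bochner_integral_iff)
  thus "variance S = V" using hb2 ES by (simp add: has_bochner_integral_iff)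
  have lim: "(\<lambda>n. expectation (\<lambda>\<omega>. exp (\<i> * complex_of_real (v * (P n \<omega> - (\<Sum>i<n. expectation (Y i)))))))
      \<longlonglongrightarrow> expectation (\<lambda>\<omega>. exp (\<i> * complex_of_real (v * (S \<omega> - m))))"
  proof (rule integral_dominated_convergence[where w="\<lambda>_. 1"])
    have [measurable]: "P n \<in> borel_measurable M" for n using iP by auto
    show "(\<lambda>\<omega>. exp (\<i> * complex_of_real (v * (S \<omega> - m)))) \<in> borel_measurable M" by measurable
    show "(\<lambda>\<omega>. exp (\<i> * complex_of_real (v * (P n \<omega> - (\<Sum>i<n. expectation (Y i)))))) \<in> borel_measurable M" for n by measurable
    show "AE \<omega> in M. (\<lambda>n. exp (\<i> * complex_of_real (v * (P n \<omega> - (\<Sum>i<n. expectation (Y i)))))) 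
        \<longlonglongrightarrow> exp (\<i> * complex_of_real (v * (S \<omega> - m)))"
      using AEl
    proof eventually_elim
      case (elim \<omega>)
      thus ?case using m unfolding sums_def P_def by (intro tendsto_intros)
    qed
  qed auto
  show "cmod (expectation (\<lambda>\<omega>. exp (\<i> * complex_of_real (v * (S \<omega> - m)))) - complex_of_real (exp (- (v\<^sup>2 * V / 2))))
       \<le> \<bar>v\<bar> ^ 3 / 6 * suminf r + v ^ 4 / 8 * b * V"
  proof (rule LIMSEQ_le)
    show "(\<lambda>n. cmod (expectation (\<lambda>\<omega>. exp (\<i> * complex_of_real (v * (P n \<omega> - (\<Sum>i<n. expectation (Y i)))))) 
        - complex_of_real (exp (- (v\<^sup>2 * (\<Sum>i<n. variance (Y i)) / 2)))))
      \<longlonglongrightarrow> cmod (expectation (\<lambda>\<omega>. exp (\<i> * complex_of_real (v * (S \<omega> - m)))) - complex_of_real (exp (- (v\<^sup>2 * V / 2))))"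
      using V unfolding sums_def by (intro tendsto_intros lim) auto
    show "(\<lambda>n. \<bar>v\<bar> ^ 3 / 6 * (\<Sum>i<n. r i) + v ^ 4 / 8 * b * (\<Sum>i<n. variance (Y i))) 
       \<longlonglongrightarrow> \<bar>v\<bar> ^ 3 / 6 * suminf r + v ^ 4 / 8 * b * V"
      using V summable_LIMSEQ[OF sr] unfolding sums_def by (intro tendsto_intros)
    show "\<exists>N. \<forall>n\<ge>N. cmod (expectation (\<lambda>\<omega>. exp (\<i> * complex_of_real (v * (P n \<omega> - (\<Sum>i<n. expectation (Y i)))))) 
        - complex_of_real (exp (- (v\<^sup>2 * (\<Sum>i<n. variance (Y i)) / 2)))) \<le> \<bar>v\<bar> ^ 3 / 6 * (\<Sum>i<n. r i) + v ^ 4 / 8 * b * (\<Sum>i<n. variance (Y i))"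
      unfolding P_def using char_indep_sum_approx[OF indep i1 i2 i3 r b] by blast
  qed
qed

section \<open>Geometric variables\<close>

text \<open>Used to pass from variables indexed by \<open>pairs\<close> to a sequence. Independence
  is a condition on finite subfamilies, and injectivity keeps their members distinct.\<close>

lemma (in prob_space) indep_vars_reindex:
  assumes "inj_on f I" and "indep_vars (\<lambda>_. N) X (f ` I)"
  shows "indep_vars (\<lambda>_. N) (\<lambda>i. X (f i)) I"
  unfolding indep_vars_def2
proof (intro conjI ballI)
  show "random_variable N (X (f i))" if "i \<in> I" for i
    using assms(2) that unfolding indep_vars_def2 by blast
  have indep: "indep_sets (\<lambda>i. {X i -` A \<inter> space M |A. A \<in> sets N}) (f ` I)"
    using assms(2) unfolding indep_vars_def2 by blast
  show "indep_sets (\<lambda>i. {X (f i) -` A \<inter> space M |A. A \<in> sets N}) I"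
    unfolding indep_sets_def
  proof (intro conjI ballI allI impI)
    show "{X (f i) -` A \<inter> space M |A. A \<in> sets N} \<subseteq> events" if "i \<in> I" for i
      using indep that unfolding indep_sets_def by blast
    fix J A assume J: "J \<subseteq> I" "J \<noteq> {}" "finite J" 
      and A: "A \<in> (\<Pi> i\<in>J. {X (f i) -` A \<inter> space M |A. A \<in> sets N})"
    define g where "g = the_inv_into J f"
    have inj: "inj_on f J" using assms(1) J(1) by (rule inj_on_subset)
    have g: "g (f j) = j" if "j \<in> J" for j unfolding g_def by (rule the_inv_into_f_f[OF inj that])
    have "prob (\<Inter>k\<in>f ` J. A (g k)) = (\<Prod>k\<in>f ` J. prob (A (g k)))"
    proof -
      have "(\<lambda>k. A (g k)) \<in> (\<Pi> k\<in>f ` J. {X k -` A \<inter> space M |A. A \<in> sets N})"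
        using A g by (auto simp: Pi_iff)
      moreover have "f ` J \<subseteq> f ` I" "f ` J \<noteq> {}" "finite (f ` J)" using J by auto
      moreover have "prob (\<Inter>k\<in>K. B k) = (\<Prod>k\<in>K. prob (B k))" 
        if "B \<in> (\<Pi> k\<in>K. {X k -` A \<inter> space M |A. A \<in> sets N})" "K \<subseteq> f ` I" "K \<noteq> {}" "finite K" for K B
        using indep that unfolding indep_sets_def by blast
      ultimately show ?thesis by blast
    qed
    also have "(\<Inter>k\<in>f ` J. A (g k)) = (\<Inter>j\<in>J. A j)" using g by auto
    also have "(\<Prod>k\<in>f ` J. prob (A (g k))) = (\<Prod>j\<in>J. prob (A j))"
      using g by (subst prod.reindex[OF inj]) auto
    finally show "prob (\<Inter>j\<in>J. A j) = (\<Prod>j\<in>J. prob (A j))" .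
  qed
qed

text \<open>The exponential series is cut down to its terms of index 0 and \<open>k\<close>.
  Retaining the \<open>- 1\<close> matters: it is what makes the moment bounds below decay
  exponentially for large \<open>x\<close>.\<close>

lemma power_le_exp_minus_1:
  fixes y :: real
  assumes "y \<ge> 0" "k \<ge> 1"
  shows "y ^ k \<le> fact k * (exp y - 1)"
proof -
  have "(\<Sum>n\<in>{0, k}. y ^ n /\<^sub>R fact n) \<le> exp y"
    unfolding exp_def using assms by (intro sum_le_suminf summable_exp_generic) auto
  hence "1 + y ^ k / fact k \<le> exp y" using assms by (simp add: divide_inverse mult.commute)
  thus ?thesis by (simp add: field_simps)
qed

locale geometric_var = prob_space +
  fixes X :: "'a \<Rightarrow> nat" and x :: real
  assumes rv[measurable]: "X \<in> measurable M (count_space UNIV)"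
    and x_pos: "x > 0"
    and prob_eq: "\<And>m. prob {\<omega> \<in> space M. X \<omega> = m} = (1 - exp (- x)) * exp (- x) ^ m"
begin

lemma has_expectation:
  fixes f :: "nat \<Rightarrow> real"
  assumes "\<And>m. f m \<ge> 0" and "(\<lambda>m. f m * ((1 - exp (- x)) * exp (- x) ^ m)) sums s"
  shows "has_bochner_integral M (\<lambda>\<omega>. f (X \<omega>)) s"
proof (rule has_bochner_integral_nn_integral)
  show "(\<lambda>\<omega>. f (X \<omega>)) \<in> borel_measurable M" by measurable
  show "AE \<omega> in M. 0 \<le> f (X \<omega>)" using assms(1) by simp
  have q: "0 \<le> (1 - exp (- x)) * exp (- x) ^ m" for m using x_pos by simp
  show "0 \<le> s" by (rule sums_le[OF _ sums_zero assms(2)]) (use assms(1) q in auto)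
  have eq: "ennreal (f (X \<omega>)) = (\<Sum>m. ennreal (f m) * indicator {\<omega> \<in> space M. X \<omega> = m} \<omega>)" if "\<omega> \<in> space M" for \<omega>
  proof -
    have "(\<Sum>m. ennreal (f m) * indicator {\<omega> \<in> space M. X \<omega> = m} \<omega>) 
        = (\<Sum>m\<in>{X \<omega>}. ennreal (f m) * indicator {\<omega> \<in> space M. X \<omega> = m} \<omega>)"
      by (rule suminf_finite) auto
    thus ?thesis using that by simp
  qed
  have "(\<integral>\<^sup>+\<omega>. ennreal (f (X \<omega>)) \<partial>M) = (\<integral>\<^sup>+\<omega>. (\<Sum>m. ennreal (f m) * indicator {\<omega> \<in> space M. X \<omega> = m} \<omega>) \<partial>M)"
    by (rule nn_integral_cong) (rule eq)
  also have "\<dots> = (\<Sum>m. \<integral>\<^sup>+\<omega>. ennreal (f m) * indicator {\<omega> \<in> space M. X \<omega> = m} \<omega> \<partial>M)"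
    by (rule nn_integral_suminf) measurable
  also have "\<dots> = (\<Sum>m. ennreal (f m * ((1 - exp (- x)) * exp (- x) ^ m)))"
  proof (rule suminf_cong)
    fix m
    have "(\<integral>\<^sup>+\<omega>. ennreal (f m) * indicator {\<omega> \<in> space M. X \<omega> = m} \<omega> \<partial>M) = ennreal (f m) * emeasure M {\<omega> \<in> space M. X \<omega> = m}"
      by (rule nn_integral_cmult_indicator) measurable
    also have "emeasure M {\<omega> \<in> space M. X \<omega> = m} = ennreal ((1 - exp (- x)) * exp (- x) ^ m)"
      by (simp only: emeasure_eq_measure prob_eq)
    finally show "(\<integral>\<^sup>+\<omega>. ennreal (f m) * indicator {\<omega> \<in> space M. X \<omega> = m} \<omega> \<partial>M) = ennreal (f m * ((1 - exp (- x)) * exp (- x) ^ m))"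
      using assms(1) by (simp only: ennreal_mult'[symmetric])
  qed
  also have "\<dots> = ennreal s"
    using assms(2) by (intro sums_unique[symmetric] sums_ennreal[THEN iffD2]) (use assms(1) q sums_le[OF _ sums_zero assms(2)] in auto)
  finally show "(\<integral>\<^sup>+\<omega>. ennreal (f (X \<omega>)) \<partial>M) = ennreal s" .
qed

text \<open>The expectation of \<open>exp (x / 2 * X) - 1\<close>. Half of the decay rate
  \<open>x\<close> of the law is spent on the exponential moment, and what is left is
  \<open>exp (- (x / 2))\<close>.\<close>

lemma exp_minus_1_sums: 
  "(\<lambda>m. (exp (x / 2 * real m) - 1) * ((1 - exp (- x)) * exp (- x) ^ m)) sums exp (- (x / 2))"
proof -
  define h where "h = exp (- (x / 2))"
  have h: "0 < h" "h < 1" "exp (- x) = h\<^sup>2" using x_pos by (auto simp: h_def exp_double[symmetric])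
  have h1: "exp (x / 2 * real m) * exp (- x) ^ m = h ^ m" for m
    unfolding h_def exp_of_nat_mult[symmetric] exp_add[symmetric] by (simp add: field_simps)
  have "(\<lambda>m. (1 - h\<^sup>2) * h ^ m - (1 - h\<^sup>2) * (h\<^sup>2) ^ m) sums ((1 - h\<^sup>2) * (1 / (1 - h)) - (1 - h\<^sup>2) * (1 / (1 - h\<^sup>2)))"
    using h by (intro sums_diff sums_mult geometric_sums) (auto simp: power_less_one_iff)
  moreover have "(1 - h\<^sup>2) * h ^ m - (1 - h\<^sup>2) * (h\<^sup>2) ^ m = (exp (x / 2 * real m) - 1) * ((1 - exp (- x)) * exp (- x) ^ m)" for m
  proof -
    have "(e - 1) * ((1 - a) * b) = (1 - a) * (e * b) - (1 - a) * b" for e a b :: real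
      by (simp add: algebra_simps)
    hence "(exp (x / 2 * real m) - 1) * ((1 - exp (- x)) * exp (- x) ^ m) 
       = (1 - exp (- x)) * (exp (x / 2 * real m) * exp (- x) ^ m) - (1 - exp (- x)) * exp (- x) ^ m" .
    thus ?thesis unfolding h1 unfolding h(3) by (rule sym)
  qed
  moreover have "(1 - h\<^sup>2) * (1 / (1 - h)) - (1 - h\<^sup>2) * (1 / (1 - h\<^sup>2)) = h"
  proof -
    have "1 - h \<noteq> 0" "1 + h \<noteq> 0" using h by auto
    moreover have "1 - h\<^sup>2 = (1 - h) * (1 + h)" by (simp add: power2_eq_square algebra_simps)
    ultimately show ?thesis by simp
  qed
  ultimately have "(\<lambda>m. (exp (x / 2 * real m) - 1) * ((1 - exp (- x)) * exp (- x) ^ m)) sums h" by (simp only:)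
  thus ?thesis unfolding h_def .
qed

text \<open>The bound has the right order \<open>1 / x ^ k\<close> for small \<open>x\<close>, and
  for large \<open>x\<close> the decay that makes it summable over all pairs. It follows term by
  term from \<open>power_le_exp_minus_1\<close> applied to \<open>x / 2 * real m\<close>.\<close>

lemma moment:
  assumes k: "k \<ge> 1"
  shows "summable (\<lambda>m. real m ^ k * ((1 - exp (- x)) * exp (- x) ^ m))"
    and "integrable M (\<lambda>\<omega>. real (X \<omega>) ^ k)"
    and "expectation (\<lambda>\<omega>. real (X \<omega>) ^ k) = (\<Sum>m. real m ^ k * ((1 - exp (- x)) * exp (- x) ^ m))"
    and "expectation (\<lambda>\<omega>. real (X \<omega>) ^ k) \<le> fact k * (2 / x) ^ k * exp (- (x / 2))"
proof -
  let ?P = "\<lambda>m. (1 - exp (- x)) * exp (- x) ^ m"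
  have q: "0 \<le> ?P m" for m using x_pos by simp
  have le: "real m ^ k * ?P m \<le> fact k * (2 / x) ^ k * ((exp (x / 2 * real m) - 1) * ?P m)" for m
  proof -
    have "(x / 2 * real m) ^ k \<le> fact k * (exp (x / 2 * real m) - 1)"
      using x_pos k by (intro power_le_exp_minus_1) auto
    hence "(2 / x) ^ k * (x / 2 * real m) ^ k \<le> (2 / x) ^ k * (fact k * (exp (x / 2 * real m) - 1))"
      using x_pos by (intro mult_left_mono) auto
    moreover have "(2 / x) ^ k * (x / 2 * real m) ^ k = real m ^ k"
      unfolding power_mult_distrib[symmetric] using x_pos by simp
    ultimately have "real m ^ k \<le> fact k * (2 / x) ^ k * (exp (x / 2 * real m) - 1)" by (simp add: mult_ac)
    from mult_right_mono[OF this q[of m]] show ?thesis by (simp only: mult.assoc)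
  qed
  have s: "(\<lambda>m. fact k * (2 / x) ^ k * ((exp (x / 2 * real m) - 1) * ?P m)) sums (fact k * (2 / x) ^ k * exp (- (x / 2)))"
    by (intro sums_mult exp_minus_1_sums)
  show sm: "summable (\<lambda>m. real m ^ k * ?P m)"
    by (rule summable_comparison_test'[OF sums_summable[OF s], where N=0]) (use le q in auto)
  have hb: "has_bochner_integral M (\<lambda>\<omega>. real (X \<omega>) ^ k) (\<Sum>m. real m ^ k * ?P m)"
    using has_expectation[of "\<lambda>m. real m ^ k"] sm by (simp add: summable_sums)
  thus "integrable M (\<lambda>\<omega>. real (X \<omega>) ^ k)" 
    and eq: "expectation (\<lambda>\<omega>. real (X \<omega>) ^ k) = (\<Sum>m. real m ^ k * ?P m)"
    by (auto simp: has_bochner_integral_iff)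
  show "expectation (\<lambda>\<omega>. real (X \<omega>) ^ k) \<le> fact k * (2 / x) ^ k * exp (- (x / 2))"
    unfolding eq by (rule sums_le[OF _ summable_sums[OF sm] s]) (rule le)
qed

lemma shift: 
  assumes "(\<lambda>m. f m * ((1 - exp (- x)) * exp (- x) ^ m)) sums s" and "f 0 = 0"
  shows "(\<lambda>m. exp (- x) * (f (Suc m) * ((1 - exp (- x)) * exp (- x) ^ m))) sums s"
proof -
  have "(\<lambda>m. f (Suc m) * ((1 - exp (- x)) * exp (- x) ^ Suc m)) sums s"
    using sums_Suc_iff[of "\<lambda>m. f m * ((1 - exp (- x)) * exp (- x) ^ m)" s] assms by simp
  thus ?thesis by (simp add: mult_ac)
qed

text \<open>The geometric law has no memory: dropping the value 0 and shifting the index reproduces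
  it with the factor \<open>q = exp (- x)\<close>. The first two moments therefore solve the linear
  equations \<open>\<mu> = q * (\<mu> + 1)\<close> and
  \<open>A = q * (A + 2 * \<mu> + 1)\<close>.\<close>

lemma mean_variance:
  shows "expectation (\<lambda>\<omega>. real (X \<omega>)) = 1 / (exp x - 1)" (is "?mu = _")
    and "variance (\<lambda>\<omega>. real (X \<omega>)) = 1 / (exp x - 1) + (1 / (exp x - 1))\<^sup>2"
proof -
  define q where "q = exp (- x)"
  have q: "0 < q" "q < 1" using x_pos by (auto simp: q_def)
  let ?P = "\<lambda>m. (1 - exp (- x)) * exp (- x) ^ m"
  define A where "A = expectation (\<lambda>\<omega>. (real (X \<omega>))\<^sup>2)"
  define \<mu> where "\<mu> = expectation (\<lambda>\<omega>. real (X \<omega>))"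
  have sP: "?P sums 1" using sums_mult[OF geometric_sums[of q], of "1 - q"] q by (simp add: q_def)
  have s1: "(\<lambda>m. real m * ?P m) sums \<mu>" 
    using summable_sums[OF moment(1)[of 1]] moment(3)[of 1] by (simp add: \<mu>_def)
  have s2: "(\<lambda>m. (real m)\<^sup>2 * ?P m) sums A" 
    using summable_sums[OF moment(1)[of 2]] moment(3)[of 2] by (simp add: A_def)
  have "(\<lambda>m. q * (real (Suc m) * ?P m)) sums \<mu>"
    using shift[of real, OF s1] by (simp add: q_def)
  moreover have "(\<lambda>m. q * (real m * ?P m + ?P m)) sums (q * (\<mu> + 1))"
    by (intro sums_mult sums_add s1 sP)
  hence "(\<lambda>m. q * (real (Suc m) * ?P m)) sums (q * (\<mu> + 1))"
    by (simp add: algebra_simps)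
  ultimately have e1: "\<mu> = q * (\<mu> + 1)" by (rule sums_unique2)
  have "(\<lambda>m. q * ((real (Suc m))\<^sup>2 * ?P m)) sums A"
    using shift[of "\<lambda>m. (real m)\<^sup>2", OF s2] by (simp add: q_def)
  moreover have "(\<lambda>m. q * ((real m)\<^sup>2 * ?P m + 2 * (real m * ?P m) + ?P m)) sums (q * (A + 2 * \<mu> + 1))"
    by (intro sums_mult sums_add s1 s2 sP)
  hence "(\<lambda>m. q * ((real (Suc m))\<^sup>2 * ?P m)) sums (q * (A + 2 * \<mu> + 1))"
    by (simp add: algebra_simps power2_eq_square)
  ultimately have e2: "A = q * (A + 2 * \<mu> + 1)" by (rule sums_unique2)
  have \<mu>: "\<mu> = q / (1 - q)" using e1 q by (simp add: field_simps)
  have "A = q * (2 * \<mu> + 1) / (1 - q)" using e2 q by (simp add: field_simps)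
  hence A: "A = \<mu> * (2 * \<mu> + 1)" by (simp add: \<mu>)
  have mu': "\<mu> = 1 / (exp x - 1)" using x_pos unfolding \<mu> q_def by (simp add: exp_minus field_simps)
  thus "?mu = 1 / (exp x - 1)" by (simp add: \<mu>_def)
  have "variance (\<lambda>\<omega>. real (X \<omega>)) = A - \<mu>\<^sup>2"
    unfolding A_def \<mu>_def using moment(2)[of 1] moment(2)[of 2] by (intro variance_eq) auto
  thus "variance (\<lambda>\<omega>. real (X \<omega>)) = 1 / (exp x - 1) + (1 / (exp x - 1))\<^sup>2"
    unfolding A mu'[symmetric] by (simp add: power2_eq_square algebra_simps)
qed

text \<open>For nonnegative numbers the cube of the distance is at most the sum of the cubes. The
  constant is \<open>56 = 48 + 8\<close>, with \<open>48 = 3! * 2 ^ 3\<close> from the third moment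
  and \<open>8 = 2 ^ 3\<close> from the cube of the mean.\<close>

lemma centered_third_moment:
  shows "integrable M (\<lambda>\<omega>. \<bar>real (X \<omega>) - expectation (\<lambda>\<omega>. real (X \<omega>))\<bar> ^ 3)"
    and "expectation (\<lambda>\<omega>. \<bar>real (X \<omega>) - expectation (\<lambda>\<omega>. real (X \<omega>))\<bar> ^ 3) \<le> 56 / x ^ 3 * exp (- (x / 2))"
proof -
  define \<mu> where "\<mu> = expectation (\<lambda>\<omega>. real (X \<omega>))"
  have \<mu>0: "\<mu> \<ge> 0" unfolding \<mu>_def by (intro Bochner_Integration.integral_nonneg) auto
  have h: "exp (- (x / 2)) \<le> 1" using x_pos by simp
  have "\<mu> \<le> 2 / x * exp (- (x / 2))" using moment(4)[of 1] by (simp add: \<mu>_def)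
  hence "\<mu> ^ 3 \<le> (2 / x * exp (- (x / 2))) ^ 3" using \<mu>0 by (intro power_mono)
  also have "\<dots> = 8 / x ^ 3 * exp (- (x / 2)) ^ 3" by (simp add: power_mult_distrib power_divide)
  also have "\<dots> \<le> 8 / x ^ 3 * exp (- (x / 2)) ^ 1"
    using h x_pos by (intro mult_left_mono power_decreasing) auto
  finally have \<mu>3: "\<mu> ^ 3 \<le> 8 / x ^ 3 * exp (- (x / 2))" by simp
  have int: "integrable M (\<lambda>\<omega>. real (X \<omega>) ^ 3 + \<mu> ^ 3)" using moment(2)[of 3] by auto
  have le: "\<bar>real (X \<omega>) - \<mu>\<bar> ^ 3 \<le> real (X \<omega>) ^ 3 + \<mu> ^ 3" for \<omega>
  proof (cases "real (X \<omega>) \<ge> \<mu>")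
    case True
    hence "\<bar>real (X \<omega>) - \<mu>\<bar> ^ 3 \<le> real (X \<omega>) ^ 3" using \<mu>0 by (intro power_mono) auto
    thus ?thesis using \<mu>0 by (simp add: add_increasing2)
  next
    case False
    hence "\<bar>real (X \<omega>) - \<mu>\<bar> ^ 3 \<le> \<mu> ^ 3" by (intro power_mono) auto
    thus ?thesis by (simp add: add_increasing)
  qed
  have "integrable M (\<lambda>\<omega>. \<bar>real (X \<omega>) - \<mu>\<bar> ^ 3)"
    by (rule Bochner_Integration.integrable_bound[OF int]) (use le \<mu>0 in auto)
  thus int': "integrable M (\<lambda>\<omega>. \<bar>real (X \<omega>) - expectation (\<lambda>\<omega>. real (X \<omega>))\<bar> ^ 3)" by (simp add: \<mu>_def)
  have "expectation (\<lambda>\<omega>. \<bar>real (X \<omega>) - \<mu>\<bar> ^ 3) \<le> expectation (\<lambda>\<omega>. real (X \<omega>) ^ 3 + \<mu> ^ 3)"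
    using int' by (intro integral_mono int le) (simp add: \<mu>_def)
  also have "\<dots> = expectation (\<lambda>\<omega>. real (X \<omega>) ^ 3) + \<mu> ^ 3" using moment(2)[of 3] by (simp add: prob_space)
  also have "\<dots> \<le> fact 3 * (2 / x) ^ 3 * exp (- (x / 2)) + 8 / x ^ 3 * exp (- (x / 2))"
    by (intro add_mono \<mu>3 moment) auto
  also have "\<dots> = 56 / x ^ 3 * exp (- (x / 2))" by (simp add: power_divide fact_numeral field_simps)
  finally show "expectation (\<lambda>\<omega>. \<bar>real (X \<omega>) - expectation (\<lambda>\<omega>. real (X \<omega>))\<bar> ^ 3) \<le> 56 / x ^ 3 * exp (- (x / 2))"
    by (simp add: \<mu>_def)
qed

end

section \<open>The weighted sum\<close>

lemma countable_pairs: "countable pairs" by simp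

lemma infinite_pairs: "infinite pairs"
  by (auto simp: pairs_def finite_cartesian_product_iff infinite_Ici)

text \<open>With \<open>y = w * t / 2\<close> this bounds the sum of the factors
  \<open>exp (- (w * t / 2))\<close> in the moment estimates by \<open>t / 2\<close> times the mean
  at parameter \<open>t / 2\<close>.\<close>

lemma exp_neg_le_bose:
  fixes y :: real
  assumes "y > 0"
  shows "exp (- y) \<le> y / (exp y - 1)"
proof -
  have "exp (- y) * (exp y - 1) = 1 - exp (- y)" by (simp add: exp_minus field_simps)
  also have "\<dots> \<le> y" using exp_ge_add_one_self[of "- y"] by simp
  finally show ?thesis using assms by (simp add: pos_le_divide_eq)
qed

text \<open>For nonnegative terms ordinary and unconditional summability coincide, and
  \<open>infsum\<close> is 0 otherwise, so the enumeration \<open>e\<close> affects neither the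
  value nor the default.\<close>

lemma weighted_sum_eq:
  fixes X :: "nat \<Rightarrow> nat \<Rightarrow> 'a \<Rightarrow> nat"
  assumes e: "bij_betw e UNIV pairs"
  defines "Y \<equiv> \<lambda>(i::nat) \<omega>. pair_weight (e i) * real (X (fst (e i)) (snd (e i)) \<omega>)"
  shows "weighted_sum X \<omega> = (if summable (\<lambda>i. Y i \<omega>) then \<Sum>i. Y i \<omega> else 0)"
proof -
  define f where "f = (\<lambda>p. pair_weight p * real (X (fst p) (snd p) \<omega>))"
  have "e i \<in> pairs" for i using e by (auto simp: bij_betw_def)
  hence nonneg: "f (e i) \<ge> 0" for i
    unfolding f_def using pair_weight_ge_1[of "e i"] by (intro mult_nonneg_nonneg) auto
  have "weighted_sum X \<omega> = infsum f pairs"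
    unfolding weighted_sum_def pairs_def f_def pair_weight_def by (intro infsum_cong) auto
  also have "\<dots> = infsum (\<lambda>i. f (e i)) UNIV"
    by (rule infsum_reindex_bij_betw[OF e, symmetric])
  also have "\<dots> = (if summable (\<lambda>i. f (e i)) then \<Sum>i. f (e i) else 0)"
  proof (cases "summable (\<lambda>i. f (e i))")
    case True
    thus ?thesis using sums_nonneg_imp_has_sum[OF summable_sums[OF True] nonneg] by (simp add: infsumI)
  next
    case False
    thus ?thesis using summable_on_UNIV_nonneg_real_iff[of "\<lambda>i. f (e i)"] nonneg by (simp add: infsum_not_exists)
  qed
  finally show ?thesis by (simp add: f_def Y_def)
qed

text \<open>The weights scale out of the moment bounds: variance and third absolute moment of a
  summand are at most a negative power of \<open>t\<close> times \<open>exp (- (w * t / 2))\<close>.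
  The sums of these bounds are controlled by \<open>\<mu> (t / 2)\<close>, so the expansion of the
  mean is the only asymptotic information required.\<close>

lemma (in prob_space) weighted_sum_normal_approx:
  fixes X :: "nat \<Rightarrow> nat \<Rightarrow> 'a \<Rightarrow> nat" and \<mu> :: "real \<Rightarrow> real"
  assumes t: "t > 0"
    and indep: "indep_vars (\<lambda>_. count_space UNIV) (\<lambda>(j, k). X j k) pairs"
    and geom: "\<And>j k m. j \<ge> 1 \<Longrightarrow> k \<ge> 1 \<Longrightarrow> prob {\<omega> \<in> space M. X j k \<omega> = m}
              = (1 - exp (- (weight j k * t))) * exp (- (weight j k * real m * t))"
    and \<mu>: "\<And>t. t > 0 \<Longrightarrow> ((\<lambda>p. pair_weight p / (exp (pair_weight p * t) - 1)) has_sum \<mu> t) pairs"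
  shows "expectation (weighted_sum X) = \<mu> t" "\<mu> t / t \<le> variance (weighted_sum X)"
    and "cmod (expectation (\<lambda>\<omega>. exp (\<i> * complex_of_real (v * (weighted_sum X \<omega> - \<mu> t)))) 
           - complex_of_real (exp (- (v\<^sup>2 * variance (weighted_sum X) / 2))))
       \<le> \<bar>v\<bar> ^ 3 / 6 * (28 / t\<^sup>2 * \<mu> (t / 2)) + v ^ 4 / 8 * (8 / t\<^sup>2) * variance (weighted_sum X)"
proof -
  define e where "e = from_nat_into pairs"
  have e: "bij_betw e UNIV pairs"
    unfolding e_def by (rule bij_betw_from_nat_into[OF countable_pairs infinite_pairs])
  have ep: "e i \<in> pairs" for i using e by (auto simp: bij_betw_def)
  define Z where "Z = (\<lambda>i. X (fst (e i)) (snd (e i)))"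
  define w where "w = (\<lambda>i. pair_weight (e i))"
  have w: "w i \<ge> 1" "w i > 0" for i using pair_weight_ge_1[OF ep[of i]] by (auto simp: w_def)
  define Y where "Y = (\<lambda>(i::nat) \<omega>. w i * real (Z i \<omega>))"
  have indepZ: "indep_vars (\<lambda>_. count_space UNIV) Z UNIV"
  proof -
    have "indep_vars (\<lambda>_. count_space UNIV) (\<lambda>i. (\<lambda>(j, k). X j k) (e i)) UNIV"
      by (rule indep_vars_reindex[where f=e and X="\<lambda>(j, k). X j k"]) (use e indep in \<open>auto simp: bij_betw_def\<close>)
    thus ?thesis by (simp add: Z_def case_prod_beta)
  qed
  have geo: "geometric_var M (Z i) (w i * t)" for i
  proof unfold_locales
    show "Z i \<in> measurable M (count_space UNIV)" using indepZ unfolding indep_vars_def by blast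
    show "w i * t > 0" using w t by simp
    obtain j k where jk: "e i = (j, k)" "j \<ge> 1" "k \<ge> 1" using ep[of i] by (auto simp: pairs_def)
    show "prob {\<omega> \<in> space M. Z i \<omega> = m} = (1 - exp (- (w i * t))) * exp (- (w i * t)) ^ m" for m
    proof -
      have "exp (- (w i * t)) ^ m = exp (- (weight j k * real m * t))"
        unfolding exp_of_nat_mult[symmetric] by (simp add: w_def pair_weight_def jk)
      thus ?thesis using geom[OF jk(2,3), of m] by (simp add: Z_def w_def pair_weight_def jk)
    qed
  qed
  define g where "g = (\<lambda>i. 1 / (exp (w i * t) - 1))"
  define h where "h = (\<lambda>i. exp (- (w i * t / 2)))"
  have h: "0 < h i" "h i \<le> 1" for i using w[of i] t by (auto simp: h_def)
  have EY: "expectation (Y i) = w i * g i" for i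
    using geometric_var.mean_variance(1)[OF geo[of i]] by (simp add: Y_def g_def)
  have iZ: "integrable M (\<lambda>\<omega>. real (Z i \<omega>) ^ k)" if "k \<ge> 1" for i k
    by (rule geometric_var.moment(2)[OF geo that])
  have iY: "integrable M (Y i)" "integrable M (\<lambda>\<omega>. (Y i \<omega>)\<^sup>2)" for i
    using iZ[of 1 i] iZ[of 2 i] by (simp_all add: Y_def power_mult_distrib)
  have varY: "variance (Y i) = (w i)\<^sup>2 * (g i + (g i)\<^sup>2)" for i
  proof -
    have "variance (Y i) = expectation (\<lambda>\<omega>. (w i)\<^sup>2 * (real (Z i \<omega>) - expectation (\<lambda>\<omega>. real (Z i \<omega>)))\<^sup>2)"
      by (simp add: Y_def right_diff_distrib[symmetric] power_mult_distrib)
    also have "\<dots> = (w i)\<^sup>2 * variance (\<lambda>\<omega>. real (Z i \<omega>))" by simp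
    finally show ?thesis using geometric_var.mean_variance(2)[OF geo[of i]] by (simp add: g_def)
  qed
  have c3: "\<bar>Y i \<omega> - expectation (Y i)\<bar> ^ 3 = w i ^ 3 * \<bar>real (Z i \<omega>) - expectation (\<lambda>\<omega>. real (Z i \<omega>))\<bar> ^ 3" for i \<omega>
  proof -
    have "Y i \<omega> - expectation (Y i) = w i * (real (Z i \<omega>) - expectation (\<lambda>\<omega>. real (Z i \<omega>)))"
      by (simp add: Y_def right_diff_distrib)
    thus ?thesis using w(2)[of i] by (simp add: abs_mult power_mult_distrib)
  qed
  have i3: "integrable M (\<lambda>\<omega>. \<bar>Y i \<omega> - expectation (Y i)\<bar> ^ 3)" for i
    unfolding c3 using geometric_var.centered_third_moment(1)[OF geo[of i]] by simp
  have e3: "expectation (\<lambda>\<omega>. \<bar>Y i \<omega> - expectation (Y i)\<bar> ^ 3) \<le> 56 / t ^ 3 * h i" for i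
  proof -
    have "expectation (\<lambda>\<omega>. \<bar>Y i \<omega> - expectation (Y i)\<bar> ^ 3) 
        = w i ^ 3 * expectation (\<lambda>\<omega>. \<bar>real (Z i \<omega>) - expectation (\<lambda>\<omega>. real (Z i \<omega>))\<bar> ^ 3)"
      unfolding c3 by simp
    \<comment> \<open>The cube of the weight cancels against the denominator
      \<open>(w i * t) ^ 3\<close>.\<close>
    also have "\<dots> \<le> w i ^ 3 * (56 / (w i * t) ^ 3 * exp (- (w i * t / 2)))"
      by (rule mult_left_mono[OF geometric_var.centered_third_moment(2)[OF geo[of i]]]) (use w(2)[of i] in simp)
    also have "\<dots> = 56 / t ^ 3 * h i" using w(2)[of i] by (simp add: power_mult_distrib h_def)
    finally show ?thesis .
  qed
  have var_le: "variance (Y i) \<le> 8 / t\<^sup>2 * h i" for i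
  proof -
    have "variance (Y i) = expectation (\<lambda>\<omega>. (Y i \<omega>)\<^sup>2) - (expectation (Y i))\<^sup>2"
      by (rule variance_eq[OF iY])
    also have "\<dots> \<le> expectation (\<lambda>\<omega>. (Y i \<omega>)\<^sup>2)" by simp
    also have "\<dots> = (w i)\<^sup>2 * expectation (\<lambda>\<omega>. (real (Z i \<omega>))\<^sup>2)" by (simp add: Y_def power_mult_distrib)
    also have "\<dots> \<le> (w i)\<^sup>2 * (fact 2 * (2 / (w i * t))\<^sup>2 * exp (- (w i * t / 2)))"
      by (intro mult_left_mono geometric_var.moment(4)[OF geo]) auto
    also have "\<dots> = 8 / t\<^sup>2 * h i" using w(2)[of i] by (simp add: power_mult_distrib power_divide h_def)
    finally show ?thesis .
  qed
  define B where "B = (\<lambda>i. w i / (exp (w i * (t / 2)) - 1))"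
  have h_le: "h i \<le> t / 2 * B i" for i
    using exp_neg_le_bose[of "w i * t / 2"] w(2)[of i] t by (simp add: h_def B_def mult.commute)
  have "((\<lambda>i. pair_weight (e i) / (exp (pair_weight (e i) * (t / 2)) - 1)) has_sum \<mu> (t / 2)) UNIV"
    by (subst has_sum_reindex_bij_betw[OF e], rule \<mu>) (use t in simp)
  hence B: "B sums \<mu> (t / 2)" unfolding B_def w_def by (rule has_sum_imp_sums)
  have "((\<lambda>i. pair_weight (e i) / (exp (pair_weight (e i) * t) - 1)) has_sum \<mu> t) UNIV"
    by (subst has_sum_reindex_bij_betw[OF e], rule \<mu>) (use t in simp)
  hence m: "(\<lambda>i. expectation (Y i)) sums \<mu> t" 
    unfolding EY g_def w_def by (simp add: has_sum_imp_sums)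
  define r where "r = (\<lambda>i. 28 / t\<^sup>2 * B i)"
  have r: "r sums (28 / t\<^sup>2 * \<mu> (t / 2))" unfolding r_def by (intro sums_mult B)
  have r_ge: "expectation (\<lambda>\<omega>. \<bar>Y i \<omega> - expectation (Y i)\<bar> ^ 3) \<le> r i" for i
  proof -
    \<comment> \<open>One power of \<open>t\<close> is gained from \<open>h_le\<close>, and 56 is
      halved to the 28 of the statement.\<close>
    have "56 / t ^ 3 * h i \<le> 56 / t ^ 3 * (t / 2 * B i)" using t by (intro mult_left_mono h_le) auto
    also have "\<dots> = r i" using t by (simp add: r_def power2_eq_square power3_eq_cube)
    finally show ?thesis using e3[of i] by linarith
  qed
  have var0: "variance (Y i) \<ge> 0" for i by (intro Bochner_Integration.integral_nonneg) auto
  have var_b: "variance (Y i) \<le> 8 / t\<^sup>2" for i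
    using var_le[of i] mult_left_mono[OF h(2)[of i], of "8 / t\<^sup>2"] by simp
  have sV: "summable (\<lambda>i. variance (Y i))"
  proof (rule summable_comparison_test'[where N=0])
    show "summable (\<lambda>i. 8 / t\<^sup>2 * (t / 2 * B i))" by (intro summable_mult sums_summable[OF B])
    show "norm (variance (Y i)) \<le> 8 / t\<^sup>2 * (t / 2 * B i)" for i
      using var0[of i] var_le[of i] mult_left_mono[OF h_le[of i], of "8 / t\<^sup>2"] by simp
  qed
  define V where "V = (\<Sum>i. variance (Y i))"
  have V: "(\<lambda>i. variance (Y i)) sums V" unfolding V_def by (rule summable_sums[OF sV])
  have S: "weighted_sum X \<omega> = (if summable (\<lambda>i. Y i \<omega>) then \<Sum>i. Y i \<omega> else 0)" for \<omega>
    using weighted_sum_eq[OF e, of X \<omega>] by (simp add: Y_def w_def Z_def)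
  have indepY: "indep_vars (\<lambda>_. borel) Y UNIV"
    unfolding Y_def by (rule indep_vars_compose2[OF indepZ, where Y="\<lambda>i n. w i * real n"]) auto
  have Y0: "Y i \<omega> \<ge> 0" for i \<omega> using w(2)[of i] by (simp add: Y_def)
  note main = infinite_indep_sum[OF indepY Y0 iY i3 m V r_ge sums_summable[OF r] var_b S]
  show "expectation (weighted_sum X) = \<mu> t" by (rule main)
  have varV: "variance (weighted_sum X) = V" by (rule main)
  have "\<mu> t / t \<le> V"
  proof (rule sums_le[OF _ sums_divide[OF m] V])
    fix i
    have x: "w i * t > 0" using w(2)[of i] t by simp
    hence g0: "g i > 0" by (simp add: g_def)
    \<comment> \<open>Since \<open>g i + 1 = 1 / (1 - exp (- (w i * t)))\<close>, this is
      \<open>1 - exp (- y) <= y\<close>. The variance is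
      \<open>(w i)\<^sup>2 * g i * (g i + 1)\<close>, so it is at least the mean
      \<open>w i * g i\<close> divided by \<open>t\<close>, term by term.\<close>
    have "1 \<le> w i * t * (g i + 1)"
    proof -
      have "1 / (E - 1) + 1 = 1 / (1 - inverse E)" if "E > 1" for E :: real
        using that by (simp add: field_simps)
      hence "g i + 1 = 1 / (1 - exp (- (w i * t)))" using x by (simp add: g_def exp_minus)
      moreover have "1 - exp (- (w i * t)) \<le> w i * t" using exp_ge_add_one_self[of "- (w i * t)"] by simp
      ultimately show ?thesis using x by (simp add: pos_le_divide_eq)
    qed
    hence "w i * g i * 1 \<le> w i * g i * (w i * t * (g i + 1))" using w(2)[of i] g0 by (intro mult_left_mono) auto
    also have "\<dots> = t * ((w i)\<^sup>2 * (g i + (g i)\<^sup>2))" by (simp add: power2_eq_square algebra_simps)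
    finally show "expectation (Y i) / t \<le> variance (Y i)"
      unfolding varY unfolding EY using t by (simp add: pos_divide_le_eq mult.commute)
  qed
  thus "\<mu> t / t \<le> variance (weighted_sum X)" by (simp add: varV)
  show "cmod (expectation (\<lambda>\<omega>. exp (\<i> * complex_of_real (v * (weighted_sum X \<omega> - \<mu> t)))) 
           - complex_of_real (exp (- (v\<^sup>2 * variance (weighted_sum X) / 2))))
       \<le> \<bar>v\<bar> ^ 3 / 6 * (28 / t\<^sup>2 * \<mu> (t / 2)) + v ^ 4 / 8 * (8 / t\<^sup>2) * variance (weighted_sum X)"
    using main(3)[of v] unfolding varV sums_unique[OF r, symmetric] .
qed

section \<open>The mean at the saddle point\<close>

lemma const_X_pos: "const_X > 0"
proof -
  have z: "(\<lambda>n. real (Suc n) powr (- (5/3))) sums zeta_real (5/3)" by (rule zeta_real_sums) simp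
  have "(\<Sum>n<1. real (Suc n) powr (- (5/3))) \<le> (\<Sum>n. real (Suc n) powr (- (5/3)))"
    by (rule sum_le_suminf[OF sums_summable[OF z]]) auto
  hence "zeta_real (5/3) \<ge> 1" using sums_unique[OF z] by simp
  moreover have "(0::real) < 1/3" by simp
  hence "Gamma (1/3 :: real) \<noteq> 0" using Gamma_real_pos less_irrefl by metis
  ultimately show ?thesis by (simp add: const_X_def)
qed

text \<open>The coefficients of \<open>y\<close> and \<open>y\<^sup>2\<close> vanish; this is what the values of \<open>tau2\<close> and \<open>tau3\<close> are made for.\<close>

lemma mean_expansion_remainder:
  "((\<lambda>y::real. ((1 - y - y\<^sup>2 / 6) powr (-5/3) - 5/3 * y * (1 - y - y\<^sup>2 / 6) powr (-3/2) - 1) / y\<^sup>2) \<longlongrightarrow> 0) (at 0)"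
  by real_asymp

text \<open>In units of the leading term the two corrections are \<open>y\<close> and
  \<open>y\<^sup>2 / 6\<close> for a single small quantity \<open>y\<close> of order
  \<open>n powr (-1/10)\<close>, because \<open>tau3 / tau1\<close> is one sixth of the square of
  \<open>tau2 / tau1\<close>. The expansion of the mean thereby becomes one in a single
  variable.\<close>

lemma t_seq_eq:
  assumes "n > 0"
  defines "y \<equiv> 3 * const_Y / (20 * const_X ^ 3) * real n powr (-1/10)"
  shows "t_seq n = tau1 * real n powr (-3/5) * (1 - y - y\<^sup>2 / 6)"
proof -
  define a where "a = 3 * const_Y / (20 * const_X ^ 3)"
  have X: "const_X \<noteq> 0" using const_X_pos by simp
  have 2: "tau2 = tau1 * a" using X
    by (simp add: tau2_def tau1_def a_def power2_eq_square power3_eq_cube field_simps)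
  have 3: "tau3 = tau1 * (a\<^sup>2 / 6)" using X
    by (simp add: tau3_def tau1_def a_def power2_eq_square power3_eq_cube power4_eq_xxxx power_int_minus field_simps)
  have n1: "real n powr (-3/5) * real n powr (-1/10) = real n powr (-7/10)"
    by (simp only: powr_add[symmetric]) simp
  have n2: "real n powr (-3/5) * (real n powr (-1/10))\<^sup>2 = real n powr (-4/5)"
  proof -
    have "real n powr (-3/5) * (real n powr (-1/10))\<^sup>2 = real n powr (-3/5) * (real n powr (-1/10) * real n powr (-1/10))"
      by (simp add: power2_eq_square)
    thus ?thesis by (simp only: powr_add[symmetric]) simp
  qed
  have "tau1 * real n powr (-3/5) * (1 - y - y\<^sup>2 / 6) = 
     tau1 * real n powr (-3/5) - tau1 * a * (real n powr (-3/5) * real n powr (-1/10)) 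
     - tau1 * (a\<^sup>2 / 6) * (real n powr (-3/5) * (real n powr (-1/10))\<^sup>2)"
    unfolding y_def a_def[symmetric] power_mult_distrib by (simp add: algebra_simps)
  thus ?thesis unfolding n1 n2 t_seq_def 2 3 by simp
qed

lemma t_seq_scaled_lim: "(\<lambda>n. t_seq n * real n powr (3/5)) \<longlonglongrightarrow> tau1"
  unfolding t_seq_def by real_asymp

lemma t_seq_pos: "\<forall>\<^sub>F n in sequentially. t_seq n > 0"
proof -
  have "tau1 > 0" using const_X_pos by (simp add: tau1_def)
  hence "\<forall>\<^sub>F n in sequentially. t_seq n * real n powr (3/5) > 0"
    by (rule order_tendstoD(1)[OF t_seq_scaled_lim])
  thus ?thesis
  proof eventually_elim
    case (elim n)
    thus ?case by (metis less_asym linorder_neqE_linordered_idom mult_eq_0_iff mult_neg_pos powr_gt_zero powr_ge_zero less_le)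
  qed
qed

text \<open>The value of \<open>tau1\<close> normalises the leading term to \<open>n\<close>, and
  the second term becomes \<open>n\<close> times \<open>- 5/3 * y\<close> up to the factor
  \<open>s powr (-3/2)\<close>. Hence the mean is \<open>n * (1 + F y)\<close> up to the error term.
  As \<open>F y\<close> is \<open>o (y\<^sup>2)\<close> with \<open>y\<^sup>2\<close> of order
  \<open>n powr (-1/5)\<close>, the deviation from \<open>n\<close> is below
  \<open>n powr (4/5)\<close>.\<close>

lemma mean_at_t_seq:
  fixes \<mu> :: "real \<Rightarrow> real"
  assumes C: "\<And>t. t > 0 \<Longrightarrow> \<bar>\<mu> t - 2 powr (5/3) * (Gamma (1/3))\<^sup>2 / 9 * zeta_real (5/3) * t powr (-5/3)
        - sqrt (pi / 2) * zeta_real (1/2) * zeta_real (3/2) * t powr (-3/2)\<bar> \<le> C * t powr (-5/4)"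
  shows "(\<lambda>n. (\<mu> (t_seq n) - real n) / real n powr (4/5)) \<longlonglongrightarrow> 0"
proof -
  have X: "const_X > 0" by (rule const_X_pos)
  have tau1: "tau1 > 0" using X by (simp add: tau1_def)
  define a where "a = 3 * const_Y / (20 * const_X ^ 3)"
  define y where "y = (\<lambda>n. a * real n powr (-1/10))"
  define F where "F = (\<lambda>y::real. (1 - y - y\<^sup>2 / 6) powr (-5/3) - 5/3 * y * (1 - y - y\<^sup>2 / 6) powr (-3/2) - 1)"
  define \<alpha> where "\<alpha> = 2 powr (5/3) * (Gamma (1/3))\<^sup>2 / 9 * zeta_real (5/3)"
  define \<beta> where "\<beta> = sqrt (pi / 2) * zeta_real (1/2) * zeta_real (3/2)"
  have y0: "y \<longlonglongrightarrow> 0" unfolding y_def by real_asymp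
  have \<alpha>: "\<alpha> = tau1 powr (5/3)"
  proof -
    define Q where "Q = 1 / 9 * (Gamma (1/3))\<^sup>2 * zeta_real (5/3)"
    have XQ: "const_X = Q powr (3/10)" by (simp add: const_X_def Q_def)
    have "Q \<noteq> 0" using X XQ by auto
    moreover have "Q \<ge> 0"
    proof -
      have "zeta_real (5/3) \<ge> 0"
        by (rule sums_le[OF _ sums_zero zeta_real_sums[of "5/3"]]) auto
      thus ?thesis by (simp add: Q_def)
    qed
    ultimately have Q: "Q > 0" by simp
    have "tau1 powr (5/3) = (2 * const_X powr 2) powr (5/3)" using X by (simp add: tau1_def)
    also have "\<dots> = 2 powr (5/3) * (const_X powr 2) powr (5/3)" by (rule powr_mult)
    also have "(const_X powr 2) powr (5/3) = Q powr 1" unfolding XQ powr_powr by simp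
    finally show ?thesis using Q by (simp add: \<alpha>_def Q_def)
  qed
  have \<beta>: "\<beta> * tau1 powr (-3/2) = - (5/3) * a"
  proof -
    have "tau1 powr (-3/2) = (2 * const_X powr 2) powr (-3/2)" using X by (simp add: tau1_def)
    also have "\<dots> = 2 powr (-3/2) * (const_X powr 2) powr (-3/2)" by (rule powr_mult)
    also have "(const_X powr 2) powr (-3/2) = const_X powr (-3)" unfolding powr_powr by simp
    also have "const_X powr (-3) = 1 / const_X ^ 3" using X by (simp add: powr_minus_divide)
    finally have 1: "tau1 powr (-3/2) = 2 powr (-3/2) * (1 / const_X ^ 3)" .
    have "(2::real) powr (-3/2) = 2 powr (-1 + -1/2)" by simp
    also have "\<dots> = 2 powr (-1) * 2 powr (-1/2)" by (rule powr_add)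
    also have "\<dots> = 1 / (2 * sqrt 2)" by (simp add: powr_minus_divide powr_half_sqrt)
    finally have 2: "(2::real) powr (-3/2) = 1 / (2 * sqrt 2)" .
    have "\<beta> = - const_Y / sqrt 2" by (simp add: \<beta>_def const_Y_def real_sqrt_divide)
    hence "\<beta> * tau1 powr (-3/2) = - (const_Y / (sqrt 2 * (2 * sqrt 2)) / const_X ^ 3)"
      unfolding 1 2 by simp
    also have "sqrt 2 * (2 * sqrt 2) = (4 :: real)" by simp
    finally show ?thesis by (simp add: a_def)
  qed
  have F0: "((\<lambda>y. F y / y\<^sup>2) \<longlongrightarrow> 0) (at 0)"
    unfolding F_def by (rule mean_expansion_remainder)
  have lim1: "(\<lambda>n. real n powr (1/5) * F (y n)) \<longlonglongrightarrow> 0"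
  \<comment> \<open>If \<open>a = 0\<close>, then \<open>y\<close> never leaves 0 and the limit over
    the punctured neighbourhood does not apply, but then \<open>F (y n) = F 0 = 0\<close>.\<close>
  proof (cases "a = 0")
    case True
    hence "F (y n) = 0" for n by (simp add: y_def F_def)
    thus ?thesis by simp
  next
    case False
    have "filterlim y (at 0) sequentially"
      using y0 False by (intro filterlim_atI) (auto simp: y_def intro!: eventually_mono[OF eventually_gt_at_top[of 0]])
    hence "(\<lambda>n. F (y n) / (y n)\<^sup>2) \<longlonglongrightarrow> 0"
      by (rule filterlim_compose[OF F0])
    hence "(\<lambda>n. a\<^sup>2 * (F (y n) / (y n)\<^sup>2)) \<longlonglongrightarrow> a\<^sup>2 * 0" by (intro tendsto_intros)
    moreover have "\<forall>\<^sub>F n in sequentially. a\<^sup>2 * (F (y n) / (y n)\<^sup>2) = real n powr (1/5) * F (y n)"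
      using eventually_gt_at_top[of 0]
    proof eventually_elim
      case (elim n)
      have "(y n)\<^sup>2 = a\<^sup>2 * (real n powr (-1/10) * real n powr (-1/10))" by (simp add: y_def power2_eq_square)
      also have "real n powr (-1/10) * real n powr (-1/10) = real n powr (- (1/5))"
        by (simp only: powr_add[symmetric]) simp
      also have "\<dots> = 1 / real n powr (1/5)" by (rule powr_minus_divide)
      finally have y2: "(y n)\<^sup>2 = a\<^sup>2 * (1 / real n powr (1/5))" .
      have "a\<^sup>2 * (f / (a\<^sup>2 * (1 / r))) = r * f" if "r \<noteq> 0" for f r :: real
        using that False by simp
      moreover have "real n powr (1/5) \<noteq> 0" using elim by simp
      ultimately show ?case unfolding y2 by blast
    qed
    ultimately show ?thesis by (simp add: tendsto_cong)
  qed
  have lim2: "(\<lambda>n. C * t_seq n powr (-5/4) / real n powr (4/5)) \<longlonglongrightarrow> 0"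
  proof -
    \<comment> \<open>The margin gained by the exponent \<open>5/4\<close>: the error is of order
      \<open>n powr (3/4)\<close>, and \<open>3/4 - 4/5 = -1/20\<close>.\<close>
    have "(\<lambda>n. C * (t_seq n * real n powr (3/5)) powr (-5/4) * real n powr (-1/20)) \<longlonglongrightarrow> C * tau1 powr (-5/4) * 0"
      using tau1 by (intro tendsto_mult tendsto_const tendsto_powr t_seq_scaled_lim) (auto, real_asymp)
    moreover have "\<forall>\<^sub>F n in sequentially. C * (t_seq n * real n powr (3/5)) powr (-5/4) * real n powr (-1/20)
        = C * t_seq n powr (-5/4) / real n powr (4/5)"
      using eventually_gt_at_top[of 0]
    proof eventually_elim
      case (elim n)
      have "(t_seq n * real n powr (3/5)) powr (-5/4) * real n powr (-1/20) 
          = t_seq n powr (-5/4) * (real n powr (3/5 * (-5/4)) * real n powr (-1/20))"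
        by (simp only: powr_mult powr_powr mult.assoc)
      also have "real n powr (3/5 * (-5/4)) * real n powr (-1/20) = real n powr (- (4/5))"
        by (simp only: powr_add[symmetric]) simp
      also have "\<dots> = 1 / real n powr (4/5)" by (rule powr_minus_divide)
      finally have "(t_seq n * real n powr (3/5)) powr (-5/4) * real n powr (-1/20) 
          = t_seq n powr (-5/4) * (1 / real n powr (4/5))" .
      from arg_cong[OF this, of "\<lambda>r. C * r"] show ?case by (simp only: mult.assoc times_divide_eq_right mult_1_right)
    qed
    ultimately show ?thesis by (simp add: tendsto_cong)
  qed
  have "(\<lambda>n. 1 - y n - (y n)\<^sup>2 / 6) \<longlonglongrightarrow> 1 - 0 - 0\<^sup>2 / 6"
    by (intro tendsto_intros y0) auto
  hence pos: "\<forall>\<^sub>F n in sequentially. 1 - y n - (y n)\<^sup>2 / 6 > 0"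
    by (rule order_tendstoD) simp
  show ?thesis
  proof (rule Lim_null_comparison)
    show "(\<lambda>n. \<bar>real n powr (1/5) * F (y n)\<bar> + C * t_seq n powr (-5/4) / real n powr (4/5)) \<longlonglongrightarrow> 0"
      using tendsto_add[OF tendsto_rabs[OF lim1] lim2] by simp
    show "\<forall>\<^sub>F n in sequentially. norm ((\<mu> (t_seq n) - real n) / real n powr (4/5)) 
        \<le> \<bar>real n powr (1/5) * F (y n)\<bar> + C * t_seq n powr (-5/4) / real n powr (4/5)"
      using pos t_seq_pos eventually_gt_at_top[of 0]
    proof eventually_elim
      case (elim n)
      define s where "s = 1 - y n - (y n)\<^sup>2 / 6"
      define N where "N = real n powr (-3/5)"
      have s: "s > 0" and n: "real n > 0" using elim by (auto simp: s_def)
      have t: "t_seq n = tau1 * N * s"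
        using t_seq_eq[of n] elim by (simp add: s_def y_def a_def N_def)
      have N: "N powr (-5/3) = real n" "N powr (-3/2) = real n * real n powr (-1/10)"
      proof -
        show "N powr (-5/3) = real n" unfolding N_def powr_powr using n by simp
        have "N powr (-3/2) = real n powr (1 + -1/10)" unfolding N_def powr_powr by simp
        thus "N powr (-3/2) = real n * real n powr (-1/10)" using n by (simp only: powr_add) simp
      qed
      have t1: "\<alpha> * t_seq n powr (-5/3) = real n * s powr (-5/3)"
      proof -
        have "tau1 powr (5/3) * tau1 powr (-5/3) = 1" using tau1 by (simp only: powr_add[symmetric]) simp
        thus ?thesis unfolding t \<alpha> powr_mult N(1) by (simp add: mult.assoc[symmetric])
      qed
      have t2: "\<beta> * t_seq n powr (-3/2) = - (real n * (5/3 * y n * s powr (-3/2)))"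
      proof -
        have "\<beta> * t_seq n powr (-3/2) = (\<beta> * tau1 powr (-3/2)) * (real n * real n powr (-1/10)) * s powr (-3/2)"
          unfolding t powr_mult N(2) by (simp only: mult.assoc)
        also have "\<dots> = - (real n * (5/3 * y n * s powr (-3/2)))" unfolding \<beta> y_def by simp
        finally show ?thesis .
      qed
      have "\<alpha> * t_seq n powr (-5/3) + \<beta> * t_seq n powr (-3/2) - real n = real n * F (y n)"
        unfolding t1 t2 F_def s_def[symmetric] by (simp add: algebra_simps)
      hence "\<mu> (t_seq n) - real n = real n * F (y n) + (\<mu> (t_seq n) - \<alpha> * t_seq n powr (-5/3) - \<beta> * t_seq n powr (-3/2))"
        by linarith
      also have "\<bar>\<dots>\<bar> \<le> \<bar>real n * F (y n)\<bar> + C * t_seq n powr (-5/4)"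
        using C[OF elim(2), folded \<alpha>_def \<beta>_def] by linarith
      finally have "\<bar>\<mu> (t_seq n) - real n\<bar> / real n powr (4/5) 
          \<le> (\<bar>real n * F (y n)\<bar> + C * t_seq n powr (-5/4)) / real n powr (4/5)"
        by (intro divide_right_mono) auto
      also have "\<dots> = \<bar>real n powr (1/5) * F (y n)\<bar> + C * t_seq n powr (-5/4) / real n powr (4/5)"
      proof -
        have "real n / real n powr (4/5) = real n powr (1/5)"
          using n powr_diff[of "real n" 1 "4/5"] by simp
        moreover have "\<bar>real n * F (y n)\<bar> / real n powr (4/5) = real n / real n powr (4/5) * \<bar>F (y n)\<bar>"
          by (simp add: abs_mult)
        ultimately have "\<bar>real n * F (y n)\<bar> / real n powr (4/5) = real n powr (1/5) * \<bar>F (y n)\<bar>" by (simp only:)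
        thus ?thesis by (simp add: add_divide_distrib abs_mult)
      qed
      finally show ?case by simp
    qed
  qed
qed

section \<open>The normal limit and the change of centring\<close>

theorem theorem9p3:
  fixes M :: "real \<Rightarrow> 'a measure"
    and X :: "real \<Rightarrow> nat \<Rightarrow> nat \<Rightarrow> 'a \<Rightarrow> nat"
    and N :: "real \<Rightarrow> 'a \<Rightarrow> real"
    and \<phi> :: "real \<Rightarrow> real \<Rightarrow> complex"
    and \<sigma> :: "nat \<Rightarrow> real"
    and u :: real
  assumes "\<And>t. t > 0 \<Longrightarrow> prob_space (M t)"
    and "\<And>t. t > 0 \<Longrightarrow> prob_space.indep_vars (M t) (\<lambda>_. count_space UNIV)
            (\<lambda>(j, k). X t j k) ({1..} \<times> {1..})"
    and "\<And>t j k m. \<lbrakk>t > 0; j \<ge> 1; k \<ge> 1\<rbrakk> \<Longrightarrow>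
            measure (M t) {\<omega> \<in> space (M t). X t j k \<omega> = m}
              = (1 - exp (- (weight j k * t))) * exp (- (weight j k * real m * t))"
    and "\<And>t. N t = weighted_sum (X t)"
    and "\<And>t v. \<phi> t v = char_fn (M t) (N t) v"
    and "\<And>n. \<sigma> n = sqrt (prob_space.variance (M (t_seq n)) (N (t_seq n)))"
  shows "(\<lambda>n. \<phi> (t_seq n) (u / \<sigma> n) * exp (- (\<i> * complex_of_real (real n * u / \<sigma> n))))
           \<longlonglongrightarrow> complex_of_real (exp (- u\<^sup>2 / 2))"
proof -
  obtain C \<mu> where C: "C > 0" 
    and \<mu>: "\<And>t. t > 0 \<Longrightarrow> ((\<lambda>p. pair_weight p / (exp (pair_weight p * t) - 1)) has_sum \<mu> t) pairs"
    and asym: "\<And>t. t > 0 \<Longrightarrow> \<bar>\<mu> t - 2 powr (5/3) * (Gamma (1/3))\<^sup>2 / 9 * zeta_real (5/3) * t powr (-5/3)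
        - sqrt (pi / 2) * zeta_real (1/2) * zeta_real (3/2) * t powr (-3/2)\<bar> \<le> C * t powr (-5/4)"
    using bose_weight_sum by blast
  define D where "D = \<bar>2 powr (5/3) * (Gamma (1/3))\<^sup>2 / 9 * zeta_real (5/3)\<bar> + \<bar>sqrt (pi / 2) * zeta_real (1/2) * zeta_real (3/2)\<bar> + C"
  have D: "D > 0" using C by (simp add: D_def)
  have \<mu>_le: "\<mu> t \<le> D * t powr (-5/3)" if t: "t > 0" "t \<le> 1" for t
  proof -
    define a b where "a = 2 powr (5/3) * (Gamma (1/3))\<^sup>2 / 9 * zeta_real (5/3)" 
      and "b = sqrt (pi / 2) * zeta_real (1/2) * zeta_real (3/2)"
    have "\<mu> t \<le> a * t powr (-5/3) + b * t powr (-3/2) + C * t powr (-5/4)"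
      using asym[OF t(1)] unfolding a_def b_def by linarith
    also have "\<dots> \<le> \<bar>a\<bar> * t powr (-5/3) + \<bar>b\<bar> * t powr (-5/3) + C * t powr (-5/3)"
      using t C by (intro add_mono mult_mono powr_mono') auto
    finally show ?thesis by (simp add: D_def a_def b_def algebra_simps)
  qed
  define T where "T = tau1"
  have T: "T > 0" using const_X_pos by (simp add: T_def tau1_def)
  define err where "err = (\<lambda>n. (\<mu> (t_seq n) - real n) / real n powr (4/5))"
  have err: "err \<longlonglongrightarrow> 0" unfolding err_def by (rule mean_at_t_seq[OF asym])
  \<comment> \<open>For the third moments the powers of \<open>n\<close> are \<open>-12/5\<close>
    from \<open>(1 / \<sigma> n) ^ 3\<close>, \<open>6/5\<close> from \<open>1 / t\<^sup>2\<close>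
    and \<open>1\<close> from \<open>\<mu> (t / 2)\<close>, altogether \<open>-1/5\<close>. For the
    Gaussian comparison they are \<open>-8/5\<close> from \<open>1 / V\<close> and
    \<open>6/5\<close> from \<open>1 / t\<^sup>2\<close>, altogether \<open>-2/5\<close>.\<close>
  define K1 where "K1 = \<bar>u\<bar> ^ 3 / 6 * (28 * (4 / T\<^sup>2) * (D * (T / 4) powr (-5/3))) * (sqrt (4 * T)) ^ 3"
  define K2 where "K2 = u ^ 4 * (4 / T\<^sup>2) * (4 * T)"
  \<comment> \<open>Positivity of \<open>t_seq n\<close> holds only eventually, and outside that
    range the assumptions give no probability space. The factors \<open>1/2\<close> and 2 around the
    limit \<open>T\<close>, and the factor \<open>1/2\<close> in the bound for the mean, are the
    source of the numerical constants in \<open>K1\<close> and \<open>K2\<close>.\<close>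
  have ev: "\<forall>\<^sub>F n in sequentially. n > 0 \<and> t_seq n > 0 \<and> t_seq n \<le> 1 \<and> T / 2 * real n powr (-3/5) \<le> t_seq n 
      \<and> t_seq n \<le> 2 * T * real n powr (-3/5) \<and> real n / 2 \<le> \<mu> (t_seq n)"
  proof -
    have 1: "\<forall>\<^sub>F n in sequentially. T / 2 < t_seq n * real n powr (3/5)"
      using T by (intro order_tendstoD(1)[OF t_seq_scaled_lim]) (simp add: T_def)
    have 2: "\<forall>\<^sub>F n in sequentially. t_seq n * real n powr (3/5) < 2 * T"
      using T by (intro order_tendstoD(2)[OF t_seq_scaled_lim]) (simp add: T_def)
    have "(\<lambda>n. 2 * T * real n powr (-3/5)) \<longlonglongrightarrow> 0" by real_asymp
    hence 3: "\<forall>\<^sub>F n in sequentially. 2 * T * real n powr (-3/5) < 1" by (rule order_tendstoD) simp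
    have "(\<lambda>n. err n * real n powr (-1/5)) \<longlonglongrightarrow> 0 * 0"
      by (intro tendsto_mult err) real_asymp
    hence 4: "\<forall>\<^sub>F n in sequentially. err n * real n powr (-1/5) > -1/2" by (rule order_tendstoD) simp
    show ?thesis using 1 2 3 4 eventually_gt_at_top[of 0]
    proof eventually_elim
      case (elim n)
      have n: "real n > 0" using elim by simp
      define r where "r = real n powr (3/5)"
      have r: "r > 0" "real n powr (-3/5) = 1 / r"
        using n powr_minus_divide[of "real n" "3/5"] by (simp_all add: r_def)
      have lo: "T / 2 * (1 / r) \<le> t_seq n" using elim(1) r(1) by (simp add: r_def[symmetric] field_simps)
      have up: "t_seq n \<le> 2 * T * (1 / r)" using elim(2) r(1) by (simp add: r_def[symmetric] field_simps)
      have "t_seq n > 0" using lo T r(1) by (smt (verit) divide_pos_pos mult_pos_pos)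
      moreover have "t_seq n \<le> 1" using up elim(3) r(2) by simp
      moreover have "real n / 2 \<le> \<mu> (t_seq n)"
      proof -
        have "real n powr (4/5) * real n powr (1/5) = real n" 
          using n by (simp only: powr_add[symmetric]) simp
        moreover have "real n powr (-1/5) = 1 / real n powr (1/5)" using powr_minus_divide[of "real n" "1/5"] by simp
        ultimately have "err n * real n powr (-1/5) = (\<mu> (t_seq n) - real n) / real n"
          by (simp add: err_def)
        hence "(\<mu> (t_seq n) - real n) / real n > -1/2" using elim(4) by simp
        thus ?thesis using n by (simp add: field_simps)
      qed
      ultimately show ?case using elim(5) lo up unfolding r(2) by blast
    qed
  qed
  \<comment> \<open>The characteristic function centred at the exact mean. The required one differs
    from it by a deterministic factor of modulus 1, whose phase is bounded by a multiple of
    \<open>err n\<close> and tends to 0.\<close>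
  define \<psi> where "\<psi> = (\<lambda>n. integral\<^sup>L (M (t_seq n)) (\<lambda>\<omega>. exp (\<i> * complex_of_real (u / \<sigma> n * (N (t_seq n) \<omega> - \<mu> (t_seq n))))))"
  have key: "\<forall>\<^sub>F n in sequentially. 
      cmod (\<psi> n - complex_of_real (exp (- u\<^sup>2 / 2))) \<le> K1 * real n powr (-1/5) + K2 * real n powr (-2/5) \<and>
      \<phi> (t_seq n) (u / \<sigma> n) * exp (- (\<i> * complex_of_real (real n * u / \<sigma> n))) 
        = \<psi> n * exp (\<i> * complex_of_real (u / \<sigma> n * (\<mu> (t_seq n) - real n))) \<and>
      \<bar>u / \<sigma> n * (\<mu> (t_seq n) - real n)\<bar> \<le> \<bar>u\<bar> * sqrt (4 * T) * \<bar>err n\<bar>"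
    using ev
  proof eventually_elim
    case (elim n)
    define t where "t = t_seq n"
    have n: "real n > 0" and t: "t > 0" "t \<le> 1" and lo: "T / 2 * real n powr (-3/5) \<le> t" 
      and up: "t \<le> 2 * T * real n powr (-3/5)" and \<mu>n: "real n / 2 \<le> \<mu> t"
      using elim by (auto simp: t_def)
    interpret prob_space "M t" by (rule assms(1)[OF t(1)])
    define V where "V = variance (N t)"
    define v where "v = u / \<sigma> n"
    have \<sigma>: "\<sigma> n = sqrt V" by (simp add: assms(6) V_def t_def)
    note approx = weighted_sum_normal_approx[OF t(1) assms(2)[OF t(1), folded pairs_def] assms(3)[OF t(1)] \<mu>, folded assms(4)]
    \<comment> \<open>Here \<open>4 * T\<close> combines \<open>\<mu> t >= n / 2\<close> with
      \<open>t <= 2 * T * n powr (-3/5)\<close> in the lower bound \<open>\<mu> t / t\<close> for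
      the variance.\<close>
    have "real n powr (8/5) / (4 * T) = real n / 2 / (2 * T * real n powr (-3/5))"
    proof -
      have "real n powr 1 / real n powr (-3/5) = real n powr (8/5)"
        by (simp only: powr_diff[symmetric]) simp
      thus ?thesis using n T by (simp add: field_simps)
    qed
    also have "\<dots> \<le> \<mu> t / t" using \<mu>n up t n T by (intro frac_le) auto
    also have "\<dots> \<le> V" unfolding V_def by (rule approx(2))
    finally have V_ge: "real n powr (8/5) / (4 * T) \<le> V" .
    have r0: "real n powr (8/5) > 0" using n by simp
    have V: "V > 0" using V_ge r0 T by (smt (verit) divide_pos_pos)
    have \<sigma>0: "\<sigma> n > 0" using V by (simp add: \<sigma>)
    have inv_\<sigma>: "1 / \<sigma> n \<le> sqrt (4 * T) * real n powr (-4/5)"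
    proof -
      have "sqrt (real n powr (8/5) / (4 * T)) \<le> \<sigma> n" unfolding \<sigma> using V_ge by (rule real_sqrt_le_mono)
      moreover have "sqrt (real n powr (8/5)) = real n powr (4/5)"
        by (simp add: powr_half_sqrt[symmetric] powr_powr)
      ultimately have "real n powr (4/5) / sqrt (4 * T) \<le> \<sigma> n" by (simp only: real_sqrt_divide)
      moreover have "real n powr (4/5) / sqrt (4 * T) > 0" using n T by simp
      ultimately have "1 / \<sigma> n \<le> 1 / (real n powr (4/5) / sqrt (4 * T))"
        by (rule frac_le[OF zero_le_one order_refl, rotated])
      also have "\<dots> = sqrt (4 * T) * (1 / real n powr (4/5))" by simp
      also have "1 / real n powr (4/5) = real n powr (-4/5)" using powr_minus_divide[of "real n" "4/5"] by simp
      finally show ?thesis .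
    qed
    have inv_V: "1 / V \<le> 4 * T * real n powr (-8/5)"
    proof -
      have "1 / V \<le> 1 / (real n powr (8/5) / (4 * T))" using V_ge r0 T by (intro frac_le) auto
      also have "\<dots> = 4 * T * (1 / real n powr (8/5))" by simp
      also have "1 / real n powr (8/5) = real n powr (-8/5)" using powr_minus_divide[of "real n" "8/5"] by simp
      finally show ?thesis .
    qed
    have inv_t2: "1 / t\<^sup>2 \<le> 4 / T\<^sup>2 * real n powr (6/5)"
    proof -
      have p: "T / 2 * real n powr (-3/5) > 0" using T n by simp
      have "(T / 2 * real n powr (-3/5))\<^sup>2 \<le> t\<^sup>2" using lo p by (intro power_mono) auto
      hence "1 / t\<^sup>2 \<le> 1 / (T / 2 * real n powr (-3/5))\<^sup>2" using p n by (intro frac_le) auto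
      also have "(T / 2 * real n powr (-3/5))\<^sup>2 = T\<^sup>2 / 4 * (real n powr (-3/5) * real n powr (-3/5))"
        by (simp add: power2_eq_square)
      also have "real n powr (-3/5) * real n powr (-3/5) = real n powr (- (6/5))"
        by (simp only: powr_add[symmetric]) simp
      also have "\<dots> = 1 / real n powr (6/5)" by (rule powr_minus_divide)
      finally show ?thesis by simp
    qed
    have \<mu>2: "\<mu> (t / 2) \<le> D * (T / 4) powr (-5/3) * real n"
    proof -
      have "\<mu> (t / 2) \<le> D * (t / 2) powr (-5/3)" using t by (intro \<mu>_le) auto
      also have "(t / 2) powr (-5/3) \<le> (T / 4 * real n powr (-3/5)) powr (-5/3)"
        using lo T n by (intro powr_mono2') auto
      also have "(T / 4 * real n powr (-3/5)) powr (-5/3) = (T / 4) powr (-5/3) * real n"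
        unfolding powr_mult powr_powr using n by simp
      finally show ?thesis using D by (simp add: mult.assoc)
    qed
    have V1: "v\<^sup>2 * V = u\<^sup>2" using V by (simp add: v_def \<sigma> power_divide)
    have "cmod (\<psi> n - complex_of_real (exp (- u\<^sup>2 / 2))) 
       \<le> \<bar>v\<bar> ^ 3 / 6 * (28 / t\<^sup>2 * \<mu> (t / 2)) + v ^ 4 / 8 * (8 / t\<^sup>2) * V"
      using approx(3)[of v, folded V_def] unfolding V1 \<psi>_def t_def[symmetric] v_def[symmetric] by simp
    also have "\<dots> \<le> K1 * real n powr (-1/5) + K2 * real n powr (-2/5)"
    proof (rule add_mono)
      have \<mu>0: "\<mu> (t / 2) \<ge> 0"
      proof (rule has_sum_nonneg[OF \<mu>])
        fix p assume "p \<in> pairs"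
        hence "pair_weight p \<ge> 1" by (rule pair_weight_ge_1)
        thus "0 \<le> pair_weight p / (exp (pair_weight p * (t / 2)) - 1)" using t by simp
      qed (use t in simp)
      have v3: "\<bar>v\<bar> ^ 3 \<le> \<bar>u\<bar> ^ 3 * ((sqrt (4 * T)) ^ 3 * real n powr (-12/5))"
      proof -
        have "\<bar>v\<bar> ^ 3 = \<bar>u\<bar> ^ 3 * (1 / \<sigma> n) ^ 3" using \<sigma>0 by (simp add: v_def power_divide)
        also have "\<dots> \<le> \<bar>u\<bar> ^ 3 * (sqrt (4 * T) * real n powr (-4/5)) ^ 3"
          using inv_\<sigma> \<sigma>0 by (intro mult_left_mono power_mono) auto
        also have "(sqrt (4 * T) * real n powr (-4/5)) ^ 3 
           = (sqrt (4 * T)) ^ 3 * (real n powr (-4/5) * real n powr (-4/5) * real n powr (-4/5))"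
          by (simp only: power3_eq_cube mult_ac)
        also have "real n powr (-4/5) * real n powr (-4/5) * real n powr (-4/5) = real n powr (-12/5)"
          by (simp only: powr_add[symmetric]) simp
        finally show ?thesis .
      qed
      have "28 / t\<^sup>2 * \<mu> (t / 2) = 28 * (1 / t\<^sup>2) * \<mu> (t / 2)" by simp
      also have "\<dots> \<le> 28 * (4 / T\<^sup>2 * real n powr (6/5)) * (D * (T / 4) powr (-5/3) * real n)"
        using inv_t2 \<mu>2 \<mu>0 T by (intro mult_mono) auto
      finally have M: "28 / t\<^sup>2 * \<mu> (t / 2) \<le> 28 * (4 / T\<^sup>2 * real n powr (6/5)) * (D * (T / 4) powr (-5/3) * real n)" .
      have "\<bar>v\<bar> ^ 3 / 6 * (28 / t\<^sup>2 * \<mu> (t / 2)) 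
         \<le> \<bar>u\<bar> ^ 3 * ((sqrt (4 * T)) ^ 3 * real n powr (-12/5)) / 6 * 
            (28 * (4 / T\<^sup>2 * real n powr (6/5)) * (D * (T / 4) powr (-5/3) * real n))"
        by (rule mult_mono[OF divide_right_mono[OF v3] M]) (use \<mu>0 T in auto)
      also have "\<dots> = K1 * (real n powr (-12/5) * real n powr (6/5) * real n)"
        by (simp add: K1_def)
      also have "real n powr (-12/5) * real n powr (6/5) * real n = real n powr (-12/5) * real n powr (6/5) * real n powr 1"
        using n by simp
      also have "\<dots> = real n powr (-1/5)" by (simp only: powr_add[symmetric]) simp
      finally show "\<bar>v\<bar> ^ 3 / 6 * (28 / t\<^sup>2 * \<mu> (t / 2)) \<le> K1 * real n powr (-1/5)" .
      have "v\<^sup>2 = u\<^sup>2 / V" using V by (simp add: v_def \<sigma> power_divide)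
      moreover have "v ^ 4 = (v\<^sup>2)\<^sup>2" by simp
      ultimately have "v ^ 4 = (u\<^sup>2 / V)\<^sup>2" by (simp only:)
      hence "v ^ 4 / 8 * (8 / t\<^sup>2) * V = u ^ 4 * (1 / t\<^sup>2) * (1 / V)"
        using V by (simp add: power_divide power2_eq_square power4_eq_xxxx mult_ac)
      also have "\<dots> \<le> u ^ 4 * (4 / T\<^sup>2 * real n powr (6/5)) * (4 * T * real n powr (-8/5))"
        using inv_t2 inv_V V T t by (intro mult_mono) auto
      also have "\<dots> = K2 * (real n powr (6/5) * real n powr (-8/5))" by (simp add: K2_def)
      also have "real n powr (6/5) * real n powr (-8/5) = real n powr (-2/5)"
        by (simp only: powr_add[symmetric]) simp
      finally show "v ^ 4 / 8 * (8 / t\<^sup>2) * V \<le> K2 * real n powr (-2/5)" .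
    qed
    finally have A: "cmod (\<psi> n - complex_of_real (exp (- u\<^sup>2 / 2))) \<le> K1 * real n powr (-1/5) + K2 * real n powr (-2/5)" .
    have B: "\<phi> t v * exp (- (\<i> * complex_of_real (real n * u / \<sigma> n))) 
        = \<psi> n * exp (\<i> * complex_of_real (v * (\<mu> t - real n)))"
    proof -
      have "exp (\<i> * complex_of_real (v * N t \<omega>)) * exp (- (\<i> * complex_of_real (real n * u / \<sigma> n)))
          = exp (\<i> * complex_of_real (v * (N t \<omega> - \<mu> t))) * exp (\<i> * complex_of_real (v * (\<mu> t - real n)))" for \<omega>
        unfolding exp_add[symmetric] by (rule arg_cong[of _ _ exp]) (simp add: v_def algebra_simps)
      moreover have "\<phi> t v * exp (- (\<i> * complex_of_real (real n * u / \<sigma> n))) 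
          = expectation (\<lambda>\<omega>. exp (\<i> * complex_of_real (v * N t \<omega>)) * exp (- (\<i> * complex_of_real (real n * u / \<sigma> n))))"
        unfolding assms(5) char_fn_def by (rule integral_mult_left_zero[symmetric])
      moreover have "\<psi> n * exp (\<i> * complex_of_real (v * (\<mu> t - real n))) 
          = expectation (\<lambda>\<omega>. exp (\<i> * complex_of_real (v * (N t \<omega> - \<mu> t))) * exp (\<i> * complex_of_real (v * (\<mu> t - real n))))"
        unfolding \<psi>_def t_def[symmetric] v_def[symmetric] by (rule integral_mult_left_zero[symmetric])
      ultimately show ?thesis by simp
    qed
    have "\<bar>v * (\<mu> t - real n)\<bar> = \<bar>u\<bar> * (1 / \<sigma> n) * \<bar>\<mu> t - real n\<bar>"
      using \<sigma>0 by (simp add: v_def abs_mult)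
    also have "\<dots> \<le> \<bar>u\<bar> * (sqrt (4 * T) * real n powr (-4/5)) * \<bar>\<mu> t - real n\<bar>"
      by (intro mult_right_mono mult_left_mono inv_\<sigma>) auto
    also have "real n powr (-4/5) = 1 / real n powr (4/5)" using powr_minus_divide[of "real n" "4/5"] by simp
    also have "\<bar>u\<bar> * (sqrt (4 * T) * (1 / real n powr (4/5))) * \<bar>\<mu> t - real n\<bar> = \<bar>u\<bar> * sqrt (4 * T) * \<bar>err n\<bar>"
      by (simp add: err_def t_def)
    finally show ?case using A B unfolding t_def v_def by blast
  qed
  have "(\<lambda>n. K1 * real n powr (-1/5) + K2 * real n powr (-2/5)) \<longlonglongrightarrow> 0" by real_asymp
  hence "(\<lambda>n. \<psi> n - complex_of_real (exp (- u\<^sup>2 / 2))) \<longlonglongrightarrow> 0"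
    by (rule Lim_null_comparison[rotated]) (use key in \<open>auto elim: eventually_mono\<close>)
  hence \<psi>: "\<psi> \<longlonglongrightarrow> complex_of_real (exp (- u\<^sup>2 / 2))" by (rule LIM_zero_cancel)
  have "(\<lambda>n. \<bar>u\<bar> * sqrt (4 * T) * \<bar>err n\<bar>) \<longlonglongrightarrow> \<bar>u\<bar> * sqrt (4 * T) * \<bar>0\<bar>"
    by (intro tendsto_intros err)
  hence "(\<lambda>n. \<bar>u\<bar> * sqrt (4 * T) * \<bar>err n\<bar>) \<longlonglongrightarrow> 0" by simp
  hence "(\<lambda>n. u / \<sigma> n * (\<mu> (t_seq n) - real n)) \<longlonglongrightarrow> 0"
    by (rule Lim_null_comparison[rotated]) (use key in \<open>auto elim: eventually_mono\<close>)
  hence "(\<lambda>n. exp (\<i> * complex_of_real (u / \<sigma> n * (\<mu> (t_seq n) - real n)))) \<longlonglongrightarrow> exp (\<i> * complex_of_real 0)"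
    by (intro tendsto_intros)
  hence "(\<lambda>n. \<psi> n * exp (\<i> * complex_of_real (u / \<sigma> n * (\<mu> (t_seq n) - real n)))) \<longlonglongrightarrow> complex_of_real (exp (- u\<^sup>2 / 2)) * exp (\<i> * complex_of_real 0)"
    by (intro tendsto_mult \<psi>)
  hence "(\<lambda>n. \<psi> n * exp (\<i> * complex_of_real (u / \<sigma> n * (\<mu> (t_seq n) - real n)))) \<longlonglongrightarrow> complex_of_real (exp (- u\<^sup>2 / 2))"
    by simp
  thus ?thesis
    by (rule Lim_transform_eventually) (use key in \<open>auto elim: eventually_mono\<close>)
qed

end
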